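(* Assume Hypotheses 4 and 5 (stated in the context) for some integer $r\ge 2$. If $\Gamma=\{(h_0(z),z): z\in K_0\}$ is positively invariant under the flow of the system $\dot a=f(a,z)$, $\dot z=g(a,z)$, then $h_0:K_0\to\mathbb{R}^n$ is $C^r$, and its first through $r$-th derivatives are bounded on $K_0$.
   Context: System $\dot a=f(a,z)$, $\dot z=g(a,z)$ with $(a,z)\in\mathbb{R}^n\times\mathbb{R}^m$, $x=(a,z)$; Euclidean inner product $\langle\cdot,\cdot\rangle$, Euclidean norm and induced operator norm $\|\cdot\|$. A set $\Gamma$ is positively invariant if for every $x\in\Gamma$ the solution $\Phi(t,x)$ exists for all $t\ge0$ and $\Phi(t,\Gamma)\subseteq\Gamma$ for $t\ge0$. Hypothesis 4: $K_0$ is an open, convex subset of $\mathbb{R}^m$; $h_0:K_0\to\mathbb{R}^n$ is $C^1$, and there exists $\eta>0$ with $\|Dh_0(z)\|<\eta$ for all $z\in K_0$. Hypothesis 5: There is an open neighborhood $U_0$ of $\{(h_0(z),z):z\in K_0\}$ on which $f,g$ are $C^r$ ($r\ge2$) with all their first through $r$-th derivatives bounded on $U_0$; and there exist a continuous positive function $\alpha:U_0\to\mathbb{R}$, a continuous nonnegative function $\ell:U_0\to\mathbb{R}$, and a constant $c_r>0$ such that for all $x\in U_0$: $\langle a',D_af(x)a'\rangle\ge\alpha(x)\|a'\|^2$ for all $a'\in\mathbb{R}^n$; $\langle z',D_zg(x)z'\rangle\le\ell(x)\|z'\|^2$ for all $z'\in\mathbb{R}^m$; and $\alpha(x)\ge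 r\ell(x)+(r+1)\eta\|D_ag(x)\|+c_r$. *)

theory Defs
  imports "HOL-Analysis.Analysis"
begin

text \<open>Higher Frechet derivatives.  The k-th derivative at a point x is encoded as a
k-multilinear map, represented as a function on lists of k direction vectors:
D k x [v1,...,vk] = D^k f(x)(v1,...,vk).\<close>

definition multilin :: "nat \<Rightarrow> ('a::real_vector list \<Rightarrow> 'b::real_vector) \<Rightarrow> bool" where
  "multilin k M \<longleftrightarrow>
     (\<forall>i<k. \<forall>vs. length vs = k \<longrightarrow> linear (\<lambda>v. M (vs[i := v])))"

definition ml_bound :: "nat \<Rightarrow> ('a::real_normed_vector list \<Rightarrow> 'b::real_normed_vector) \<Rightarrow> real \<Rightarrow> bool" where
  "ml_bound k M B \<longleftrightarrow>
     (\<forall>vs. length vs = k \<longrightarrow> norm (M vs) \<le> B * prod_list (map norm vs))"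

text \<open>D is the family of derivatives D^0 = f, D^1, ..., D^r of f on the open set S:
each D^k(x) is k-multilinear, D^(k+1) is the Frechet derivative of x \<mapsto> D^k(x)
(with respect to the operator norm on k-multilinear maps) for k < r, and each
x \<mapsto> D^k(x) is continuous on S (operator norm) for k \<le> r.\<close>
definition higher_derivs_on ::
  "nat \<Rightarrow> 'a::real_normed_vector set \<Rightarrow> ('a \<Rightarrow> 'b::real_normed_vector)
    \<Rightarrow> (nat \<Rightarrow> 'a \<Rightarrow> 'a list \<Rightarrow> 'b) \<Rightarrow> bool" where
  "higher_derivs_on r S f D \<longleftrightarrow>
     (\<forall>x\<in>S. D 0 x [] = f x) \<and>
     (\<forall>k\<le>r. \<forall>x\<in>S. multilin k (D k x)) \<and>
     (\<forall>k<r. \<forall>x\<in>S. \<forall>e>0. \<exists>d>0. \<forall>y\<in>S. norm (y - x) < d \<longrightarrow>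
        ml_bound k (\<lambda>vs. D k y vs - D k x vs - D (Suc k) x ((y - x) # vs)) (e * norm (y - x))) \<and>
     (\<forall>k\<le>r. \<forall>x\<in>S. \<forall>e>0. \<exists>d>0. \<forall>y\<in>S. norm (y - x) < d \<longrightarrow>
        ml_bound k (\<lambda>vs. D k y vs - D k x vs) e)"

definition Cr_on :: "nat \<Rightarrow> 'a::real_normed_vector set \<Rightarrow> ('a \<Rightarrow> 'b::real_normed_vector) \<Rightarrow> bool" where
  "Cr_on r S f \<longleftrightarrow> (\<exists>D. higher_derivs_on r S f D)"

definition Cr_bounded_on :: "nat \<Rightarrow> 'a::real_normed_vector set \<Rightarrow> ('a \<Rightarrow> 'b::real_normed_vector) \<Rightarrow> bool" where
  "Cr_bounded_on r S f \<longleftrightarrow>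
     (\<exists>D. higher_derivs_on r S f D \<and> (\<forall>k\<in>{1..r}. \<exists>B. \<forall>x\<in>S. ml_bound k (D k x) B))"

definition pos_invariant :: "('a::real_normed_vector \<Rightarrow> 'a) \<Rightarrow> 'a set \<Rightarrow> bool" where
  "pos_invariant F \<Gamma> \<longleftrightarrow>
     (\<forall>x\<in>\<Gamma>. \<exists>\<phi>. \<phi> 0 = x \<and>
        (\<forall>t\<ge>0. (\<phi> has_vector_derivative F (\<phi> t)) (at t within {0..})) \<and>
        (\<forall>t\<ge>0. \<phi> t \<in> \<Gamma>))"

end

theory Submission
  imports Defs
begin

text \<open>Write $G(z) = g(h(z), z)$ for the reduced vector field on $K_0$, where $h = h_0$.  Along a trajectory
  $z(t)$ of $G$, the derivative $Q = D^k h$, evaluated on solutions of the linearised reduced flow,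
  satisfies $Q' = L\,Q + R$ with $L = D_a f - Dh\,D_a g$ and with a remainder $R$ that only involves
  lower derivatives of $h$ (for $k = 1$ the equation is instead a Riccati equation, quadratic in $Q$).  By
  Hypothesis 5, $L$ expands at a rate that exceeds $k + 1$ times the growth rate
  $\ell + \eta \|D_a g\|$ of the linearised reduced flow by at least $c_r$, for each $k < r$.  So the
  difference of $Q$ along two trajectories is determined, up to a factor $e^{-c_r T/2}$, by the
  inhomogeneities on $[0, T]$.  Applied to $Q$ this gives a Lipschitz bound; applied to differences of difference
  quotients of $Q$ it shows that these converge locally uniformly, hence that $Q$ is $C^1$.
  Differentiating the equation along the flow yields the equation for $D^{k+1} h$, and one proceeds by
  induction on $k$.\<close>

section \<open>Functions with bounded continuous derivatives\<close>

text \<open>The obstacle is that \<open>Q\<close> is not yet known to be differentiable when its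
  equation is used: the equation holds only along trajectories, and these exist only in forward
  time. Nothing can be linearised in \<open>z\<close>, so nearby trajectories are compared over
  \<open>[0, T]\<close> and the estimates are carried from \<open>T\<close> back to 0, where the
  expansion of \<open>L\<close> becomes decay. The constants of Hypothesis 5 count exponents in this
  comparison: \<open>k\<close> growth factors come from the \<open>k\<close> arguments of
  \<open>Q\<close> and one from the distance of the trajectories, and the summand
  \<open>Dh D_a g\<close> of \<open>L\<close> costs one more \<open>\<eta> |D_a g|\<close>. At
  \<open>k = r - 1\<close> this makes \<open>r\<close> copies of \<open>ell\<close> and
  \<open>r + 1\<close> copies of \<open>\<eta> |D_a g|\<close>. Half of \<open>c_r\<close> pays for
  measuring the growth at the points of a reference trajectory, which leaves the rate
  \<open>c_r / 2\<close>. Derivatives of top order are bounded and continuous, but not uniformly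
  continuous, so no single radius serves all times. Therefore \<open>T\<close> is fixed before the
  tolerance, and compactness of the trajectory segment over \<open>[0, T]\<close> gives the
  radius.\<close>

definition dd :: "'a::real_normed_vector \<Rightarrow> ('a \<Rightarrow> 'b::real_normed_vector) \<Rightarrow> 'a \<Rightarrow> 'b"
  where "dd v F x = frechet_derivative F (at x) v"

lemma dd_eq: "(F has_derivative F') (at x) \<Longrightarrow> dd v F x = F' v"
  unfolding dd_def by (metis frechet_derivative_at)

lemma has_derivative_dd: "F differentiable (at x) \<Longrightarrow> (F has_derivative (\<lambda>v. dd v F x)) (at x)"
  unfolding dd_def using frechet_derivative_works by blast

lemma linear_dd: "F differentiable (at x) \<Longrightarrow> linear (\<lambda>v. dd v F x)"
  using has_derivative_dd has_derivative_linear by blast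

text \<open>No differentiability is assumed: functions that agree near \<open>x\<close> have the
  same Frechet derivatives there, so the choice operator in \<open>frechet_derivative\<close>
  returns the same map for both.\<close>

lemma dd_transform:
  assumes "open S" "x \<in> S" "\<And>y. y \<in> S \<Longrightarrow> F y = H y"
  shows "dd v F x = dd v H x"
proof -
  have "(F has_derivative F') (at x) = (H has_derivative F') (at x)" for F'
    using assms by (metis has_derivative_transform_within_open)
  thus ?thesis by (simp add: dd_def frechet_derivative_def)
qed

text \<open>Derivatives are taken in constant directions, one at a time, so that derivatives of all orders have
  the same type as the function itself.\<close>

primrec Cb :: "nat \<Rightarrow> 'a::real_normed_vector set \<Rightarrow> ('a \<Rightarrow> 'b::real_normed_vector) \<Rightarrow> bool" where
  "Cb 0 S F \<longleftrightarrow> continuous_on S F \<and> bounded (F ` S)"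
| "Cb (Suc s) S F \<longleftrightarrow> bounded (F ` S) \<and> (\<forall>x\<in>S. F differentiable (at x)) \<and> (\<forall>v. Cb s S (dd v F))"

lemma Cb_cong:
  assumes "open S" "\<And>x. x \<in> S \<Longrightarrow> F x = H x" "Cb s S F"
  shows "Cb s S H"
  using assms(2,3)
proof (induction s arbitrary: F H)
  case 0
  then show ?case by (metis (mono_tags, lifting) Cb.simps(1) continuous_on_cong image_cong)
next
  case (Suc s)
  have "H differentiable (at x)" if "x \<in> S" for x
    using Suc.prems that has_derivative_transform_within_open[OF has_derivative_dd assms(1) that, of F H]
    by (auto intro: differentiableI)
  moreover have "Cb s S (dd v H)" for v
    using Suc.prems by - (rule Suc.IH[of "dd v F"], auto intro: dd_transform[OF assms(1)])
  moreover have "bounded (H ` S)"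
    using Suc.prems by (metis (mono_tags, lifting) Cb.simps(2) image_cong)
  ultimately show ?case by simp
qed

lemma Cb_continuous: "Cb s S F \<Longrightarrow> continuous_on S F"
  by (cases s) (simp_all add: continuous_at_imp_continuous_on differentiable_imp_continuous_within)

text \<open>\<open>Cb\<close> asks for continuity at level 0 only, since differentiability supplies
  it above; the base case has to recover it.\<close>

lemma Cb_pred: "Cb (Suc s) S F \<Longrightarrow> Cb s S F"
proof (induction s arbitrary: F)
  case 0
  then show ?case using Cb_continuous[of "Suc 0" S F] by simp
qed auto

lemma Cb_le:
  assumes "Cb s S F" "t \<le> s"
  shows "Cb t S F"
  using assms(2,1) by (induction rule: inc_induct) (blast intro: Cb_pred)+

lemma Cb_differentiable: "Cb s S F \<Longrightarrow> s \<noteq> 0 \<Longrightarrow> x \<in> S \<Longrightarrow> F differentiable (at x)"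
  by (cases s) auto

lemma Cb_dd: "Cb s S F \<Longrightarrow> s \<noteq> 0 \<Longrightarrow> Cb (s - 1) S (dd v F)"
  by (cases s) auto

lemma Cb_const: "Cb s S (\<lambda>x. c)"
proof (induction s arbitrary: c)
  case 0
  then show ?case by (cases "S = {}") (auto simp: image_constant_conv)
next
  case (Suc s)
  have "dd v (\<lambda>x. c) = (\<lambda>x. 0)" for v :: 'a
    by (auto simp: dd_def)
  then show ?case using Suc by (cases "S = {}") (auto simp: image_constant_conv)
qed

lemma dd_bounded_linear:
  assumes "bounded_linear T" "F differentiable (at x)"
  shows "dd v (\<lambda>x. T (F x)) x = T (dd v F x)"
  using bounded_linear.has_derivative[OF assms(1) has_derivative_dd[OF assms(2)]] by (rule dd_eq)

lemma Cb_bounded_linear: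
  assumes T: "bounded_linear T" and S: "open S" and F: "Cb s S F"
  shows "Cb s S (\<lambda>x. T (F x))"
  using F
proof (induction s arbitrary: F)
  case 0
  then show ?case
    using bounded_linear_image[of "F ` S" T] T
    by (auto simp: image_image intro: bounded_linear.continuous_on)
next
  case (Suc s)
  have "bounded ((\<lambda>x. T (F x)) ` S)"
    using bounded_linear_image[of "F ` S" T] T Suc.prems by (auto simp: image_image)
  moreover have "(\<lambda>x. T (F x)) differentiable (at x)" if "x \<in> S" for x
    using Suc.prems that bounded_linear.has_derivative[OF T has_derivative_dd, of F x]
    by (auto intro: differentiableI)
  moreover have "Cb s S (dd v (\<lambda>x. T (F x)))" for v
    using Suc.prems
    by - (rule Cb_cong[OF S _ Suc.IH[of "dd v F"]], auto simp: dd_bounded_linear[OF T])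
  ultimately show ?case by simp
qed

lemma dd_add:
  "F differentiable (at x) \<Longrightarrow> H differentiable (at x) \<Longrightarrow> dd v (\<lambda>x. F x + H x) x = dd v F x + dd v H x"
  by (rule dd_eq) (intro has_derivative_add has_derivative_dd)

lemma Cb_add:
  assumes S: "open S" and "Cb s S F" "Cb s S H"
  shows "Cb s S (\<lambda>x. F x + H x)"
  using assms(2,3)
proof (induction s arbitrary: F H)
  case 0
  then show ?case by (auto intro: continuous_on_add bounded_plus_comp)
next
  case (Suc s)
  have "Cb s S (dd v (\<lambda>x. F x + H x))" for v
    using Suc.prems
    by - (rule Cb_cong[OF S _ Suc.IH[of "dd v F" "dd v H"]], auto simp: dd_add)
  then show ?case using Suc.prems by (auto intro: bounded_plus_comp)
qed

lemma Cb_minus: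
  assumes S: "open S" and "Cb s S F"
  shows "Cb s S (\<lambda>x. - F x)"
  using Cb_bounded_linear[OF bounded_linear_minus[OF bounded_linear_ident] assms] .

lemma Cb_diff:
  assumes S: "open S" and "Cb s S F" "Cb s S H"
  shows "Cb s S (\<lambda>x. F x - H x)"
  using Cb_add[OF S assms(2) Cb_minus[OF S assms(3)]] by simp

lemma Cb_sum:
  assumes S: "open S" and "\<And>i. i \<in> I \<Longrightarrow> Cb s S (F i)"
  shows "Cb s S (\<lambda>x. \<Sum>i\<in>I. F i x)"
proof (cases "finite I")
  case True
  thus ?thesis using assms(2)
    by (induction I) (simp_all add: Cb_add[OF S] Cb_const)
qed (auto intro: Cb_const)

lemma dd_scaleR:
  assumes "p differentiable (at x)" "F differentiable (at x)"
  shows "dd v (\<lambda>x. p x *\<^sub>R F x) x = p x *\<^sub>R dd v F x + dd v p x *\<^sub>R F x"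
  by (rule dd_eq) (intro has_derivative_scaleR has_derivative_dd assms)

lemma bounded_scaleR_image:
  fixes p :: "'a \<Rightarrow> real" and F :: "'a \<Rightarrow> 'b::real_normed_vector"
  assumes "bounded (p ` S)" "bounded (F ` S)"
  shows "bounded ((\<lambda>x. p x *\<^sub>R F x) ` S)"
proof -
  obtain B C where "\<And>x. x \<in> S \<Longrightarrow> \<bar>p x\<bar> \<le> B" "\<And>x. x \<in> S \<Longrightarrow> norm (F x) \<le> C"
    using assms by (auto simp: bounded_iff)
  hence "norm (p x *\<^sub>R F x) \<le> B * C" if "x \<in> S" for x
    using that by (metis abs_ge_zero mult_mono' norm_ge_zero norm_scaleR)
  thus ?thesis by (auto simp: bounded_iff)
qed

lemma Cb_scaleR:
  fixes p :: "'a::real_normed_vector \<Rightarrow> real"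
  assumes S: "open S" and "Cb s S p" "Cb s S F"
  shows "Cb s S (\<lambda>x. p x *\<^sub>R F x)"
  using assms(2,3)
proof (induction s arbitrary: p F)
  case 0
  then show ?case by (auto intro: continuous_on_scaleR bounded_scaleR_image)
next
  case (Suc s)
  have "Cb s S (dd v (\<lambda>x. p x *\<^sub>R F x))" for v
  proof (rule Cb_cong[OF S])
    show "Cb s S (\<lambda>x. p x *\<^sub>R dd v F x + dd v p x *\<^sub>R F x)"
      using Suc.prems Cb_pred[OF Suc.prems(1)] Cb_pred[OF Suc.prems(2)] by (intro Cb_add[OF S] Suc.IH) simp_all
    show "\<And>x. x \<in> S \<Longrightarrow> p x *\<^sub>R dd v F x + dd v p x *\<^sub>R F x = dd v (\<lambda>x. p x *\<^sub>R F x) x"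
      using Suc.prems by (auto simp: dd_scaleR)
  qed
  then show ?case using Suc.prems by (auto intro: bounded_scaleR_image)
qed

lemma linear_expand:
  fixes T :: "'a::euclidean_space \<Rightarrow> 'b::real_vector"
  assumes "linear T"
  shows "T v = (\<Sum>b\<in>Basis. (v \<bullet> b) *\<^sub>R T b)"
proof -
  have "T v = T (\<Sum>b\<in>Basis. (v \<bullet> b) *\<^sub>R b)" by (simp add: euclidean_representation)
  also have "\<dots> = (\<Sum>b\<in>Basis. (v \<bullet> b) *\<^sub>R T b)"
    by (simp add: linear_sum[OF assms] linear_cmul[OF assms])
  finally show ?thesis .
qed

lemma linear_norm_bound:
  fixes T :: "'a::euclidean_space \<Rightarrow> 'b::real_normed_vector"
  assumes "linear T"
  shows "norm (T v) \<le> (\<Sum>b\<in>Basis. norm (T b)) * norm v"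
proof -
  have "norm (T v) \<le> (\<Sum>b\<in>Basis. norm ((v \<bullet> b) *\<^sub>R T b))"
    by (subst linear_expand[OF assms]) (rule norm_sum)
  also have "\<dots> \<le> (\<Sum>b\<in>Basis. norm (T b) * norm v)"
    by (intro sum_mono) (simp add: Basis_le_norm mult.commute[of _ "norm v"] mult_right_mono)
  finally show ?thesis by (simp add: sum_distrib_right)
qed

lemma dd_compose:
  assumes "H differentiable (at x)" "F differentiable (at (H x))"
  shows "dd u (\<lambda>x. F (H x)) x = dd (dd u H x) F (H x)"
  using has_derivative_compose[OF has_derivative_dd[OF assms(1)] has_derivative_dd[OF assms(2)]]
  by (rule dd_eq)

text \<open>The inner map is controlled through its derivatives and may be unbounded, as the graph
  map \<open>z \<mapsto> (h z, z)\<close> is over an unbounded domain. The chain rule differentiates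
  \<open>F\<close> in the moving direction \<open>dd u H x\<close>; expanding this direction in the
  basis leaves constant ones, so the induction hypothesis applies to each
  \<open>dd b F\<close>.\<close>

lemma Cb_compose:
  fixes H :: "'a::real_normed_vector \<Rightarrow> 'c::euclidean_space"
  assumes S: "open S" and HU: "H ` S \<subseteq> U"
    and Hd: "\<And>x. x \<in> S \<Longrightarrow> H differentiable (at x)"
    and H: "\<And>u. s \<noteq> 0 \<Longrightarrow> Cb (s - 1) S (dd u H)"
    and F: "Cb s U F"
  shows "Cb s S (\<lambda>x. F (H x))"
  using H F
proof (induction s arbitrary: F)
  case 0
  have "continuous_on S H"
    using Hd by (meson continuous_at_imp_continuous_on differentiable_imp_continuous_within)
  moreover have "(\<lambda>x. F (H x)) ` S \<subseteq> F ` U" using HU by auto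
  ultimately show ?case using 0 HU by (auto intro: bounded_subset continuous_on_compose2)
next
  case (Suc s)
  have 1: "Cb s S (\<lambda>x. dd b F (H x))" for b
  proof (rule Suc.IH)
    fix u assume "s \<noteq> 0"
    thus "Cb (s - 1) S (dd u H)" using Suc.prems(1)[of u] by (auto intro: Cb_le)
  next
    show "Cb s U (dd b F)" using Suc.prems(2) by simp
  qed
  have 2: "dd u (\<lambda>x. F (H x)) x = (\<Sum>b\<in>Basis. (dd u H x \<bullet> b) *\<^sub>R dd b F (H x))" if "x \<in> S" for u x
  proof -
    have *: "F differentiable (at (H x))" using Suc.prems HU that by auto
    show ?thesis
      unfolding dd_compose[OF Hd[OF that] *] using linear_expand[OF linear_dd[OF *]] .
  qed
  have "Cb s S (\<lambda>x. dd u H x \<bullet> b)" for u b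
    using Cb_bounded_linear[OF bounded_linear_inner_left S Suc.prems(1)[of u]] by simp
  hence "Cb s S (\<lambda>x. \<Sum>b\<in>Basis. (dd u H x \<bullet> b) *\<^sub>R dd b F (H x))" for u
    using 1 by (intro Cb_sum[OF S] Cb_scaleR[OF S])
  hence "Cb s S (dd u (\<lambda>x. F (H x)))" for u
    by (rule Cb_cong[OF S, rotated]) (simp add: 2)
  moreover have "(\<lambda>x. F (H x)) ` S \<subseteq> F ` U" using HU by auto
  hence "bounded ((\<lambda>x. F (H x)) ` S)" using Suc.prems(2) by (auto intro: bounded_subset)
  moreover have "(\<lambda>x. F (H x)) differentiable (at x)" if "x \<in> S" for x
    using has_derivative_compose[OF has_derivative_dd[OF Hd[OF that]] has_derivative_dd[of F]] Suc.prems(2) that HU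
    by (auto intro: differentiableI)
  ultimately show ?case by simp
qed

section \<open>Multilinear maps on lists of vectors\<close>

lemma multilin_Cons:
  assumes "multilin (Suc k) M"
  shows "multilin k (\<lambda>vs. M (v # vs))"
  unfolding multilin_def
proof (intro allI impI)
  fix i :: nat and vs :: "'a list" assume "i < k" "length vs = k"
  hence "linear (\<lambda>w. M ((v # vs)[Suc i := w]))"
    using assms unfolding multilin_def by (metis Suc_less_eq length_Cons)
  thus "linear (\<lambda>w. M (v # vs[i := w]))" by simp
qed

lemma multilin_linear: "multilin k M \<Longrightarrow> i < k \<Longrightarrow> length vs = k \<Longrightarrow> linear (\<lambda>v. M (vs[i := v]))"
  by (simp add: multilin_def)

lemma multilin_head: "multilin (Suc k) M \<Longrightarrow> length vs = k \<Longrightarrow> linear (\<lambda>v. M (v # vs))"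
  using multilin_linear[of "Suc k" M 0 "undefined # vs"] by simp

lemma multilin_cong:
  "(\<And>vs. length vs = k \<Longrightarrow> M vs = M' vs) \<Longrightarrow> multilin k M = multilin k M'"
  by (simp add: multilin_def)

lemma multilin_linear_comp: "multilin k M \<Longrightarrow> linear T \<Longrightarrow> multilin k (\<lambda>vs. T (M vs))"
  unfolding multilin_def using linear_compose[unfolded o_def] by blast

lemma multilin_add: "multilin k M \<Longrightarrow> multilin k M' \<Longrightarrow> multilin k (\<lambda>vs. M vs + M' vs)"
  unfolding multilin_def using linear_compose_add by blast

lemma multilin_diff: "multilin k M \<Longrightarrow> multilin k M' \<Longrightarrow> multilin k (\<lambda>vs. M vs - M' vs)"
  unfolding multilin_def using linear_compose_sub by blast

lemma multilin_scaleR: "multilin k M \<Longrightarrow> multilin k (\<lambda>vs. c *\<^sub>R M vs)"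
  unfolding multilin_def using linear_compose_scale_right by blast

lemma multilin_sum: "(\<And>i. i \<in> I \<Longrightarrow> multilin k (M i)) \<Longrightarrow> multilin k (\<lambda>vs. \<Sum>i\<in>I. M i vs)"
  unfolding multilin_def by (auto intro!: linear_compose_sum)

lemma multilin_subst:
  assumes M: "multilin k M" and T: "linear T" and "i < k"
  shows "multilin k (\<lambda>vs. M (vs[i := T (vs ! i)]))"
  unfolding multilin_def
proof (intro allI impI)
  fix j :: nat and vs :: "'a list" assume j: "j < k" and l: "length vs = k"
  show "linear (\<lambda>v. M (vs[j := v, i := T (vs[j := v] ! i)]))"
  proof (cases "i = j")
    case True
    have "linear (\<lambda>v. M (vs[j := T v]))"
      using linear_compose[OF T multilin_linear[OF M j l]] by (simp add: o_def)
    thus ?thesis using True j l by simp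
  next
    case False
    have "linear (\<lambda>v. M (vs[i := T (vs ! i), j := v]))"
      using multilin_linear[OF M j] l by simp
    thus ?thesis using False j l by (simp add: list_update_swap)
  qed
qed

text \<open>A finite test set: a \<open>k\<close>-multilinear map is bounded by its values on these
  lists, which turns statements about single argument lists into statements in operator
  norm.\<close>

definition basis_lists :: "nat \<Rightarrow> 'a::euclidean_space list set" where
  "basis_lists k = {bs. set bs \<subseteq> Basis \<and> length bs = k}"

lemma finite_basis_lists: "finite (basis_lists k)"
  unfolding basis_lists_def by (rule finite_lists_length_eq) simp

lemma basis_lists_0: "basis_lists 0 = {[]}"
  by (auto simp: basis_lists_def)

lemma basis_lists_Suc: "basis_lists (Suc k) = (\<lambda>(b, bs). b # bs) ` (Basis \<times> basis_lists k)"
  by (auto simp: basis_lists_def length_Suc_conv image_iff)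

lemma prod_list_norm_nonneg: "0 \<le> prod_list (map norm vs)"
  by (induction vs) auto

lemma multilin_norm_bound:
  fixes M :: "'a::euclidean_space list \<Rightarrow> 'b::real_normed_vector"
  assumes "multilin k M" "length vs = k"
  shows "norm (M vs) \<le> (\<Sum>bs\<in>basis_lists k. norm (M bs)) * prod_list (map norm vs)"
  using assms
proof (induction k arbitrary: M vs)
  case 0
  then show ?case by (simp add: basis_lists_0)
next
  case (Suc k)
  then obtain v ws where vs: "vs = v # ws" and l: "length ws = k" by (auto simp: length_Suc_conv)
  let ?p = "prod_list (map norm ws)"
  have "norm (M vs) \<le> (\<Sum>b\<in>Basis. norm (M (b # ws))) * norm v"
    unfolding vs by (rule linear_norm_bound) (rule multilin_head[OF Suc.prems(1) l])
  also have "\<dots> \<le> (\<Sum>b\<in>Basis. (\<Sum>bs\<in>basis_lists k. norm (M (b # bs))) * ?p) * norm v"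
    by (intro mult_right_mono sum_mono Suc.IH[OF multilin_Cons[OF Suc.prems(1)] l]) simp
  also have "\<dots> = (\<Sum>b\<in>Basis. \<Sum>bs\<in>basis_lists k. norm (M (b # bs))) * (norm v * ?p)"
    by (simp only: sum_distrib_right[symmetric] mult.assoc mult.commute[of "norm v"])
  also have "(\<Sum>b\<in>Basis. \<Sum>bs\<in>basis_lists k. norm (M (b # bs))) = (\<Sum>(b, bs)\<in>Basis \<times> basis_lists k. norm (M (b # bs)))"
    by (rule sum.cartesian_product)
  also have "(\<Sum>(b, bs)\<in>Basis \<times> basis_lists k. norm (M (b # bs))) = (\<Sum>bs\<in>basis_lists (Suc k). norm (M bs))"
    unfolding basis_lists_Suc by (subst sum.reindex) (auto simp: inj_on_def case_prod_unfold)
  finally show ?case by (simp add: vs)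
qed

lemma multilin_norm_le:
  fixes M :: "'a::euclidean_space list \<Rightarrow> 'b::real_normed_vector"
  assumes "multilin k M" "length vs = k" "\<And>bs. bs \<in> basis_lists k \<Longrightarrow> norm (M bs) \<le> c bs"
  shows "norm (M vs) \<le> sum c (basis_lists k) * prod_list (map norm vs)"
  by (rule order_trans[OF multilin_norm_bound[OF assms(1,2)]])
     (intro mult_right_mono sum_mono assms(3) prod_list_norm_nonneg)

text \<open>Product rule with all arguments moving. Expanding the head in the fixed basis leaves
  real coefficients and maps with a constant head, and the induction hypothesis covers the remaining
  arguments.\<close>

lemma multilin_curve_deriv:
  fixes M :: "real \<Rightarrow> 'a::euclidean_space list \<Rightarrow> 'b::real_normed_vector"
  assumes "\<And>t. t \<in> S \<Longrightarrow> multilin k (M t)" "multilin k M'" "t \<in> S"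
    and "\<And>ws. length ws = k \<Longrightarrow> ((\<lambda>t. M t ws) has_vector_derivative M' ws) (at t within S)"
    and "length vs = k" "length ds = k"
    and "\<And>i. i < k \<Longrightarrow> ((vs ! i) has_vector_derivative (ds ! i)) (at t within S)"
  shows "((\<lambda>t. M t (map (\<lambda>v. v t) vs)) has_vector_derivative
     M' (map (\<lambda>v. v t) vs) + (\<Sum>i<k. M t ((map (\<lambda>v. v t) vs)[i := ds ! i]))) (at t within S)"
  using assms
proof (induction k arbitrary: M M' vs ds)
  case 0
  then show ?case by simp
next
  case (Suc k)
  obtain u us where vs: "vs = u # us" and l: "length us = k"
    using Suc.prems(5) by (auto simp: length_Suc_conv)
  obtain e es where ds: "ds = e # es" and le: "length es = k"
    using Suc.prems(6) by (auto simp: length_Suc_conv)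
  let ?w = "map (\<lambda>v. v t) us"
  have u: "(u has_vector_derivative e) (at t within S)"
    using Suc.prems(7)[of 0] by (simp add: vs ds)
  have us: "((us ! i) has_vector_derivative (es ! i)) (at t within S)" if "i < k" for i
    using Suc.prems(7)[of "Suc i"] that by (simp add: vs ds)
  let ?D = "\<lambda>b. M' (b # ?w) + (\<Sum>i<k. M t (b # ?w[i := es ! i]))"
  have 1: "((\<lambda>t. M t (b # map (\<lambda>v. v t) us)) has_vector_derivative ?D b) (at t within S)" for b
  proof (rule Suc.IH[of "\<lambda>t ws. M t (b # ws)" "\<lambda>ws. M' (b # ws)" us es])
    show "multilin k (\<lambda>ws. M s (b # ws))" if "s \<in> S" for s
      by (rule multilin_Cons[OF Suc.prems(1)[OF that]])
    show "multilin k (\<lambda>ws. M' (b # ws))" by (rule multilin_Cons[OF Suc.prems(2)])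
  qed (use Suc.prems(3,4) l le us in auto)
  have c: "((\<lambda>t. u t \<bullet> b) has_real_derivative e \<bullet> b) (at t within S)" for b
    using bounded_linear.has_vector_derivative[OF bounded_linear_inner_left u]
    by (simp add: has_real_derivative_iff_has_vector_derivative)
  have "((\<lambda>t. \<Sum>b\<in>Basis. (u t \<bullet> b) *\<^sub>R M t (b # map (\<lambda>v. v t) us)) has_vector_derivative
      (\<Sum>b\<in>Basis. (u t \<bullet> b) *\<^sub>R ?D b + (e \<bullet> b) *\<^sub>R M t (b # ?w))) (at t within S)"
    by (intro has_vector_derivative_sum has_vector_derivative_scaleR c 1)
  also have "(\<Sum>b\<in>Basis. (u t \<bullet> b) *\<^sub>R ?D b + (e \<bullet> b) *\<^sub>R M t (b # ?w))
    = M' (u t # ?w) + (\<Sum>i<k. M t (u t # ?w[i := es ! i])) + M t (e # ?w)"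
  proof -
    have "M' (u t # ?w) = (\<Sum>b\<in>Basis. (u t \<bullet> b) *\<^sub>R M' (b # ?w))"
      by (rule linear_expand[OF multilin_head[OF Suc.prems(2)]]) (simp add: l)
    moreover have "M t (e # ?w) = (\<Sum>b\<in>Basis. (e \<bullet> b) *\<^sub>R M t (b # ?w))"
      by (rule linear_expand[OF multilin_head[OF Suc.prems(1)]]) (simp_all add: l Suc.prems(3))
    moreover have "M t (u t # ?w[i := es ! i]) = (\<Sum>b\<in>Basis. (u t \<bullet> b) *\<^sub>R M t (b # ?w[i := es ! i]))" for i
      by (rule linear_expand[OF multilin_head[OF Suc.prems(1)]]) (simp_all add: l Suc.prems(3))
    hence "(\<Sum>i<k. M t (u t # ?w[i := es ! i])) = (\<Sum>b\<in>Basis. (u t \<bullet> b) *\<^sub>R (\<Sum>i<k. M t (b # ?w[i := es ! i])))"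
      by (simp add: scaleR_sum_right) (rule sum.swap)
    ultimately show ?thesis
      by (simp add: scaleR_add_right sum.distrib)
  qed
  also have "\<dots> = M' (map (\<lambda>v. v t) vs) + (\<Sum>i<Suc k. M t ((map (\<lambda>v. v t) vs)[i := ds ! i]))"
    unfolding vs ds by (subst sum.lessThan_Suc_shift) (simp add: add_ac)
  finally have 2: "((\<lambda>t. \<Sum>b\<in>Basis. (u t \<bullet> b) *\<^sub>R M t (b # map (\<lambda>v. v t) us)) has_vector_derivative
      M' (map (\<lambda>v. v t) vs) + (\<Sum>i<Suc k. M t ((map (\<lambda>v. v t) vs)[i := ds ! i]))) (at t within S)" .
  have 3: "(\<Sum>b\<in>Basis. (u s \<bullet> b) *\<^sub>R M s (b # map (\<lambda>v. v s) us)) = M s (map (\<lambda>v. v s) vs)" if "s \<in> S" for s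
    unfolding vs by (simp, rule linear_expand[OF multilin_head[OF Suc.prems(1)[OF that]], symmetric]) (simp add: l)
  show ?case
    by (rule has_vector_derivative_transform[OF Suc.prems(3) _ 2]) (simp add: 3)
qed

section \<open>Differential inequalities and linear equations\<close>

lemma nondecreasing_within:
  fixes g :: "real \<Rightarrow> real"
  assumes T: "0 \<le> T"
    and d: "\<And>t. t \<in> {0..T} \<Longrightarrow> (g has_real_derivative g' t) (at t within {0..T})"
    and p: "\<And>t. t \<in> {0..T} \<Longrightarrow> 0 \<le> g' t"
  shows "g 0 \<le> g T"
proof (rule DERIV_nonneg_imp_increasing_open[OF T])
  fix x assume x: "0 < x" "x < T"
  hence "at x within {0..T} = at x" by (intro at_within_interior) (auto simp: interior_atLeastAtMost_real)
  thus "\<exists>y. (g has_real_derivative y) (at x) \<and> 0 \<le> y" using d[of x] p[of x] x by auto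
next
  show "continuous_on {0..T} g"
    using d by (meson DERIV_continuous_on)
qed

text \<open>The norm is not differentiable at zeros of \<open>\<psi>\<close>; it is replaced by
  \<open>sqrt (\<psi> t \<bullet> \<psi> t + e^2)\<close>, which differs from it by at most
  \<open>e\<close>. With \<open>s = 1\<close> this bounds the final norm from above, with
  \<open>s = - 1\<close> from below.\<close>

lemma norm_growth_aux:
  fixes \<psi> :: "real \<Rightarrow> 'b::real_inner"
  assumes T: "0 \<le> T" and s: "\<bar>s\<bar> = 1"
    and d: "\<And>t. t \<in> {0..T} \<Longrightarrow> (\<psi> has_vector_derivative \<psi>' t) (at t within {0..T})"
    and R: "\<And>t. t \<in> {0..T} \<Longrightarrow> (R has_real_derivative R' t) (at t within {0..T})"
    and p: "\<And>t. t \<in> {0..T} \<Longrightarrow> 0 \<le> R' t"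
    and i: "\<And>t. t \<in> {0..T} \<Longrightarrow> s * (\<psi> t \<bullet> \<psi>' t) \<le> R' t * norm (\<psi> t)"
  shows "s * norm (\<psi> T) \<le> s * norm (\<psi> 0) + R T - R 0"
proof (rule field_le_epsilon)
  fix e :: real assume e: "0 < e"
  let ?q = "\<lambda>t. sqrt (\<psi> t \<bullet> \<psi> t + e\<^sup>2)"
  let ?g = "\<lambda>t. R t - s * ?q t"
  have pos: "0 < \<psi> t \<bullet> \<psi> t + e\<^sup>2" for t using e by (simp add: add_nonneg_pos)
  have "?g 0 \<le> ?g T"
  proof (rule nondecreasing_within[OF T])
    fix t assume t: "t \<in> {0..T}"
    have "((\<lambda>t. \<psi> t \<bullet> \<psi> t) has_real_derivative (2 * (\<psi> t \<bullet> \<psi>' t))) (at t within {0..T})"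
      using has_derivative_inner[OF d[OF t, unfolded has_vector_derivative_def] d[OF t, unfolded has_vector_derivative_def]]
      by (simp add: has_field_derivative_def inner_commute algebra_simps mult_commute_abs)
    thus "(?g has_real_derivative (R' t - s * (\<psi> t \<bullet> \<psi>' t / ?q t))) (at t within {0..T})"
      using R[OF t] pos[of t] by (auto intro!: derivative_eq_intros simp: field_simps)
    have "norm (\<psi> t) \<le> ?q t"
      by (rule real_le_rsqrt) (simp add: power2_norm_eq_inner)
    hence "s * (\<psi> t \<bullet> \<psi>' t) \<le> R' t * ?q t"
      using i[OF t] p[OF t] by (meson mult_left_mono order_trans)
    thus "0 \<le> R' t - s * (\<psi> t \<bullet> \<psi>' t / ?q t)"
      using pos[of t] by (simp add: field_simps)
  qed
  moreover have 1: "norm (\<psi> t) \<le> ?q t" for t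
    by (rule real_le_rsqrt) (simp add: power2_norm_eq_inner)
  moreover have 2: "?q t \<le> norm (\<psi> t) + e" for t
    using e by (intro real_le_lsqrt) (auto simp: power2_norm_eq_inner[symmetric] power2_sum)
  moreover have "s = 1 \<or> s = - 1" using s by linarith
  ultimately show "s * norm (\<psi> T) \<le> s * norm (\<psi> 0) + R T - R 0 + e"
    using 1[of 0] 1[of T] 2[of 0] 2[of T] by (elim disjE; clarsimp; linarith)
qed

text \<open>The integrating factor \<open>exp (- A t)\<close> removes the linear rate
  \<open>a\<close>. The inhomogeneity carries the factor \<open>exp (A t)\<close> so that exactly
  \<open>R'\<close> is left after rescaling.\<close>

lemma weighted_growth:
  fixes \<delta> :: "real \<Rightarrow> 'b::real_inner"
  assumes T: "0 \<le> T" and s: "\<bar>s\<bar> = 1"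
    and d: "\<And>t. t \<in> {0..T} \<Longrightarrow> (\<delta> has_vector_derivative \<delta>' t) (at t within {0..T})"
    and A: "\<And>t. t \<in> {0..T} \<Longrightarrow> (A has_real_derivative a t) (at t within {0..T})"
    and R: "\<And>t. t \<in> {0..T} \<Longrightarrow> (R has_real_derivative R' t) (at t within {0..T})"
    and p: "\<And>t. t \<in> {0..T} \<Longrightarrow> 0 \<le> R' t"
    and i: "\<And>t. t \<in> {0..T} \<Longrightarrow> s * (\<delta> t \<bullet> \<delta>' t) \<le> s * a t * (norm (\<delta> t))\<^sup>2 + exp (A t) * R' t * norm (\<delta> t)"
  shows "s * (exp (- A T) * norm (\<delta> T)) \<le> s * (exp (- A 0) * norm (\<delta> 0)) + R T - R 0"
proof -
  let ?\<psi> = "\<lambda>t. exp (- A t) *\<^sub>R \<delta> t"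
  let ?d = "\<lambda>t. exp (- A t) *\<^sub>R \<delta>' t + (- a t * exp (- A t)) *\<^sub>R \<delta> t"
  have "s * norm (?\<psi> T) \<le> s * norm (?\<psi> 0) + R T - R 0"
  proof (rule norm_growth_aux[OF T s _ R p])
    fix t assume t: "t \<in> {0..T}"
    show "(?\<psi> has_vector_derivative ?d t) (at t within {0..T})"
      using A[OF t] d[OF t] by (auto intro!: derivative_eq_intros has_vector_derivative_scaleR)
    have "s * (?\<psi> t \<bullet> ?d t) = exp (- A t) * exp (- A t) * (s * (\<delta> t \<bullet> \<delta>' t) - s * a t * (norm (\<delta> t))\<^sup>2)"
      by (simp add: inner_add_right power2_norm_eq_inner algebra_simps)
    also have "\<dots> \<le> exp (- A t) * exp (- A t) * (exp (A t) * R' t * norm (\<delta> t))"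
      using i[OF t] by (intro mult_left_mono) auto
    also have "\<dots> = R' t * norm (?\<psi> t)" by (simp add: exp_minus)
    finally show "s * (?\<psi> t \<bullet> ?d t) \<le> R' t * norm (?\<psi> t)" .
  qed
  thus ?thesis by simp
qed

lemma gronwall_upper:
  fixes \<delta> :: "real \<Rightarrow> 'b::real_inner"
  assumes "0 \<le> T"
    and "\<And>t. t \<in> {0..T} \<Longrightarrow> (\<delta> has_vector_derivative \<delta>' t) (at t within {0..T})"
    and "\<And>t. t \<in> {0..T} \<Longrightarrow> (A has_real_derivative a t) (at t within {0..T})"
    and "\<And>t. t \<in> {0..T} \<Longrightarrow> \<delta> t \<bullet> \<delta>' t \<le> a t * (norm (\<delta> t))\<^sup>2"
  shows "norm (\<delta> T) \<le> exp (A T - A 0) * norm (\<delta> 0)"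
proof -
  have "1 * (exp (- A T) * norm (\<delta> T)) \<le> 1 * (exp (- A 0) * norm (\<delta> 0)) + 0 - 0"
    by (rule weighted_growth[where s = 1 and R' = "\<lambda>_. 0", OF assms(1) _ assms(2,3)]) (use assms(4) in auto)
  hence "exp (A T) * (exp (- A T) * norm (\<delta> T)) \<le> exp (A T) * (exp (- A 0) * norm (\<delta> 0))"
    by (intro mult_left_mono) auto
  thus ?thesis by (simp add: exp_minus exp_diff field_simps)
qed

text \<open>The backward direction: a solution that expands at rate at least \<open>a\<close> cannot
  be large at time 0 without being large at time \<open>T\<close>, up to the accumulated
  inhomogeneity.\<close>

lemma gronwall_lower:
  fixes \<delta> :: "real \<Rightarrow> 'b::real_inner"
  assumes "0 \<le> T"
    and "\<And>t. t \<in> {0..T} \<Longrightarrow> (\<delta> has_vector_derivative \<delta>' t) (at t within {0..T})"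
    and "\<And>t. t \<in> {0..T} \<Longrightarrow> (A has_real_derivative a t) (at t within {0..T})"
    and "\<And>t. t \<in> {0..T} \<Longrightarrow> (R has_real_derivative R' t) (at t within {0..T})"
    and "\<And>t. t \<in> {0..T} \<Longrightarrow> 0 \<le> R' t"
    and "\<And>t. t \<in> {0..T} \<Longrightarrow> a t * (norm (\<delta> t))\<^sup>2 - exp (A t) * R' t * norm (\<delta> t) \<le> \<delta> t \<bullet> \<delta>' t"
  shows "exp (- A 0) * norm (\<delta> 0) \<le> exp (- A T) * norm (\<delta> T) + R T - R 0"
proof -
  have "- 1 * (exp (- A T) * norm (\<delta> T)) \<le> - 1 * (exp (- A 0) * norm (\<delta> 0)) + R T - R 0"
    by (rule weighted_growth[where s = "- 1", OF assms(1) _ assms(2,3,4,5)]) (use assms(6) in fastforce)+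
  thus ?thesis by simp
qed

lemma at_within_halfline:
  assumes "0 \<le> (t::real)" "t < T"
  shows "at t within {0..T} = at t within {0..}"
  by (rule at_within_nhd[of t "{..<T}"]) (use assms in auto)

lemma has_vector_derivative_halfline:
  assumes "\<And>T. 0 < T \<Longrightarrow> (f has_vector_derivative f') (at t within {0..T})" "0 \<le> (t::real)"
  shows "(f has_vector_derivative f') (at t within {0..})"
  using assms(1)[of "t + 1"] assms(2) at_within_halfline[of t "t + 1"] by simp

lemma integral_has_vector_derivative_halfline:
  fixes k :: "real \<Rightarrow> 'a::banach"
  assumes "continuous_on {0..} k" "0 \<le> t"
  shows "((\<lambda>u. integral {0..u} k) has_vector_derivative k t) (at t within {0..})"
proof -
  have "((\<lambda>u. integral {0..u} k) has_vector_derivative k t) (at t within {0..t + 1})"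
    using assms by (intro integral_has_vector_derivative continuous_on_subset[OF assms(1)]) auto
  thus ?thesis using at_within_halfline[of t "t + 1"] assms(2) by simp
qed

lemma continuous_on_linear_family:
  fixes A :: "'s::topological_space \<Rightarrow> 'a::euclidean_space \<Rightarrow> 'b::real_normed_vector"
  assumes lin: "\<And>t. t \<in> S \<Longrightarrow> linear (A t)" and cont: "\<And>v. continuous_on S (\<lambda>t. A t v)"
    and u: "continuous_on S u"
  shows "continuous_on S (\<lambda>t. A t (u t))"
proof -
  have "continuous_on S (\<lambda>t. \<Sum>b\<in>Basis. (u t \<bullet> b) *\<^sub>R A t b)"
    by (intro continuous_intros cont u)
  thus ?thesis
    by (rule continuous_on_eq) (rule linear_expand[OF lin, symmetric])
qed

text \<open>The weight $e^{-2 C t}$ turns the Picard operator into a contraction on the bounded continuous functions on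
  the whole line, so a global solution comes from a single fixed point.\<close>

lemma linear_ode_exists:
  fixes A :: "real \<Rightarrow> 'a::euclidean_space \<Rightarrow> 'a"
  assumes lin: "\<And>t. 0 \<le> t \<Longrightarrow> linear (A t)" and cont: "\<And>v. continuous_on {0..} (\<lambda>t. A t v)"
    and C: "0 < C" and bd: "\<And>t v. 0 \<le> t \<Longrightarrow> norm (A t v) \<le> C * norm v"
  shows "\<exists>v. v 0 = w \<and> (\<forall>t\<ge>0. (v has_vector_derivative A t (v t)) (at t within {0..}))"
proof -
  \<comment> \<open>Elements of the function space live on all of \<open>real\<close>, so time is
    clamped at 0 by \<open>\<tau>\<close>. The unknown is
    \<open>u t = exp (- 2 * C * t) *\<^sub>R v t\<close>, which makes \<open>k u\<close> the
    integrand \<open>A s (v s)\<close>.\<close>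
  define \<tau> :: "real \<Rightarrow> real" where "\<tau> t = max 0 t" for t
  define k where "k u s = exp (2 * C * s) *\<^sub>R A s (apply_bcontfun u s)" for u :: "real \<Rightarrow>\<^sub>C 'a" and s
  define \<Phi> where "\<Phi> u t = exp (- 2 * C * \<tau> t) *\<^sub>R (w + integral {0..\<tau> t} (k u))" for u t
  have kc: "continuous_on {0..} (k u)" for u
    unfolding k_def
    by (intro continuous_intros continuous_on_linear_family[OF lin cont]) auto
  have ki: "k u integrable_on {0..t}" for u t
    by (rule integrable_continuous_real) (rule continuous_on_subset[OF kc], auto)
  have deriv: "((\<lambda>t. integral {0..t} (k u)) has_vector_derivative k u t) (at t within {0..})" if "0 \<le> t" for u t
    by (rule integral_has_vector_derivative_halfline[OF kc that])
  have Ic: "continuous_on {0..} (\<lambda>t. integral {0..t} (k u))" for u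
    unfolding continuous_on_eq_continuous_within
    by (auto intro!: has_vector_derivative_continuous deriv)
  have \<Phi>c: "continuous_on UNIV (\<Phi> u)" for u
  proof -
    have "continuous_on UNIV \<tau>" unfolding \<tau>_def by (intro continuous_intros)
    thus ?thesis unfolding \<Phi>_def
      by (intro continuous_intros continuous_on_compose2[OF Ic, of UNIV \<tau>]) (auto simp: \<tau>_def)
  qed
  have ebd: "integral {0..t} (\<lambda>s. exp (2 * C * s) * (C * B)) = (exp (2 * C * t) - 1) / 2 * B"
    and eint: "(\<lambda>s. exp (2 * C * s) * (C * B)) integrable_on {0..t}" if "0 \<le> t" for t B
  proof -
    have "((\<lambda>s. exp (2 * C * s) * (C * B)) has_integral (exp (2 * C * t) / 2 * B - exp (2 * C * 0) / 2 * B)) {0..t}"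
      using that
      by (intro fundamental_theorem_of_calculus)
         (auto intro!: derivative_eq_intros simp: has_real_derivative_iff_has_vector_derivative[symmetric])
    from integral_unique[OF this] has_integral_integrable[OF this]
    show "integral {0..t} (\<lambda>s. exp (2 * C * s) * (C * B)) = (exp (2 * C * t) - 1) / 2 * B"
      and "(\<lambda>s. exp (2 * C * s) * (C * B)) integrable_on {0..t}"
      by (simp_all add: left_diff_distrib diff_divide_distrib)
  qed
  \<comment> \<open>Origin of the contraction constant: the integral of
    \<open>C * exp (2 * C * s)\<close> over \<open>[0, t]\<close> is below
    \<open>exp (2 * C * t) / 2\<close>, and the weight cancels this exponential.\<close>
  have half: "exp (- 2 * C * t) * ((exp (2 * C * t) - 1) / 2 * B) \<le> B / 2" if "0 \<le> B" for t B :: real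
  proof -
    have "exp (- 2 * C * t) * ((exp (2 * C * t) - 1) / 2 * B) = (1 - exp (- 2 * C * t)) * (B / 2)"
      by (simp add: algebra_simps exp_add[symmetric] diff_divide_distrib flip: exp_minus)
    also have "\<dots> \<le> 1 * (B / 2)" using that by (intro mult_right_mono) auto
    finally show ?thesis by simp
  qed
  have \<Phi>b: "norm (\<Phi> u t) \<le> norm w + norm u / 2" for u t
  proof -
    have "norm (integral {0..\<tau> t} (k u)) \<le> integral {0..\<tau> t} (\<lambda>s. exp (2 * C * s) * (C * norm u))"
    proof (rule integral_norm_bound_integral[OF ki eint])
      fix s assume "s \<in> {0..\<tau> t}"
      hence "norm (A s (u s)) \<le> C * norm u"
        using bd[of s "u s"] norm_bounded[of u s] C by (smt (verit) atLeastAtMost_iff mult_left_mono)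
      thus "norm (k u s) \<le> exp (2 * C * s) * (C * norm u)" by (simp add: k_def)
    qed (simp add: \<tau>_def)
    also have "\<dots> = (exp (2 * C * \<tau> t) - 1) / 2 * norm u" by (rule ebd) (simp add: \<tau>_def)
    finally have "exp (- 2 * C * \<tau> t) * norm (integral {0..\<tau> t} (k u)) \<le> norm u / 2"
      using half[of "norm u" "\<tau> t"] by (meson exp_ge_zero mult_left_mono norm_ge_zero order_trans)
    moreover have "exp (- 2 * C * \<tau> t) * norm w \<le> 1 * norm w"
      using C by (intro mult_right_mono) (auto simp: \<tau>_def)
    moreover have "norm (\<Phi> u t) \<le> exp (- 2 * C * \<tau> t) * (norm w + norm (integral {0..\<tau> t} (k u)))"
      unfolding \<Phi>_def norm_scaleR abs_exp_cancel by (intro mult_left_mono norm_triangle_ineq) simp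
    ultimately show ?thesis by (simp add: algebra_simps)
  qed
  have in_b: "\<Phi> u \<in> bcontfun" for u
    by (rule bcontfun_normI[OF \<Phi>c \<Phi>b])
  have dist: "dist (\<Phi> u t) (\<Phi> u' t) \<le> 1 / 2 * dist u u'" for u u' t
  proof -
    have *: "integral {0..\<tau> t} (k u) - integral {0..\<tau> t} (k u') = integral {0..\<tau> t} (\<lambda>s. k u s - k u' s)"
      by (rule integral_diff[symmetric]) (rule ki)+
    have "norm (integral {0..\<tau> t} (\<lambda>s. k u s - k u' s)) \<le> integral {0..\<tau> t} (\<lambda>s. exp (2 * C * s) * (C * dist u u'))"
    proof (rule integral_norm_bound_integral[OF _ eint])
      show "(\<lambda>s. k u s - k u' s) integrable_on {0..\<tau> t}" by (intro integrable_diff ki)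
      fix s assume s: "s \<in> {0..\<tau> t}"
      have "norm (A s (u s - u' s)) \<le> C * norm (u s - u' s)" using s by (intro bd) auto
      also have "\<dots> \<le> C * dist u u'"
        using dist_bounded[of u s u'] C by (simp add: dist_norm)
      finally have "norm (A s (u s - u' s)) \<le> C * dist u u'" .
      moreover have "k u s - k u' s = exp (2 * C * s) *\<^sub>R A s (u s - u' s)"
        unfolding k_def using linear_diff[OF lin, of s] s by (simp add: scaleR_diff_right)
      ultimately show "norm (k u s - k u' s) \<le> exp (2 * C * s) * (C * dist u u')" by simp
    qed (simp add: \<tau>_def)
    also have "\<dots> = (exp (2 * C * \<tau> t) - 1) / 2 * dist u u'" by (rule ebd) (simp add: \<tau>_def)
    finally have "exp (- 2 * C * \<tau> t) * norm (integral {0..\<tau> t} (\<lambda>s. k u s - k u' s)) \<le> dist u u' / 2"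
      using half[of "dist u u'" "\<tau> t"] by (meson exp_ge_zero mult_left_mono zero_le_dist order_trans)
    moreover have "\<Phi> u t - \<Phi> u' t = exp (- 2 * C * \<tau> t) *\<^sub>R integral {0..\<tau> t} (\<lambda>s. k u s - k u' s)"
      unfolding \<Phi>_def *[symmetric] by (simp add: algebra_simps)
    ultimately show ?thesis by (simp add: dist_norm)
  qed
  have ap: "apply_bcontfun (Bcontfun (\<Phi> u)) = \<Phi> u" for u
    by (rule Bcontfun_inverse[OF in_b])
  have "\<exists>!u. Bcontfun (\<Phi> u) = u"
  proof (rule banach_fix_type[where c = "1/2"])
    show "\<forall>u u'. dist (Bcontfun (\<Phi> u)) (Bcontfun (\<Phi> u')) \<le> 1 / 2 * dist u u'"
      by (intro allI dist_bound) (simp only: ap dist)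
  qed auto
  then obtain u where "Bcontfun (\<Phi> u) = u" by auto
  hence u: "apply_bcontfun u t = \<Phi> u t" for t using ap[of u] by simp
  let ?v = "\<lambda>t. w + integral {0..t} (k u)"
  have v: "?v t = exp (2 * C * t) *\<^sub>R u t" if "0 \<le> t" for t
    using that unfolding u \<Phi>_def by (simp add: \<tau>_def exp_add[symmetric] scaleR_scaleR[symmetric] del: scaleR_scaleR) (simp add: exp_add[symmetric])
  show ?thesis
  proof (intro exI[of _ ?v] conjI allI impI)
    show "w + integral {0..0} (k u) = w" by simp
    fix t :: real assume t: "0 \<le> t"
    have "A t (?v t) = k u t"
      unfolding v[OF t] k_def using linear_cmul[OF lin[OF t]] by simp
    thus "(?v has_vector_derivative A t (?v t)) (at t within {0..})"
      using deriv[OF t, of u] by (auto intro!: derivative_eq_intros)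
  qed
qed

section \<open>Strict differentiability\<close>

text \<open>The radius is a Lebesgue number of the cover of \<open>Z\<close> by the open sets with
  property \<open>P\<close>.\<close>

lemma compact_uniform_radius:
  fixes Z :: "'a::metric_space set"
  assumes Z: "compact Z"
    and ex: "\<And>z. z \<in> Z \<Longrightarrow> \<exists>d>0. P (ball z d)"
    and anti: "\<And>U V. P V \<Longrightarrow> U \<subseteq> V \<Longrightarrow> P U"
  shows "\<exists>d>0. \<forall>z\<in>Z. P (ball z d)"
proof -
  let ?\<G> = "{U. open U \<and> P U}"
  have "Z \<subseteq> \<Union>?\<G>"
  proof
    fix z assume "z \<in> Z"
    then obtain d where "0 < d" "P (ball z d)" using ex by blast
    thus "z \<in> \<Union>?\<G>" by (intro UnionI[of "ball z d"]) auto
  qed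
  from Heine_Borel_lemma[OF Z this] obtain d where "0 < d"
    and "\<And>z. z \<in> Z \<Longrightarrow> \<exists>U\<in>?\<G>. ball z d \<subseteq> U" by (metis (no_types, lifting) mem_Collect_eq)
  thus ?thesis using anti by (intro exI[of _ d]) blast
qed

text \<open>Weaker than \<open>Cb 1\<close>, because \<open>F\<close> itself may be unbounded. This
  is all that can be expected of \<open>h\<close> and of the reduced vector field.\<close>

definition C1b :: "'a::real_normed_vector set \<Rightarrow> ('a \<Rightarrow> 'b::real_normed_vector) \<Rightarrow> bool" where
  "C1b S F \<longleftrightarrow> (\<forall>x\<in>S. F differentiable (at x)) \<and> (\<forall>v. Cb 0 S (dd v F))"

lemma Cb_imp_C1b: "Cb s S F \<Longrightarrow> s \<noteq> 0 \<Longrightarrow> C1b S F"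
  unfolding C1b_def using Cb_differentiable Cb_dd Cb_le by blast

lemma C1b_bound:
  fixes F :: "'a::euclidean_space \<Rightarrow> 'b::real_normed_vector"
  assumes "C1b S F"
  obtains M where "0 < M" "\<And>x v. x \<in> S \<Longrightarrow> norm (dd v F x) \<le> M * norm v"
proof -
  have "\<forall>b. \<exists>B. \<forall>x\<in>S. norm (dd b F x) \<le> B"
    using assms by (auto simp: C1b_def bounded_iff)
  then obtain B where B: "\<And>b x. x \<in> S \<Longrightarrow> norm (dd b F x) \<le> B b" by metis
  have "norm (dd v F x) \<le> (1 + \<bar>\<Sum>b\<in>Basis. B b\<bar>) * norm v" if "x \<in> S" for x v
  proof -
    have "norm (dd v F x) \<le> (\<Sum>b\<in>Basis. norm (dd b F x)) * norm v"
      using assms that by (intro linear_norm_bound linear_dd) (auto simp: C1b_def)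
    also have "\<dots> \<le> (1 + \<bar>\<Sum>b\<in>Basis. B b\<bar>) * norm v"
      using sum_mono[of Basis "\<lambda>b. norm (dd b F x)" B] B[OF that]
      by (intro mult_right_mono) auto
    finally show ?thesis .
  qed
  thus ?thesis by (intro that[of "1 + \<bar>\<Sum>b\<in>Basis. B b\<bar>"]) auto
qed

lemma dd_locally_close:
  fixes F :: "'a::euclidean_space \<Rightarrow> 'b::real_normed_vector"
  assumes S: "open S" and F: "C1b S F" and z: "z \<in> S" and e: "0 < e"
  shows "\<exists>d>0. \<forall>y\<in>ball z d. \<forall>y'\<in>ball z d. y \<in> S \<and> y' \<in> S \<and> (\<forall>v. norm (dd v F y - dd v F y') \<le> e * norm v)"
proof -
  \<comment> \<open>The tolerance is shared among the basis directions; the factor 2 pays for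
    comparing \<open>y\<close> with \<open>y'\<close> through \<open>z\<close>.\<close>
  define e' where "e' = e / (2 * real (DIM('a)))"
  have e': "0 < e'" using e by (simp add: e'_def)
  have "\<forall>\<^sub>F y in nhds z. \<forall>b\<in>Basis. dist (dd b F y) (dd b F z) < e'"
  proof (rule eventually_ball_finite)
    show "\<forall>b\<in>Basis. \<forall>\<^sub>F y in nhds z. dist (dd b F y) (dd b F z) < e'"
    proof
      fix b :: 'a
      have "isCont (dd b F) z"
        using F S z by (auto simp: C1b_def continuous_on_eq_continuous_at)
      thus "\<forall>\<^sub>F y in nhds z. dist (dd b F y) (dd b F z) < e'"
        using e' by (simp add: continuous_at_eps_delta eventually_nhds_metric)
    qed
  qed simp
  moreover have "\<forall>\<^sub>F y in nhds z. y \<in> S" using S z by (rule eventually_nhds_in_open)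
  ultimately have "\<forall>\<^sub>F y in nhds z. y \<in> S \<and> (\<forall>b\<in>Basis. dist (dd b F y) (dd b F z) < e')"
    by eventually_elim auto
  then obtain d where d: "0 < d" "\<And>y. y \<in> ball z d \<Longrightarrow> y \<in> S"
    "\<And>y b. y \<in> ball z d \<Longrightarrow> b \<in> Basis \<Longrightarrow> dist (dd b F y) (dd b F z) < e'"
    by (auto simp: eventually_nhds_metric dist_commute)
  show ?thesis
  proof (intro exI[of _ d] conjI d(1) ballI allI d(2); assumption?)
    fix y y' v assume y: "y \<in> ball z d" and y': "y' \<in> ball z d"
    have lin: "linear (\<lambda>v. dd v F y - dd v F y')"
      using F d(2)[OF y] d(2)[OF y'] by (intro linear_compose_sub linear_dd) (auto simp: C1b_def)
    have "norm (dd v F y - dd v F y') \<le> (\<Sum>b\<in>Basis. norm (dd b F y - dd b F y')) * norm v"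
      by (rule linear_norm_bound[OF lin])
    also have "\<dots> \<le> (\<Sum>b\<in>(Basis::'a set). 2 * e') * norm v"
    proof (intro mult_right_mono sum_mono)
      fix b :: 'a assume "b \<in> Basis"
      have "dist (dd b F y) (dd b F y') \<le> dist (dd b F y) (dd b F z) + dist (dd b F y') (dd b F z)"
        by (rule dist_triangle2)
      thus "norm (dd b F y - dd b F y') \<le> 2 * e'"
        using d(3)[OF y \<open>b \<in> Basis\<close>] d(3)[OF y' \<open>b \<in> Basis\<close>] by (simp add: dist_norm)
    qed simp
    also have "(\<Sum>b\<in>(Basis::'a set). 2 * e') = e" by (simp add: e'_def)
    finally show "norm (dd v F y - dd v F y') \<le> e * norm v" .
  qed
qed

text \<open>Mean value inequality for \<open>F\<close> minus its linearisation at \<open>z\<close>.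
  The increment runs between two arbitrary points of \<open>S\<close> and does not start at
  \<open>z\<close>: this is strict differentiability.\<close>

lemma C1b_strict:
  fixes F :: "'a::euclidean_space \<Rightarrow> 'b::real_normed_vector"
  assumes S: "convex S" and d: "\<And>y. y \<in> S \<Longrightarrow> F differentiable (at y)"
    and e: "\<And>y v. y \<in> S \<Longrightarrow> norm (dd v F y - dd v F z) \<le> e * norm v"
    and "z \<in> S" "y \<in> S" "y' \<in> S"
  shows "norm (F y' - F y - dd (y' - y) F z) \<le> e * norm (y' - y)"
proof -
  have "norm (F y' - F y - (\<lambda>v. dd v F z) (y' - y)) \<le> norm (y' - y) * e"
  proof (rule differentiable_bound_linearization[where S = S and f' = "\<lambda>x v. dd v F x"])
    show "y + t *\<^sub>R (y' - y) \<in> S" if "t \<in> {0..1}" for t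
    proof -
      have "y + t *\<^sub>R (y' - y) = (1 - t) *\<^sub>R y + t *\<^sub>R y'" by (simp add: algebra_simps)
      thus ?thesis using S assms(5,6) that by (auto intro: convexD)
    qed
    show "(F has_derivative (\<lambda>v. dd v F x)) (at x within S)" if "x \<in> S" for x
      using has_derivative_dd[OF d[OF that]] by (rule has_derivative_at_withinI)
    show "onorm ((\<lambda>v. dd v F x) - (\<lambda>v. dd v F z)) \<le> e" if "x \<in> S" for x
      using e[OF that] by (intro onorm_le) auto
  qed (rule assms(4))
  thus ?thesis by (simp add: mult.commute)
qed

lemma C1b_lipschitz:
  fixes F :: "'a::euclidean_space \<Rightarrow> 'b::real_normed_vector"
  assumes S: "convex S" and d: "\<And>y. y \<in> S \<Longrightarrow> F differentiable (at y)"
    and e: "\<And>y v. y \<in> S \<Longrightarrow> norm (dd v F y) \<le> M * norm v"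
    and "y \<in> S" "y' \<in> S"
  shows "norm (F y' - F y) \<le> M * norm (y' - y)"
proof (rule differentiable_bound[where S = S and f' = "\<lambda>x v. dd v F x"])
  show "(F has_derivative (\<lambda>v. dd v F x)) (at x within S)" if "x \<in> S" for x
    using has_derivative_dd[OF d[OF that]] by (rule has_derivative_at_withinI)
  show "onorm (\<lambda>v. dd v F x) \<le> M" if "x \<in> S" for x
    using e[OF that] by (intro onorm_le) auto
qed (use assms in auto)

text \<open>For $\Delta(y', y) = F(y') - F(y)$ the following predicates express that $F$ is Lipschitz and strictly
  differentiable, without mentioning a derivative.  They are needed for error terms $\Delta(y', y)$ that
  are not increments of a function of one point.\<close>

abbreviation close_quotients :: "'a::euclidean_space set \<Rightarrow> ('a \<Rightarrow> 'a \<Rightarrow> 'b::real_normed_vector) \<Rightarrow> real \<Rightarrow> real \<Rightarrow> 'a set \<Rightarrow> bool" where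
  "close_quotients K \<Delta> M e U \<equiv>
    \<forall>y\<in>U \<inter> K. \<forall>y'\<in>U \<inter> K. \<forall>x\<in>U \<inter> K. \<forall>x'\<in>U \<inter> K. \<forall>p>0. \<forall>q>0.
      norm (p *\<^sub>R \<Delta> y' y - q *\<^sub>R \<Delta> x' x)
        \<le> M * norm (p *\<^sub>R (y' - y) - q *\<^sub>R (x' - x)) + e * (p * norm (y' - y) + q * norm (x' - x))"

abbreviation close_ml_quotients ::
  "nat \<Rightarrow> 'a::euclidean_space set \<Rightarrow> ('a \<Rightarrow> 'a \<Rightarrow> 'a list \<Rightarrow> 'b::real_normed_vector) \<Rightarrow> real \<Rightarrow> real \<Rightarrow> 'a set \<Rightarrow> bool" where
  "close_ml_quotients k K \<Delta> M e U \<equiv>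
    \<forall>y\<in>U \<inter> K. \<forall>y'\<in>U \<inter> K. \<forall>x\<in>U \<inter> K. \<forall>x'\<in>U \<inter> K. \<forall>p>0. \<forall>q>0. \<forall>vs. length vs = k \<longrightarrow>
      norm (p *\<^sub>R \<Delta> y' y vs - q *\<^sub>R \<Delta> x' x vs)
        \<le> (M * norm (p *\<^sub>R (y' - y) - q *\<^sub>R (x' - x)) + e * (p * norm (y' - y) + q * norm (x' - x))) * prod_list (map norm vs)"

abbreviation close_maps :: "'a::euclidean_space set \<Rightarrow> ('a \<Rightarrow> 'a \<Rightarrow> 'b::real_normed_vector \<Rightarrow> 'b) \<Rightarrow> real \<Rightarrow> 'a set \<Rightarrow> bool" where
  "close_maps K L e U \<equiv> \<forall>y\<in>U \<inter> K. \<forall>y'\<in>U \<inter> K. \<forall>x\<in>U \<inter> K. \<forall>x'\<in>U \<inter> K. \<forall>w. norm (L y' y w - L x' x w) \<le> e * norm w"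

text \<open>The factors \<open>p\<close> and \<open>q\<close> are reciprocal step lengths. If
  \<open>p *\<^sub>R (y' - y) = q *\<^sub>R (x' - x)\<close>, the term with \<open>M\<close>
  vanishes and two difference quotients with the same displacement are compared. The term is kept
  because displacements that start equal drift apart along trajectories.\<close>

definition sd :: "'a::euclidean_space set \<Rightarrow> ('a \<Rightarrow> 'a \<Rightarrow> 'b::real_normed_vector) \<Rightarrow> real \<Rightarrow> bool" where
  "sd K \<Delta> M \<longleftrightarrow> 0 \<le> M \<and> (\<forall>y\<in>K. \<forall>y'\<in>K. norm (\<Delta> y' y) \<le> M * norm (y' - y)) \<and>
    (\<forall>z\<in>K. \<forall>e>0. \<exists>d>0. close_quotients K \<Delta> M e (ball z d))"

lemma sdI:
  fixes \<Delta> :: "'a::euclidean_space \<Rightarrow> 'a \<Rightarrow> 'b::real_normed_vector"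
  assumes "0 \<le> M" "\<And>y y'. y \<in> K \<Longrightarrow> y' \<in> K \<Longrightarrow> norm (\<Delta> y' y) \<le> M * norm (y' - y)"
    and "\<And>z e. z \<in> K \<Longrightarrow> 0 < e \<Longrightarrow> \<exists>d>0. close_quotients K \<Delta> M e (ball z d)"
  shows "sd K \<Delta> M"
  unfolding sd_def by (intro conjI ballI allI impI assms)

lemma sd_nonneg: "sd K \<Delta> M \<Longrightarrow> 0 \<le> M"
  and sd_lipschitz: "sd K \<Delta> M \<Longrightarrow> y \<in> K \<Longrightarrow> y' \<in> K \<Longrightarrow> norm (\<Delta> y' y) \<le> M * norm (y' - y)"
  and sd_close_quotients: "sd K \<Delta> M \<Longrightarrow> z \<in> K \<Longrightarrow> 0 < e \<Longrightarrow>
    \<exists>d>0. close_quotients K \<Delta> M e (ball z d)"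
  unfolding sd_def by (elim conjE, assumption, elim conjE, blast, elim conjE, drule (1) bspec, drule spec, erule (1) mp)

text \<open>The derivative is frozen at \<open>z\<close>. Acting on
  \<open>p *\<^sub>R (y' - y) - q *\<^sub>R (x' - x)\<close> it produces the term with
  \<open>M\<close>; the two remainders of strict differentiability produce the term with
  \<open>e\<close>.\<close>

lemma sd_C1b:
  fixes F :: "'a::euclidean_space \<Rightarrow> 'b::real_normed_vector"
  assumes K: "open K" "convex K" and F: "C1b K F"
  shows "\<exists>M. sd K (\<lambda>y' y. F y' - F y) M"
proof -
  obtain M where M: "0 < M" "\<And>x v. x \<in> K \<Longrightarrow> norm (dd v F x) \<le> M * norm v"
    using C1b_bound[OF F] by metis
  have diff: "\<And>y. y \<in> K \<Longrightarrow> F differentiable (at y)" using F by (simp add: C1b_def)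
  have "sd K (\<lambda>y' y. F y' - F y) M"
  proof (rule sdI)
    show "norm (F y' - F y) \<le> M * norm (y' - y)" if "y \<in> K" "y' \<in> K" for y y'
      by (rule C1b_lipschitz[OF K(2) diff M(2) that])
    fix z and e :: real assume z: "z \<in> K" and e: "0 < e"
    from dd_locally_close[OF K(1) F z e] obtain d where d: "0 < d" "ball z d \<subseteq> K"
      "\<And>y y' v. y \<in> ball z d \<Longrightarrow> y' \<in> ball z d \<Longrightarrow> norm (dd v F y - dd v F y') \<le> e * norm v" by blast
    have s: "norm (F y' - F y - dd (y' - y) F z) \<le> e * norm (y' - y)" if "y \<in> ball z d" "y' \<in> ball z d" for y y'
      by (rule C1b_strict[of "ball z d"]) (use that d diff in auto)
    show "\<exists>d>0. close_quotients K (\<lambda>y' y. F y' - F y) M e (ball z d)"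
    proof (intro exI[of _ d] conjI d(1) ballI allI impI)
      fix y y' x x' and p q :: real
      assume "y \<in> ball z d \<inter> K" "y' \<in> ball z d \<inter> K" "x \<in> ball z d \<inter> K" "x' \<in> ball z d \<inter> K" and pq: "0 < p" "0 < q"
      let ?E = "\<lambda>y' y. F y' - F y - dd (y' - y) F z"
      note lin = linear_dd[OF diff[OF z]]
      have "p *\<^sub>R (F y' - F y) - q *\<^sub>R (F x' - F x)
        = dd (p *\<^sub>R (y' - y) - q *\<^sub>R (x' - x)) F z + (p *\<^sub>R ?E y' y - q *\<^sub>R ?E x' x)"
        unfolding linear_diff[OF lin] linear_cmul[OF lin] by (simp add: algebra_simps)
      also have "norm \<dots> \<le> M * norm (p *\<^sub>R (y' - y) - q *\<^sub>R (x' - x)) + norm (p *\<^sub>R ?E y' y - q *\<^sub>R ?E x' x)"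
        by (rule norm_triangle_le) (intro add_mono M(2)[OF z] order_refl)
      also have "norm (p *\<^sub>R ?E y' y - q *\<^sub>R ?E x' x) \<le> p * norm (?E y' y) + q * norm (?E x' x)"
        using norm_triangle_ineq4[of "p *\<^sub>R ?E y' y" "q *\<^sub>R ?E x' x"] pq by simp
      also have "\<dots> \<le> p * (e * norm (y' - y)) + q * (e * norm (x' - x))"
        using pq \<open>y \<in> _\<close> \<open>y' \<in> _\<close> \<open>x \<in> _\<close> \<open>x' \<in> _\<close> by (intro add_mono mult_left_mono s) auto
      finally show "norm (p *\<^sub>R (F y' - F y) - q *\<^sub>R (F x' - F x)) \<le>
        M * norm (p *\<^sub>R (y' - y) - q *\<^sub>R (x' - x)) + e * (p * norm (y' - y) + q * norm (x' - x))"
        by (simp add: algebra_simps)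
    qed
  qed (use M in simp)
  thus ?thesis ..
qed

lemma sd_add:
  assumes "sd K \<Delta> M" "sd K \<Delta>' M'"
  shows "sd K (\<lambda>y' y. \<Delta> y' y + \<Delta>' y' y) (M + M')"
proof (rule sdI)
  show "norm (\<Delta> y' y + \<Delta>' y' y) \<le> (M + M') * norm (y' - y)" if "y \<in> K" "y' \<in> K" for y y'
    using sd_lipschitz[OF assms(1) that] sd_lipschitz[OF assms(2) that]
    by (simp add: distrib_right norm_triangle_le)
  fix z and e :: real assume z: "z \<in> K" and e: "0 < e"
  hence e2: "0 < e / 2" by simp
  from sd_close_quotients[OF assms(1) z e2] sd_close_quotients[OF assms(2) z e2] obtain d d' where d: "0 < d" "0 < d'"
    and 1: "\<And>y y' x x' p q. y\<in>ball z d \<inter> K \<Longrightarrow> y'\<in>ball z d \<inter> K \<Longrightarrow> x\<in>ball z d \<inter> K \<Longrightarrow> x'\<in>ball z d \<inter> K \<Longrightarrow> 0 < p \<Longrightarrow> 0 < q \<Longrightarrow>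
      norm (p *\<^sub>R \<Delta> y' y - q *\<^sub>R \<Delta> x' x) \<le>
        M * norm (p *\<^sub>R (y' - y) - q *\<^sub>R (x' - x)) + e / 2 * (p * norm (y' - y) + q * norm (x' - x))"
    and 2: "\<And>y y' x x' p q. y\<in>ball z d' \<inter> K \<Longrightarrow> y'\<in>ball z d' \<inter> K \<Longrightarrow> x\<in>ball z d' \<inter> K \<Longrightarrow> x'\<in>ball z d' \<inter> K \<Longrightarrow> 0 < p \<Longrightarrow> 0 < q \<Longrightarrow>
      norm (p *\<^sub>R \<Delta>' y' y - q *\<^sub>R \<Delta>' x' x) \<le>
        M' * norm (p *\<^sub>R (y' - y) - q *\<^sub>R (x' - x)) + e / 2 * (p * norm (y' - y) + q * norm (x' - x))"
    by metis
  show "\<exists>d>0. close_quotients K (\<lambda>y' y. \<Delta> y' y + \<Delta>' y' y) (M + M') e (ball z d)"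
  proof (intro exI[of _ "min d d'"] conjI ballI allI impI)
    fix y y' x x' and p q :: real
    assume "y \<in> ball z (min d d') \<inter> K" "y' \<in> ball z (min d d') \<inter> K" "x \<in> ball z (min d d') \<inter> K" "x' \<in> ball z (min d d') \<inter> K" and pq: "0 < p" "0 < q"
    have "p *\<^sub>R (\<Delta> y' y + \<Delta>' y' y) - q *\<^sub>R (\<Delta> x' x + \<Delta>' x' x)
      = (p *\<^sub>R \<Delta> y' y - q *\<^sub>R \<Delta> x' x) + (p *\<^sub>R \<Delta>' y' y - q *\<^sub>R \<Delta>' x' x)" by (simp add: algebra_simps)
    also have "norm \<dots> \<le> (M * norm (p *\<^sub>R (y' - y) - q *\<^sub>R (x' - x)) + e / 2 * (p * norm (y' - y) + q * norm (x' - x)))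
      + (M' * norm (p *\<^sub>R (y' - y) - q *\<^sub>R (x' - x)) + e / 2 * (p * norm (y' - y) + q * norm (x' - x)))"
      using pq \<open>y \<in> _\<close> \<open>y' \<in> _\<close> \<open>x \<in> _\<close> \<open>x' \<in> _\<close>
      by (intro norm_triangle_le add_mono 1 2) auto
    finally show "norm (p *\<^sub>R (\<Delta> y' y + \<Delta>' y' y) - q *\<^sub>R (\<Delta> x' x + \<Delta>' x' x)) \<le>
        (M + M') * norm (p *\<^sub>R (y' - y) - q *\<^sub>R (x' - x)) + e * (p * norm (y' - y) + q * norm (x' - x))"
      by (simp add: algebra_simps)
  qed (use d in auto)
qed (use sd_nonneg[OF assms(1)] sd_nonneg[OF assms(2)] in simp)

text \<open>A bounded continuous factor suffices, although it may fail to be Lipschitz: the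
  variation of \<open>\<rho>\<close> multiplies \<open>\<Delta>\<close>, which is already of first
  order in \<open>y' - y\<close>. Evaluating \<open>\<rho>\<close> at \<open>y'\<close> alone makes
  this possible.\<close>

lemma sd_prod:
  assumes B: "bounded_bilinear bil" and K: "open K"
    and D: "sd K \<Delta> M" and p: "Cb 0 K \<rho>"
  shows "\<exists>M. sd K (\<lambda>y' y. bil (\<rho> y') (\<Delta> y' y)) M"
proof -
  interpret B: bounded_bilinear bil by (rule B)
  obtain C where C: "0 < C" "\<And>a b. norm (bil a b) \<le> norm a * norm b * C"
    using B.pos_bounded by blast
  obtain P where P: "0 < P" "\<And>x. x \<in> K \<Longrightarrow> norm (\<rho> x) \<le> P"
    using p by (auto simp: bounded_pos)
  note M = sd_nonneg[OF D]
  have "sd K (\<lambda>y' y. bil (\<rho> y') (\<Delta> y' y)) (P * M * C)"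
  proof (rule sdI)
    show "norm (bil (\<rho> y') (\<Delta> y' y)) \<le> P * M * C * norm (y' - y)" if "y \<in> K" "y' \<in> K" for y y'
    proof -
      have "norm (bil (\<rho> y') (\<Delta> y' y)) \<le> norm (\<rho> y') * norm (\<Delta> y' y) * C" by (rule C(2))
      also have "\<dots> \<le> P * (M * norm (y' - y)) * C"
        using that P C(1) by (intro mult_right_mono mult_mono sd_lipschitz[OF D]) auto
      finally show ?thesis by (simp add: mult_ac)
    qed
    fix z and e :: real assume z: "z \<in> K" and e: "0 < e"
    \<comment> \<open>Each of the two error terms receives \<open>e / 2\<close>. In the second
      denominator \<open>M + 1\<close> stands for \<open>M\<close>, which may vanish.\<close>
    define e1 where "e1 = e / (2 * P * C)"
    define e2 where "e2 = e / (2 * (M + 1) * C)"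
    have e1: "0 < e1" and e2: "0 < e2" using e P C M by (simp_all add: e1_def e2_def)
    from sd_close_quotients[OF D z e1] obtain d where d: "0 < d"
      and 1: "\<And>y y' x x' p q. y\<in>ball z d \<inter> K \<Longrightarrow> y'\<in>ball z d \<inter> K \<Longrightarrow> x\<in>ball z d \<inter> K \<Longrightarrow> x'\<in>ball z d \<inter> K \<Longrightarrow> 0 < p \<Longrightarrow> 0 < q \<Longrightarrow>
        norm (p *\<^sub>R \<Delta> y' y - q *\<^sub>R \<Delta> x' x) \<le>
          M * norm (p *\<^sub>R (y' - y) - q *\<^sub>R (x' - x)) + e1 * (p * norm (y' - y) + q * norm (x' - x))"
      by metis
    have "isCont \<rho> z" using p K z by (simp add: continuous_on_eq_continuous_at)
    then obtain d' where d': "0 < d'" "\<And>y. y \<in> ball z d' \<Longrightarrow> dist (\<rho> y) (\<rho> z) < e2 / 2"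
      using e2 unfolding continuous_at_eps_delta by (metis half_gt_zero_iff mem_ball dist_commute)
    have 2: "norm (\<rho> y - \<rho> x) \<le> e2" if "y \<in> ball z d'" "x \<in> ball z d'" for x y
      using d'(2)[OF that(1)] d'(2)[OF that(2)] dist_triangle2[of "\<rho> y" "\<rho> x" "\<rho> z"] by (simp add: dist_norm)
    show "\<exists>d>0. close_quotients K (\<lambda>y' y. bil (\<rho> y') (\<Delta> y' y)) (P * M * C) e (ball z d)"
    proof (intro exI[of _ "min d d'"] conjI ballI allI impI)
      fix y y' x x' and p q :: real
      assume mem: "y \<in> ball z (min d d') \<inter> K" "y' \<in> ball z (min d d') \<inter> K" "x \<in> ball z (min d d') \<inter> K" "x' \<in> ball z (min d d') \<inter> K" and pq: "0 < p" "0 < q"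
      let ?n = "p * norm (y' - y) + q * norm (x' - x)"
      let ?m = "norm (p *\<^sub>R (y' - y) - q *\<^sub>R (x' - x))"
      have "p *\<^sub>R bil (\<rho> y') (\<Delta> y' y) - q *\<^sub>R bil (\<rho> x') (\<Delta> x' x)
        = bil (\<rho> y') (p *\<^sub>R \<Delta> y' y - q *\<^sub>R \<Delta> x' x) + q *\<^sub>R bil (\<rho> y' - \<rho> x') (\<Delta> x' x)"
        by (simp add: B.diff_left B.diff_right B.scaleR_right algebra_simps)
      also have "norm \<dots> \<le> norm (\<rho> y') * norm (p *\<^sub>R \<Delta> y' y - q *\<^sub>R \<Delta> x' x) * C + q * (norm (\<rho> y' - \<rho> x') * norm (\<Delta> x' x) * C)"
        using pq C(2)[of "\<rho> y' - \<rho> x'" "\<Delta> x' x"] by (intro norm_triangle_le add_mono C(2)) simp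
      also have "\<dots> \<le> P * (M * ?m + e1 * ?n) * C + q * (e2 * (M * norm (x' - x)) * C)"
        using pq P C(1) e1 e2 M mem
        by (intro add_mono mult_right_mono mult_left_mono mult_mono 1 2 sd_lipschitz[OF D]) auto
      also have "\<dots> = P * M * C * ?m + P * e1 * C * ?n + (e2 * M * C) * (q * norm (x' - x))"
        by (simp add: algebra_simps)
      also have "\<dots> \<le> P * M * C * ?m + e / 2 * ?n + e / 2 * ?n"
      proof (intro add_mono order_refl mult_mono)
        show "P * e1 * C \<le> e / 2" using P C by (simp add: e1_def)
        have "e2 * M * C \<le> e2 * (M + 1) * C" using M C(1) e2 by (intro mult_right_mono mult_left_mono) auto
        also have "\<dots> = e * ((M + 1) * C) / (2 * ((M + 1) * C))" by (simp add: e2_def mult_ac)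
        also have "\<dots> = e / 2" using M C(1) by (intro mult_divide_mult_cancel_right) simp
        finally show "e2 * M * C \<le> e / 2" .
      qed (use pq e in auto)
      finally show "norm (p *\<^sub>R bil (\<rho> y') (\<Delta> y' y) - q *\<^sub>R bil (\<rho> x') (\<Delta> x' x)) \<le>
          P * M * C * ?m + e * ?n" by (simp add: algebra_simps)
    qed (use d d' in auto)
  qed (use P C M in simp)
  thus ?thesis ..
qed

lemma sd_cong:
  assumes "\<And>y y'. y \<in> K \<Longrightarrow> y' \<in> K \<Longrightarrow> \<Delta> y' y = \<Delta>' y' y" "sd K \<Delta> M"
  shows "sd K \<Delta>' M"
  using assms unfolding sd_def by simp

lemma ex_sd_sum:
  assumes "finite I" "\<And>i. i \<in> I \<Longrightarrow> \<exists>M. sd K (\<Delta> i) M"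
  shows "\<exists>M. sd K (\<lambda>y' y. \<Sum>i\<in>I. \<Delta> i y' y) M"
  using assms
proof (induction I)
  case empty
  have "sd K (\<lambda>y' y. 0) 0" unfolding sd_def by (auto intro!: exI[of _ 1])
  thus ?case by auto
next
  case (insert i I)
  then obtain M M' where "sd K (\<Delta> i) M" "sd K (\<lambda>y' y. \<Sum>i\<in>I. \<Delta> i y' y) M'" by (meson insertCI)
  from sd_add[OF this] show ?case using insert.hyps by auto
qed

lemma ex_sd_add: "\<exists>M. sd K \<Delta> M \<Longrightarrow> \<exists>M. sd K \<Delta>' M \<Longrightarrow> \<exists>M. sd K (\<lambda>y' y. \<Delta> y' y + \<Delta>' y' y) M"
  using sd_add by blast

lemma ex_sd_minus: "\<exists>M. sd K \<Delta> M \<Longrightarrow> \<exists>M. sd K (\<lambda>y' y. - \<Delta> y' y) M"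
proof -
  have "norm (p *\<^sub>R - \<Delta> y' y - q *\<^sub>R - \<Delta> x' x) = norm (p *\<^sub>R \<Delta> y' y - q *\<^sub>R \<Delta> x' x)" for y y' x x' p q
    by (simp add: norm_minus_commute)
  thus "\<exists>M. sd K \<Delta> M \<Longrightarrow> \<exists>M. sd K (\<lambda>y' y. - \<Delta> y' y) M" by (auto simp: sd_def)
qed

lemma ex_sd_diff: "\<exists>M. sd K \<Delta> M \<Longrightarrow> \<exists>M. sd K \<Delta>' M \<Longrightarrow> \<exists>M. sd K (\<lambda>y' y. \<Delta> y' y - \<Delta>' y' y) M"
  using ex_sd_add[of K \<Delta> "\<lambda>y' y. - \<Delta>' y' y"] ex_sd_minus[of K \<Delta>'] by simp

lemma ex_sd_scaleR:
  "open K \<Longrightarrow> Cb 0 K (\<rho> :: _ \<Rightarrow> real) \<Longrightarrow> \<exists>M. sd K \<Delta> M \<Longrightarrow> \<exists>M. sd K (\<lambda>y' y. \<rho> y' *\<^sub>R \<Delta> y' y) M"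
  using sd_prod[OF bounded_bilinear_scaleR] by blast

lemma ex_sd_scaleR_flip:
  "open K \<Longrightarrow> Cb 0 K \<rho> \<Longrightarrow> \<exists>M. sd K (\<Delta> :: _ \<Rightarrow> _ \<Rightarrow> real) M \<Longrightarrow> \<exists>M. sd K (\<lambda>y' y. \<Delta> y' y *\<^sub>R \<rho> y') M"
  using sd_prod[OF bounded_bilinear.flip[OF bounded_bilinear_scaleR]] by blast

text \<open>Quotients at nearby points, with one direction \<open>u\<close> but independent steps,
  are assumed close. Equal base points make the quotients at \<open>z\<close> Cauchy, shifting the
  base point by \<open>s *\<^sub>R u\<close> makes the limit additive, and varying the base point
  makes the derivative continuous.\<close>

lemma strict_quotients_C1b:
  fixes F :: "'a::euclidean_space \<Rightarrow> 'b::euclidean_space"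
  assumes K: "open K" and M: "0 \<le> M"
    and lip: "\<And>y z. y \<in> K \<Longrightarrow> z \<in> K \<Longrightarrow> norm (F y - F z) \<le> M * norm (y - z)"
    and st: "\<And>z e. z \<in> K \<Longrightarrow> 0 < e \<Longrightarrow> \<exists>d>0. ball z d \<subseteq> K \<and> (\<forall>y\<in>ball z d. \<forall>s s' u. 0 < s \<longrightarrow> s < d \<longrightarrow> 0 < s' \<longrightarrow> s' < d \<longrightarrow>
       norm u \<le> 1 \<longrightarrow> y + s *\<^sub>R u \<in> K \<longrightarrow> z + s' *\<^sub>R u \<in> K \<longrightarrow>
       norm ((1 / s) *\<^sub>R (F (y + s *\<^sub>R u) - F y) - (1 / s') *\<^sub>R (F (z + s' *\<^sub>R u) - F z)) \<le> e)"
  shows "C1b K F"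
proof -
  define q where "q s y u = (1 / s) *\<^sub>R (F (y + s *\<^sub>R u) - F y)" for s y u
  have q_bound: "norm (q s y u) \<le> M * norm u" if "y \<in> K" "y + s *\<^sub>R u \<in> K" "0 < s" for s y u
    using lip[OF that(2,1)] that(3) by (simp add: q_def divide_simps mult_ac)
  have q_scale: "q s y (c *\<^sub>R u) = c *\<^sub>R q (s * c) y u" if "c \<noteq> 0" for s y c u
    using that by (simp add: q_def)
  \<comment> \<open>From the unit ball of directions to a ball of radius \<open>R\<close>: a
    direction \<open>u\<close> with step \<open>s\<close> is the direction
    \<open>u /\<^sub>R R\<close> with step \<open>s * R\<close>. The radius is also shrunk until the
    shifted points lie in \<open>K\<close>, so that membership need not be assumed any more.\<close>
  have st': "\<exists>d>0. ball z d \<subseteq> K \<and> (\<forall>y\<in>ball z d. \<forall>s s' u. 0 < s \<longrightarrow> s < d \<longrightarrow> 0 < s' \<longrightarrow> s' < d \<longrightarrow> norm u \<le> R \<longrightarrow>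
      y + s *\<^sub>R u \<in> K \<and> norm (q s y u - q s' z u) \<le> e)" if z: "z \<in> K" and e: "0 < e" and R: "0 < R" for z e R
  proof -
    have "0 < e / R" using e R by simp
    from st[OF z this] obtain d where d: "0 < d" and dK: "ball z d \<subseteq> K"
      and dq: "\<And>y s s' u. y \<in> ball z d \<Longrightarrow> 0 < s \<Longrightarrow> s < d \<Longrightarrow> 0 < s' \<Longrightarrow> s' < d \<Longrightarrow> norm u \<le> 1 \<Longrightarrow>
        y + s *\<^sub>R u \<in> K \<Longrightarrow> z + s' *\<^sub>R u \<in> K \<Longrightarrow> norm (q s y u - q s' z u) \<le> e / R"
      unfolding q_def by blast
    define d' where "d' = min (d / 2) (d / (2 * R))"
    have d': "0 < d'" "d' \<le> d / 2" "d' * R \<le> d / 2"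
    proof -
      show "0 < d'" "d' \<le> d / 2" using d R by (simp_all add: d'_def)
      have "d' * R \<le> d / (2 * R) * R" using R by (intro mult_right_mono) (auto simp: d'_def)
      thus "d' * R \<le> d / 2" using R by simp
    qed
    have sK: "y + s *\<^sub>R u \<in> K" if "y \<in> ball z d'" "0 < s" "s < d'" "norm u \<le> R" for y s and u :: 'a
    proof -
      have "norm (s *\<^sub>R u) \<le> d' * R" using that R by (simp add: mult_mono)
      hence "norm ((y + s *\<^sub>R u) - z) < d"
        using that(1) d' norm_triangle_ineq[of "y - z" "s *\<^sub>R u"] by (simp add: dist_norm norm_minus_commute algebra_simps)
      thus ?thesis using dK by (auto simp: dist_norm norm_minus_commute)
    qed
    show ?thesis
    proof (intro exI[of _ d'] conjI ballI allI impI d'(1) sK)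
      show "ball z d' \<subseteq> K" using dK d' d subset_ball[of d' d z] by auto
      fix y s s' and u :: 'a assume y: "y \<in> ball z d'" and s: "0 < s" "s < d'" "0 < s'" "s' < d'" and u: "norm u \<le> R"
      have "norm (q (s * R) y (u /\<^sub>R R) - q (s' * R) z (u /\<^sub>R R)) \<le> e / R"
      proof (rule dq)
        show "y \<in> ball z d" using y d' d by auto
        have "s * R < d' * R" "s' * R < d' * R" using s R by simp_all
        thus "s * R < d" "s' * R < d" using d'(3) d by linarith+
        show "norm (u /\<^sub>R R) \<le> 1" using u R by (simp add: divide_simps)
        show "y + (s * R) *\<^sub>R (u /\<^sub>R R) \<in> K" using sK[OF y s(1,2) u] R by (simp add: mult.assoc)
        show "z + (s' * R) *\<^sub>R (u /\<^sub>R R) \<in> K" using sK[OF _ s(3,4) u, of z] R d' by (simp add: mult.assoc)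
      qed (use s R in auto)
      hence "R * norm (q (s * R) y (u /\<^sub>R R) - q (s' * R) z (u /\<^sub>R R)) \<le> e" using R by (simp add: field_simps)
      moreover have "q s y u - q s' z u = R *\<^sub>R (q (s * R) y (u /\<^sub>R R) - q (s' * R) z (u /\<^sub>R R))"
        using q_scale[of R s y "u /\<^sub>R R"] q_scale[of R s' z "u /\<^sub>R R"] R by (simp add: scaleR_diff_right)
      ultimately show "norm (q s y u - q s' z u) \<le> e" using R by simp
    qed
  qed
  \<comment> \<open>Letting only the second step tend to 0 keeps the uniformity in the base point
    \<open>y\<close> of the first quotient, which additivity and continuity of the derivative rely
    on.\<close>
  have "\<exists>l. \<forall>R>0. \<forall>e>0. \<exists>d>0. ball z d \<subseteq> K \<and> (\<forall>y\<in>ball z d. \<forall>s u. 0 < s \<longrightarrow> s < d \<longrightarrow> norm u \<le> R \<longrightarrow>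
      y + s *\<^sub>R u \<in> K \<and> norm (q s y u - l u) \<le> e)" if z: "z \<in> K" for z
  proof -
    let ?S = "\<lambda>u n. q (1 / real (Suc n)) z u"
    have small: "\<exists>N. \<forall>n\<ge>N. 1 / real (Suc n) < d" if "0 < d" for d
    proof -
      obtain N where "1 / real (Suc N) < d" using nat_approx_posE[OF \<open>0 < d\<close>] by blast
      moreover have "1 / real (Suc n) \<le> 1 / real (Suc N)" if "N \<le> n" for n
        using that by (intro divide_left_mono) auto
      ultimately show ?thesis by (meson order_le_less_trans)
    qed
    have cau: "Cauchy (?S u)" for u
    proof (rule metric_CauchyI)
      fix e :: real assume e: "0 < e"
      have R: "0 < norm u + 1" by (simp add: add_nonneg_pos)
      have R': "norm u \<le> norm u + 1" by simp
      from st'[OF z half_gt_zero[OF e] R] R' obtain d where d: "0 < d"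
        and dq: "\<And>s s'. 0 < s \<Longrightarrow> s < d \<Longrightarrow> 0 < s' \<Longrightarrow> s' < d \<Longrightarrow> norm (q s z u - q s' z u) \<le> e / 2"
        by (meson centre_in_ball)
      from small[OF d] obtain N where "\<forall>n\<ge>N. 1 / real (Suc n) < d" ..
      hence *: "\<forall>m\<ge>N. \<forall>n\<ge>N. norm (?S u m - ?S u n) \<le> e / 2" using dq by simp
      thus "\<exists>N. \<forall>m\<ge>N. \<forall>n\<ge>N. dist (?S u m) (?S u n) < e"
      proof (intro exI[of _ N] allI impI)
        fix m n assume "N \<le> m" "N \<le> n"
        hence "norm (?S u m - ?S u n) \<le> e / 2" using * by blast
        also have "\<dots> < e" using e by simp
        finally show "dist (?S u m) (?S u n) < e" by (simp only: dist_norm)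
      qed
    qed
    define l where "l u = lim (?S u)" for u
    have l: "?S u \<longlonglongrightarrow> l u" for u
      using cau[of u] unfolding l_def by (simp add: Cauchy_convergent_iff convergent_LIMSEQ_iff)
    show ?thesis
    proof (intro exI[of _ l] allI impI)
      fix R e :: real assume "0 < R" "0 < e"
      from st'[OF z this(2,1)] obtain d where d: "0 < d" and dK: "ball z d \<subseteq> K"
        and dq: "\<And>y s s' u. y \<in> ball z d \<Longrightarrow> 0 < s \<Longrightarrow> s < d \<Longrightarrow> 0 < s' \<Longrightarrow> s' < d \<Longrightarrow> norm u \<le> R \<Longrightarrow>
          y + s *\<^sub>R u \<in> K \<and> norm (q s y u - q s' z u) \<le> e" by blast
      from small[OF d] obtain N where N: "\<forall>n\<ge>N. 1 / real (Suc n) < d" ..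
      show "\<exists>d>0. ball z d \<subseteq> K \<and> (\<forall>y\<in>ball z d. \<forall>s u. 0 < s \<longrightarrow> s < d \<longrightarrow> norm u \<le> R \<longrightarrow>
        y + s *\<^sub>R u \<in> K \<and> norm (q s y u - l u) \<le> e)"
      proof (intro exI[of _ d] conjI d dK ballI allI impI)
        fix y s and u :: 'a assume y: "y \<in> ball z d" "0 < s" "s < d" "norm u \<le> R"
        show "y + s *\<^sub>R u \<in> K" using dq[OF y(1,2,3) _ _ y(4), of "d/2"] d by simp
        have "(\<lambda>n. norm (q s y u - ?S u n)) \<longlonglongrightarrow> norm (q s y u - l u)"
          by (intro tendsto_intros l)
        thus "norm (q s y u - l u) \<le> e"
          by (rule LIMSEQ_le_const2) (use N dq[OF y(1,2,3) _ _ y(4)] in \<open>auto intro!: exI[of _ N]\<close>)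
      qed
    qed
  qed
  then obtain l where l: "\<And>z R e. z \<in> K \<Longrightarrow> 0 < R \<Longrightarrow> 0 < e \<Longrightarrow> \<exists>d>0. ball z d \<subseteq> K \<and> (\<forall>y\<in>ball z d. \<forall>s u. 0 < s \<longrightarrow> s < d \<longrightarrow> norm u \<le> R \<longrightarrow>
      y + s *\<^sub>R u \<in> K \<and> norm (q s y u - l z u) \<le> e)" by metis
  have l_bound: "norm (l z u) \<le> M * norm u" if z: "z \<in> K" for z u
  proof (rule field_le_epsilon)
    fix e :: real assume e: "0 < e"
    have R: "0 < norm u + 1" "norm u \<le> norm u + 1" by (simp_all add: add_nonneg_pos)
    obtain d where d: "0 < d" "\<And>s. 0 < s \<Longrightarrow> s < d \<Longrightarrow> z + s *\<^sub>R u \<in> K \<and> norm (q s z u - l z u) \<le> e"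
      using l[OF z R(1) e] R(2) by (meson centre_in_ball)
    have "norm (l z u) \<le> norm (q (d/2) z u) + norm (q (d/2) z u - l z u)"
      using norm_triangle_ineq4[of "q (d/2) z u" "q (d/2) z u - l z u"] by simp
    also have "\<dots> \<le> M * norm u + e" using d(2)[of "d/2"] d(1) q_bound[OF z] by (intro add_mono) auto
    finally show "norm (l z u) \<le> M * norm u + e" .
  qed
  have eq_by_small: "a = b" if "\<And>e. 0 < e \<Longrightarrow> norm (a - b) \<le> 3 * e" for a b :: 'b
  proof (rule ccontr)
    assume "a \<noteq> b"
    hence "0 < norm (a - b) / 4" by simp
    from that[OF this] \<open>a \<noteq> b\<close> show False by simp
  qed
  have l_add: "l z (u + w) = l z w + l z u" if z: "z \<in> K" for z u w
  proof (rule eq_by_small)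
    fix e :: real assume e: "0 < e"
    define R where "R = norm u + norm w + 1"
    have R: "0 < R" "norm u \<le> R" "norm w \<le> R" "norm (u + w) \<le> R"
      using norm_triangle_ineq[of u w] by (auto simp: R_def add_nonneg_pos)
    from l[OF z R(1) e] obtain d where d: "0 < d"
      and dq: "\<And>y s u. y \<in> ball z d \<Longrightarrow> 0 < s \<Longrightarrow> s < d \<Longrightarrow> norm u \<le> R \<Longrightarrow> norm (q s y u - l z u) \<le> e" by blast
    define s where "s = min (d / 2) (d / (2 * R))"
    have s: "0 < s" "s < d" and sR: "s * R < d"
    proof -
      show "0 < s" "s < d" using d R by (auto simp: s_def)
      have "s * R \<le> d / (2 * R) * R" using R by (intro mult_right_mono) (auto simp: s_def)
      also have "\<dots> = d / 2" using R by simp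
      also have "\<dots> < d" using d by simp
      finally show "s * R < d" .
    qed
    have "norm (s *\<^sub>R u) \<le> s * R" using s R by simp
    hence y: "z + s *\<^sub>R u \<in> ball z d" using sR by (simp add: dist_norm)
    \<comment> \<open>The quotient for \<open>u + w\<close> telescopes through
      \<open>z + s *\<^sub>R u\<close>, a nearby base point whose quotients are also close to
      \<open>l z\<close>.\<close>
    have "q s z (u + w) = q s (z + s *\<^sub>R u) w + q s z u"
      by (simp add: q_def algebra_simps)
    hence "l z (u + w) - (l z w + l z u)
      = (q s (z + s *\<^sub>R u) w - l z w) + (q s z u - l z u) - (q s z (u + w) - l z (u + w))" by simp
    also have "norm \<dots> \<le> e + e + e"
      by (intro norm_triangle_le norm_triangle_le_diff add_mono dq y s R) (use d in auto)
    finally show "norm (l z (u + w) - (l z w + l z u)) \<le> 3 * e" by simp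
  qed
  have l_pos: "l z (c *\<^sub>R u) = c *\<^sub>R l z u" if z: "z \<in> K" and c: "0 < c" for z u c
  proof (rule eq_by_small)
    fix e :: real assume e: "0 < e"
    have R: "0 < norm w + 1" "norm w \<le> norm w + 1" for w :: 'a by (simp_all add: add_nonneg_pos)
    from l[OF z R(1) e] R(2) obtain d where d: "0 < d" and dq: "\<And>s. 0 < s \<Longrightarrow> s < d \<Longrightarrow> norm (q s z (c *\<^sub>R u) - l z (c *\<^sub>R u)) \<le> e"
      by (meson centre_in_ball)
    have "0 < e / c" using e c by simp
    from l[OF z R(1) this] R(2) obtain d' where d': "0 < d'" and dq': "\<And>s. 0 < s \<Longrightarrow> s < d' \<Longrightarrow> norm (q s z u - l z u) \<le> e / c"
      by (meson centre_in_ball)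
    define s where "s = min (d / 2) (d' / (2 * c))"
    have s: "0 < s" "s < d" "0 < s * c" "s * c < d'"
    proof -
      show "0 < s" "s < d" "0 < s * c" using d d' c by (auto simp: s_def)
      have "s * c \<le> d' / (2 * c) * c" using c by (intro mult_right_mono) (auto simp: s_def)
      also have "\<dots> < d'" using c d' by simp
      finally show "s * c < d'" .
    qed
    have "l z (c *\<^sub>R u) - c *\<^sub>R l z u = c *\<^sub>R (q (s * c) z u - l z u) - (q s z (c *\<^sub>R u) - l z (c *\<^sub>R u))"
      using q_scale[of c s z u] c by (simp add: algebra_simps)
    also have "norm \<dots> \<le> norm (c *\<^sub>R (q (s * c) z u - l z u)) + norm (q s z (c *\<^sub>R u) - l z (c *\<^sub>R u))"
      by (rule norm_triangle_ineq4)
    also have "\<dots> \<le> c * (e / c) + e"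
      unfolding norm_scaleR using c by (intro add_mono dq s) (simp_all only: abs_of_pos mult_left_mono[OF dq'[OF s(3,4)]] less_imp_le)
    also have "\<dots> \<le> 3 * e" using c e by simp
    finally show "norm (l z (c *\<^sub>R u) - c *\<^sub>R l z u) \<le> 3 * e" .
  qed
  have l0: "l z 0 = 0" if "z \<in> K" for z using l_bound[OF that, of 0] by simp
  have lin: "linear (l z)" if z: "z \<in> K" for z
  proof (rule linearI)
    show "l z (u + w) = l z u + l z w" for u w using l_add[OF z] by (simp add: add.commute)
    show "l z (c *\<^sub>R u) = c *\<^sub>R l z u" for c u
    proof (cases "c = 0" "0 < c" rule: bool.exhaust[case_product bool.exhaust])
      case True_True thus ?thesis using l0[OF z] by simp
    next
      case True_False thus ?thesis using l0[OF z] by simp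
    next
      case False_True thus ?thesis using l_pos[OF z] by simp
    next
      case False_False
      hence "0 < - c" by simp
      from l_pos[OF z this, of u] l_add[OF z, of "c *\<^sub>R u" "(- c) *\<^sub>R u"] l0[OF z]
      show ?thesis by (simp add: eq_neg_iff_add_eq_0[symmetric])
    qed
  qed
  have der: "(F has_derivative l z) (at z)" if z: "z \<in> K" for z
  proof -
    have bl: "bounded_linear (l z)" using lin[OF z] by (simp add: linear_conv_bounded_linear)
    show ?thesis unfolding has_derivative_at_alt
    proof (intro conjI bl allI impI)
      fix e :: real assume e: "0 < e"
      from l[OF z zero_less_one e] obtain d where d: "0 < d"
        and dq: "\<And>s u. 0 < s \<Longrightarrow> s < d \<Longrightarrow> norm u \<le> 1 \<Longrightarrow> norm (q s z u - l z u) \<le> e"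
        by (metis centre_in_ball)
      show "\<exists>d>0. \<forall>y. norm (y - z) < d \<longrightarrow> norm (F y - F z - l z (y - z)) \<le> e * norm (y - z)"
      proof (intro exI[of _ d] conjI d allI impI)
        fix y assume y: "norm (y - z) < d"
        show "norm (F y - F z - l z (y - z)) \<le> e * norm (y - z)"
        proof (cases "y = z")
          case False
          \<comment> \<open>The length of the increment becomes the step and its direction a unit
            vector; uniformity over directions makes \<open>l z\<close> a Frechet
            derivative.\<close>
          define s where "s = norm (y - z)"
          have s: "0 < s" "s < d" using False y by (simp_all add: s_def)
          define u where "u = (1 / s) *\<^sub>R (y - z)"
          have su: "s *\<^sub>R u = y - z" and nu: "norm u \<le> 1" using s by (simp_all add: u_def s_def)
          have "F y - F z - l z (y - z) = s *\<^sub>R (q s z u - l z u)"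
            using linear_cmul[OF lin[OF z], of s u] s su by (simp add: q_def scaleR_diff_right)
          also have "norm \<dots> \<le> s * e" using dq[OF s nu] s by simp
          finally show ?thesis by (simp add: s_def mult.commute)
        qed (use l0[OF z] in simp)
      qed
    qed
  qed
  show ?thesis
    unfolding C1b_def
  proof (intro conjI ballI allI)
    show "F differentiable (at z)" if "z \<in> K" for z using der[OF that] by (rule differentiableI)
    fix u
    have eq: "dd u F z = l z u" if "z \<in> K" for z using der[OF that] by (rule dd_eq)
    have "bounded (dd u F ` K)"
      unfolding bounded_iff by (intro exI[of _ "M * norm u"]) (auto simp: eq l_bound)
    moreover have "continuous_on K (dd u F)"
      unfolding continuous_on_eq_continuous_at[OF K] continuous_at_eps_delta
    proof (intro ballI allI impI)
      fix z and e :: real assume z: "z \<in> K" and e: "0 < e"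
      hence e3: "0 < e / 3" by simp
      have R: "0 < norm u + 1" and R': "norm u \<le> norm u + 1" by (simp_all add: add_nonneg_pos)
      from l[OF z R e3] R' obtain d where d: "0 < d" and dK: "ball z d \<subseteq> K"
        and dq: "\<And>y s. y \<in> ball z d \<Longrightarrow> 0 < s \<Longrightarrow> s < d \<Longrightarrow> norm (q s y u - l z u) \<le> e / 3"
        by meson
      show "\<exists>d>0. \<forall>y. dist y z < d \<longrightarrow> dist (dd u F y) (dd u F z) < e"
      proof (intro exI[of _ d] conjI d allI impI)
        fix y assume "dist y z < d"
        hence y: "y \<in> ball z d" by (simp add: dist_commute)
        hence yK: "y \<in> K" using dK by auto
        from l[OF yK R e3] R' obtain d' where d': "0 < d'"
          and dq': "\<And>s. 0 < s \<Longrightarrow> s < d' \<Longrightarrow> norm (q s y u - l y u) \<le> e / 3"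
          by (meson centre_in_ball)
        define s where "s = min d d' / 2"
        have s: "0 < s" "s < d" "s < d'" using d d' by (auto simp: s_def)
        have "norm (l y u - l z u) \<le> norm (q s y u - l z u) + norm (q s y u - l y u)"
          using norm_triangle_ineq4[of "q s y u - l z u" "q s y u - l y u"] by simp
        also have "\<dots> \<le> e / 3 + e / 3" by (intro add_mono dq dq' y s)
        also have "\<dots> < e" using e by simp
        finally show "dist (dd u F y) (dd u F z) < e" using eq z yK by (simp add: dist_norm)
      qed
    qed
    ultimately show "Cb 0 K (dd u F)" by simp
  qed
qed

section \<open>Derivatives along trajectories\<close>

definition traj :: "'a::real_normed_vector set \<Rightarrow> ('a \<Rightarrow> 'a) \<Rightarrow> (real \<Rightarrow> 'a) \<Rightarrow> bool" where
  "traj K G \<zeta> \<longleftrightarrow> (\<forall>t\<ge>0. \<zeta> t \<in> K \<and> (\<zeta> has_vector_derivative G (\<zeta> t)) (at t within {0..}))"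

text \<open>$F$ need not be differentiable, so this applies to the highest derivative of $h$ known to exist.\<close>

definition flow_deriv :: "'a::real_normed_vector set \<Rightarrow> ('a \<Rightarrow> 'a) \<Rightarrow> ('a \<Rightarrow> 'b::real_normed_vector) \<Rightarrow> ('a \<Rightarrow> 'b) \<Rightarrow> bool" where
  "flow_deriv K G F N \<longleftrightarrow> (\<forall>\<zeta>. traj K G \<zeta> \<longrightarrow>
     (\<forall>t\<ge>0. ((\<lambda>t. F (\<zeta> t)) has_vector_derivative N (\<zeta> t)) (at t within {0..})))"

lemma trajD: "traj K G \<zeta> \<Longrightarrow> 0 \<le> t \<Longrightarrow> \<zeta> t \<in> K"
  "traj K G \<zeta> \<Longrightarrow> 0 \<le> t \<Longrightarrow> (\<zeta> has_vector_derivative G (\<zeta> t)) (at t within {0..})"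
  by (simp_all add: traj_def)

lemma flow_derivD: "flow_deriv K G F N \<Longrightarrow> traj K G \<zeta> \<Longrightarrow> 0 \<le> t \<Longrightarrow>
    ((\<lambda>t. F (\<zeta> t)) has_vector_derivative N (\<zeta> t)) (at t within {0..})"
  by (simp add: flow_deriv_def)

lemma traj_continuous_on: "traj K G \<zeta> \<Longrightarrow> continuous_on {0..} \<zeta>"
  unfolding continuous_on_eq_continuous_within
  by (auto intro!: has_vector_derivative_continuous trajD(2))

lemma traj_compact: "traj K G \<zeta> \<Longrightarrow> compact (\<zeta> ` {0..T})"
  by (rule compact_continuous_image) (auto intro: continuous_on_subset[OF traj_continuous_on])

lemma at_0_halfline_nontriv: "at (0::real) within {0..} \<noteq> bot"
  using at_within_halfline[of 0 1] by (simp flip: at_within_halfline[of 0 1] add: trivial_limit_within islimpt_Icc)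

lemma has_vector_derivative_chain_dd:
  assumes "F differentiable (at (\<zeta> t))" "(\<zeta> has_vector_derivative v) (at t within S)"
  shows "((\<lambda>t. F (\<zeta> t)) has_vector_derivative dd v F (\<zeta> t)) (at t within S)"
  using vector_derivative_diff_chain_within[OF assms(2) has_derivative_at_withinI[OF has_derivative_dd[OF assms(1)]]]
  by (simp add: o_def)

text \<open>A statement along trajectories becomes a pointwise identity: every point of
  \<open>K\<close> is the start of a trajectory, and the one-sided derivative at time 0 is
  unique.\<close>

lemma flow_deriv_eq_dd:
  assumes "\<exists>\<zeta>. \<zeta> 0 = z \<and> traj K G \<zeta>" "flow_deriv K G F N" "F differentiable (at z)"
  shows "dd (G z) F z = N z"
proof -
  obtain \<zeta> where z: "\<zeta> 0 = z" "traj K G \<zeta>" using assms(1) by blast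
  have "((\<lambda>t. F (\<zeta> t)) has_vector_derivative dd (G (\<zeta> 0)) F (\<zeta> 0)) (at 0 within {0..})"
    using assms(3) z trajD(2)[OF z(2), of 0] by (intro has_vector_derivative_chain_dd) auto
  moreover have "((\<lambda>t. F (\<zeta> t)) has_vector_derivative N (\<zeta> 0)) (at 0 within {0..})"
    by (rule flow_derivD[OF assms(2) z(2)]) simp
  ultimately show ?thesis
    using vector_derivative_unique_within[OF at_0_halfline_nontriv] z(1) by blast
qed

lemma C1b_compact_uniform:
  fixes F :: "'a::euclidean_space \<Rightarrow> 'b::real_normed_vector"
  assumes K: "open K" and F: "C1b K F" and Z: "compact Z" "Z \<subseteq> K" and e: "0 < e"
  shows "\<exists>d>0. \<forall>z\<in>Z. ball z d \<subseteq> K \<and> (\<forall>y\<in>ball z d. (\<forall>v. norm (dd v F y - dd v F z) \<le> e * norm v) \<and>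
     norm (F y - F z - dd (y - z) F z) \<le> e * norm (y - z))"
proof -
  let ?P = "\<lambda>U. \<forall>y\<in>U. \<forall>y'\<in>U. y \<in> K \<and> y' \<in> K \<and> (\<forall>v. norm (dd v F y - dd v F y') \<le> e * norm v)"
  have "\<exists>d>0. \<forall>z\<in>Z. ?P (ball z d)"
  proof (rule compact_uniform_radius[OF Z(1)])
    show "\<exists>d>0. ?P (ball z d)" if "z \<in> Z" for z
      by (rule dd_locally_close[OF K F _ e]) (use that Z in blast)
  qed blast
  then obtain d where d: "0 < d" and P: "\<And>z. z \<in> Z \<Longrightarrow> ?P (ball z d)" by blast
  show ?thesis
  proof (intro exI[of _ d] conjI d ballI allI)
    fix z assume z: "z \<in> Z"
    show "ball z d \<subseteq> K" using P[OF z] by blast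
    fix y assume y: "y \<in> ball z d"
    have zb: "z \<in> ball z d" using d by simp
    show "norm (dd v F y - dd v F z) \<le> e * norm v" for v using P[OF z] y zb by blast
    show "norm (F y - F z - dd (y - z) F z) \<le> e * norm (y - z)"
    proof (rule C1b_strict[of "ball z d"])
      show "F differentiable (at x)" if "x \<in> ball z d" for x using F P[OF z] that by (auto simp: C1b_def)
      show "norm (dd v F x - dd v F z) \<le> e * norm v" if "x \<in> ball z d" for x v using P[OF z] that zb by blast
    qed (use y zb in auto)
  qed
qed

text \<open>The values of $F$ on $\zeta$ are compared with those on the shifted curve $\zeta + \varepsilon u$.  It
  is not a trajectory, but the pointwise identity $DF(y)\,G(y) = N(y)$ holds at its points.\<close>

lemma flow_deriv_dd:
  fixes F :: "'a::euclidean_space \<Rightarrow> 'b::euclidean_space"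
  assumes K: "open K" and ex: "\<And>z. z \<in> K \<Longrightarrow> \<exists>\<zeta>. \<zeta> 0 = z \<and> traj K G \<zeta>"
    and G: "C1b K G" and F: "C1b K F" and N: "C1b K N" and FN: "flow_deriv K G F N"
  shows "flow_deriv K G (dd u F) (\<lambda>z. dd u N z - dd (dd u G z) F z)"
  unfolding flow_deriv_def
proof (intro allI impI)
  fix \<zeta> and t0 :: real assume tr: "traj K G \<zeta>" and t0: "0 \<le> t0"
  have diff: "F differentiable (at z)" "G differentiable (at z)" "N differentiable (at z)" if "z \<in> K" for z
    using that F G N by (auto simp: C1b_def)
  have id: "dd (G z) F z = N z" if "z \<in> K" for z
    by (rule flow_deriv_eq_dd[OF ex[OF that] FN diff(1)[OF that]])
  obtain MF where MF: "0 < MF" "\<And>x v. x \<in> K \<Longrightarrow> norm (dd v F x) \<le> MF * norm v" using C1b_bound[OF F] by metis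
  obtain MG where MG: "0 < MG" "\<And>x v. x \<in> K \<Longrightarrow> norm (dd v G x) \<le> MG * norm v" using C1b_bound[OF G] by metis
  let ?D = "\<lambda>z. dd u N z - dd (dd u G z) F z"
  show "((\<lambda>t. dd u F (\<zeta> t)) has_vector_derivative ?D (\<zeta> t0)) (at t0 within {0..})"
  proof (rule has_vector_derivative_halfline[OF _ t0])
    fix T0 :: real assume "0 < T0"
    define T where "T = max T0 t0"
    have T: "t0 \<in> {0..T}" using t0 by (simp add: T_def)
    define Z where "Z = \<zeta> ` {0..T}"
    have Z: "compact Z" "Z \<subseteq> K" using traj_compact[OF tr] trajD(1)[OF tr] by (auto simp: Z_def)
    from C1b_compact_uniform[OF K F Z zero_less_one] obtain d0 where d0: "0 < d0" "\<And>z. z \<in> Z \<Longrightarrow> ball z d0 \<subseteq> K" by blast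
    \<comment> \<open>Step lengths tending to 0, scaled so that each shift
      \<open>\<epsilon> n *\<^sub>R u\<close> is shorter than \<open>d0\<close> and the shifted
      curve stays in \<open>K\<close>.\<close>
    define \<epsilon> where "\<epsilon> n = d0 / (norm u + 1) / real (Suc n)" for n
    have \<epsilon>0: "0 < \<epsilon> n" for n using d0 by (simp add: \<epsilon>_def add_nonneg_pos)
    have \<epsilon>lim: "\<epsilon> \<longlonglongrightarrow> 0"
      unfolding \<epsilon>_def by (rule lim_const_over_n[THEN LIMSEQ_Suc])
    have small: "\<forall>\<^sub>F n in sequentially. norm (\<epsilon> n *\<^sub>R u) < d" if "0 < d" for d
    proof -
      have "(\<lambda>n. norm (\<epsilon> n *\<^sub>R u)) \<longlonglongrightarrow> norm (0 *\<^sub>R u)" by (intro tendsto_intros \<epsilon>lim)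
      thus ?thesis using that by (intro order_tendstoD(2)) auto
    qed
    have inb: "norm (\<epsilon> n *\<^sub>R u) < d0" for n
    proof -
      have "norm (\<epsilon> n *\<^sub>R u) = d0 * (norm u / (norm u + 1)) / real (Suc n)"
        using d0 by (simp add: \<epsilon>_def add_nonneg_pos)
      also have "\<dots> \<le> d0 * (norm u / (norm u + 1)) / 1"
        using d0 by (intro divide_left_mono) (auto intro!: mult_nonneg_nonneg divide_nonneg_nonneg)
      also have "\<dots> < d0 * 1 / 1" using d0 by (intro divide_strict_right_mono mult_strict_left_mono) (auto simp: divide_simps add_nonneg_pos)
      finally show ?thesis by simp
    qed
    have yK: "z + \<epsilon> n *\<^sub>R u \<in> K" if "z \<in> Z" for z n
      using d0(2)[OF that] inb[of n] by (auto simp: dist_norm)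
    define f where "f n t = (1 / \<epsilon> n) *\<^sub>R (F (\<zeta> t + \<epsilon> n *\<^sub>R u) - F (\<zeta> t))" for n t
    define f' where "f' n t = (1 / \<epsilon> n) *\<^sub>R (dd (G (\<zeta> t)) F (\<zeta> t + \<epsilon> n *\<^sub>R u) - N (\<zeta> t))" for n t
    have \<zeta>d: "(\<zeta> has_vector_derivative G (\<zeta> t)) (at t within {0..T})" if "t \<in> {0..T}" for t
      using trajD(2)[OF tr, of t] that by (auto intro: has_vector_derivative_within_subset)
    have fd: "(f n has_derivative (\<lambda>h. h *\<^sub>R f' n t)) (at t within {0..T})" if "t \<in> {0..T}" for n t
    proof -
      have zZ: "\<zeta> t \<in> Z" using that by (auto simp: Z_def)
      have "((\<lambda>t. \<zeta> t + \<epsilon> n *\<^sub>R u) has_vector_derivative G (\<zeta> t)) (at t within {0..T})"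
        using \<zeta>d[OF that] by (auto intro!: derivative_eq_intros)
      from has_vector_derivative_chain_dd[where F = F, OF _ this] yK[OF zZ]
      have "((\<lambda>t. F (\<zeta> t + \<epsilon> n *\<^sub>R u)) has_vector_derivative dd (G (\<zeta> t)) F (\<zeta> t + \<epsilon> n *\<^sub>R u)) (at t within {0..T})"
        by (auto intro: diff)
      moreover have "((\<lambda>t. F (\<zeta> t)) has_vector_derivative N (\<zeta> t)) (at t within {0..T})"
        using flow_derivD[OF FN tr, of t] that by (auto intro: has_vector_derivative_within_subset)
      ultimately have "(f n has_vector_derivative f' n t) (at t within {0..T})"
        unfolding f_def f'_def
        by (intro has_vector_derivative_scaleR[where f = "\<lambda>_. 1 / \<epsilon> n" and f' = 0, simplified] has_vector_derivative_diff) auto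
      thus ?thesis by (simp add: has_vector_derivative_def)
    qed
    \<comment> \<open>The limit \<open>dd u F\<close> need not be differentiable in space. Uniform
      convergence of the time derivatives \<open>f' n\<close> on \<open>[0, T]\<close> is what gives
      its derivative in time.\<close>
    have unif: "\<forall>\<^sub>F n in sequentially. \<forall>t\<in>{0..T}. norm (f' n t - ?D (\<zeta> t)) \<le> e
        \<and> norm (f n t - dd u F (\<zeta> t)) \<le> e" if e: "0 < e" for e
    proof -
      define e' where "e' = e / (1 + norm u + MF * norm u + MG * norm u)"
      have den: "0 < 1 + norm u + MF * norm u + MG * norm u" using MF MG by (simp add: add_pos_nonneg)
      have e': "0 < e'" using e den by (simp add: e'_def)
      have tot: "e' * norm u + MF * (e' * norm u) + e' * (MG * norm u) \<le> e"
      proof -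
        have "e' * norm u + MF * (e' * norm u) + e' * (MG * norm u) = e' * (norm u + MF * norm u + MG * norm u)" by (simp add: algebra_simps)
        also have "\<dots> \<le> e' * (1 + norm u + MF * norm u + MG * norm u)" using e' by (intro mult_left_mono) auto
        also have "\<dots> = e" using den by (simp add: e'_def)
        finally show ?thesis .
      qed
      from C1b_compact_uniform[OF K F Z e'] obtain d1 where d1: "0 < d1"
        "\<And>z y v. z \<in> Z \<Longrightarrow> y \<in> ball z d1 \<Longrightarrow> norm (dd v F y - dd v F z) \<le> e' * norm v"
        "\<And>z y. z \<in> Z \<Longrightarrow> y \<in> ball z d1 \<Longrightarrow> norm (F y - F z - dd (y - z) F z) \<le> e' * norm (y - z)" by blast
      from C1b_compact_uniform[OF K G Z e'] obtain d2 where d2: "0 < d2"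
        "\<And>z y. z \<in> Z \<Longrightarrow> y \<in> ball z d2 \<Longrightarrow> norm (G y - G z - dd (y - z) G z) \<le> e' * norm (y - z)" by blast
      from C1b_compact_uniform[OF K N Z e'] obtain d3 where d3: "0 < d3"
        "\<And>z y. z \<in> Z \<Longrightarrow> y \<in> ball z d3 \<Longrightarrow> norm (N y - N z - dd (y - z) N z) \<le> e' * norm (y - z)" by blast
      have "0 < min d1 (min d2 d3)" using d1 d2 d3 by simp
      from small[OF this] show ?thesis
      proof eventually_elim
        fix n assume n: "norm (\<epsilon> n *\<^sub>R u) < min d1 (min d2 d3)"
        have eps: "norm ((1 / \<epsilon> n) *\<^sub>R (H (z + \<epsilon> n *\<^sub>R u) - H z) - dd u H z) \<le> e' * norm u"
          if "norm (H (z + \<epsilon> n *\<^sub>R u) - H z - dd (\<epsilon> n *\<^sub>R u) H z) \<le> e' * norm (\<epsilon> n *\<^sub>R u)" "H differentiable (at z)"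
          for H :: "'a \<Rightarrow> 'c::real_normed_vector" and z
        proof -
          have "(1 / \<epsilon> n) *\<^sub>R (H (z + \<epsilon> n *\<^sub>R u) - H z) - dd u H z = (1 / \<epsilon> n) *\<^sub>R (H (z + \<epsilon> n *\<^sub>R u) - H z - dd (\<epsilon> n *\<^sub>R u) H z)"
            using linear_cmul[OF linear_dd[OF that(2)], of "\<epsilon> n" u] \<epsilon>0[of n] by (simp add: scaleR_diff_right)
          also have "norm \<dots> = (1 / \<epsilon> n) * norm (H (z + \<epsilon> n *\<^sub>R u) - H z - dd (\<epsilon> n *\<^sub>R u) H z)"
            using \<epsilon>0[of n] by simp
          also have "\<dots> \<le> (1 / \<epsilon> n) * (e' * norm (\<epsilon> n *\<^sub>R u))"
            using \<epsilon>0[of n] by (intro mult_left_mono that(1)) simp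
          also have "\<dots> = e' * norm u" using \<epsilon>0[of n] by simp
          finally show ?thesis .
        qed
        show "\<forall>t\<in>{0..T}. norm (f' n t - ?D (\<zeta> t)) \<le> e \<and> norm (f n t - dd u F (\<zeta> t)) \<le> e"
        proof (intro ballI conjI)
          fix t assume t: "t \<in> {0..T}"
          let ?z = "\<zeta> t" let ?y = "\<zeta> t + \<epsilon> n *\<^sub>R u"
          have zZ: "?z \<in> Z" using t by (auto simp: Z_def)
          have zK: "?z \<in> K" and yK': "?y \<in> K" using zZ Z yK by auto
          have b: "?y \<in> ball ?z d1" "?y \<in> ball ?z d2" "?y \<in> ball ?z d3" using n by (auto simp: dist_norm)
          define w where "w = (1 / \<epsilon> n) *\<^sub>R (G ?y - G ?z)"
          have w: "norm (w - dd u G ?z) \<le> e' * norm u"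
            unfolding w_def using d2(2)[OF zZ b(2)] diff(2)[OF zK] by (intro eps) simp_all
          have nN: "norm ((1 / \<epsilon> n) *\<^sub>R (N ?y - N ?z) - dd u N ?z) \<le> e' * norm u"
            using d3(2)[OF zZ b(3)] diff(3)[OF zK] by (intro eps) simp_all
          have nF: "norm (f n t - dd u F ?z) \<le> e' * norm u"
            unfolding f_def using d1(3)[OF zZ b(1)] diff(1)[OF zK] by (intro eps) simp_all
          note lin = linear_dd[OF diff(1)[OF yK']]
          \<comment> \<open>At the shifted point the pointwise identity concerns the direction
            \<open>G ?y\<close>, whereas the shifted curve moves with velocity \<open>G ?z\<close>.
            The discrepancy \<open>\<epsilon> n *\<^sub>R w\<close> is the source of the term
            \<open>dd (dd u G z) F z\<close>.\<close>
          have "dd (G ?z) F ?y = dd (G ?y) F ?y - \<epsilon> n *\<^sub>R dd w F ?y"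
          proof -
            have "G ?z = G ?y - \<epsilon> n *\<^sub>R w" using \<epsilon>0[of n] by (simp add: w_def)
            thus ?thesis using linear_diff[OF lin] linear_cmul[OF lin] by simp
          qed
          hence "f' n t = (1 / \<epsilon> n) *\<^sub>R ((N ?y - N ?z) - \<epsilon> n *\<^sub>R dd w F ?y)"
            unfolding f'_def id[OF yK'] by simp
          hence "f' n t = (1 / \<epsilon> n) *\<^sub>R (N ?y - N ?z) - dd w F ?y"
            using \<epsilon>0[of n] by (simp add: scaleR_diff_right)
          hence "f' n t - ?D ?z = ((1 / \<epsilon> n) *\<^sub>R (N ?y - N ?z) - dd u N ?z) - dd (w - dd u G ?z) F ?y
            - (dd (dd u G ?z) F ?y - dd (dd u G ?z) F ?z)"
            using linear_diff[OF lin] by (simp add: algebra_simps)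
          also have "norm \<dots> \<le> e' * norm u + MF * (e' * norm u) + e' * (MG * norm u)"
          proof (rule order_trans[OF norm_triangle_ineq4], rule add_mono, rule order_trans[OF norm_triangle_ineq4], rule add_mono[OF nN])
            show "norm (dd (w - dd u G ?z) F ?y) \<le> MF * (e' * norm u)"
              using MF(2)[OF yK', of "w - dd u G ?z"] mult_left_mono[OF w, of MF] MF(1) by linarith
            show "norm (dd (dd u G ?z) F ?y - dd (dd u G ?z) F ?z) \<le> e' * (MG * norm u)"
              using d1(2)[OF zZ b(1), of "dd u G ?z"] mult_left_mono[OF MG(2)[OF zK, of u], of e'] e' by linarith
          qed
          finally show "norm (f' n t - ?D ?z) \<le> e" using tot by linarith
          have "0 \<le> MF * (e' * norm u)" "0 \<le> e' * (MG * norm u)" using MF MG e' by simp_all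
          thus "norm (f n t - dd u F ?z) \<le> e" using nF tot by linarith
        qed
      qed
    qed
    have lim: "(\<lambda>n. f n t) \<longlonglongrightarrow> dd u F (\<zeta> t)" if t: "t \<in> {0..T}" for t
    proof (rule tendstoI)
      fix e :: real assume "0 < e"
      hence "0 < e / 2" by simp
      from unif[OF this] show "\<forall>\<^sub>F n in sequentially. dist (f n t) (dd u F (\<zeta> t)) < e"
      proof eventually_elim
        case (elim n)
        hence "norm (f n t - dd u F (\<zeta> t)) \<le> e / 2" using t by blast
        thus ?case using \<open>0 < e\<close> by (simp add: dist_norm)
      qed
    qed
    have "\<exists>g. \<forall>t\<in>{0..T}. (\<lambda>n. f n t) \<longlonglongrightarrow> g t \<and> (g has_derivative (\<lambda>h. h *\<^sub>R ?D (\<zeta> t))) (at t within {0..T})"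
    proof (rule has_derivative_sequence[OF _ fd _ T lim[OF T]])
      fix e :: real assume "0 < e"
      from unif[OF this] show "\<forall>\<^sub>F n in sequentially. \<forall>t\<in>{0..T}. \<forall>h. norm (h *\<^sub>R f' n t - h *\<^sub>R ?D (\<zeta> t)) \<le> e * norm h"
      proof eventually_elim
        case (elim n)
        show ?case
        proof (intro ballI allI)
          fix t h assume "t \<in> {0..T}"
          hence "norm (f' n t - ?D (\<zeta> t)) \<le> e" using elim by blast
          thus "norm (h *\<^sub>R f' n t - h *\<^sub>R ?D (\<zeta> t)) \<le> e * norm h"
            unfolding scaleR_diff_right[symmetric] norm_scaleR by (simp add: mult.commute[of e] mult_left_mono)
        qed
      qed
    qed simp
    then obtain g where g: "\<And>t. t \<in> {0..T} \<Longrightarrow> (\<lambda>n. f n t) \<longlonglongrightarrow> g t"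
      "\<And>t. t \<in> {0..T} \<Longrightarrow> (g has_vector_derivative ?D (\<zeta> t)) (at t within {0..T})"
      unfolding has_vector_derivative_def by blast
    have "g t = dd u F (\<zeta> t)" if "t \<in> {0..T}" for t using LIMSEQ_unique[OF g(1)[OF that] lim[OF that]] .
    hence "((\<lambda>t. dd u F (\<zeta> t)) has_vector_derivative ?D (\<zeta> t0)) (at t0 within {0..T})"
      by (intro has_vector_derivative_transform[OF T _ g(2)[OF T]]) simp
    thus "((\<lambda>t. dd u F (\<zeta> t)) has_vector_derivative ?D (\<zeta> t0)) (at t0 within {0..T0})"
      by (rule has_vector_derivative_within_subset) (simp add: T_def)
  qed
qed

section \<open>Sections over an expanding skew flow\<close>

lemma finite_min_radius:
  fixes P :: "'i \<Rightarrow> real \<Rightarrow> bool"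
  assumes "finite A" "\<And>a. a \<in> A \<Longrightarrow> \<exists>d>0. P a d" "\<And>a d d'. P a d \<Longrightarrow> d' \<le> d \<Longrightarrow> P a d'"
  shows "\<exists>d>0. \<forall>a\<in>A. P a d"
  using assms(1,2)
proof (induction A)
  case empty
  show ?case by (intro exI[of _ 1]) simp
next
  case (insert a A)
  then obtain d d' where "0 < d" "P a d" "0 < d'" "\<forall>a\<in>A. P a d'" by (meson insertCI)
  thus ?case using assms(3) by (intro exI[of _ "min d d'"]) (metis insert_iff min.cobounded1 min.cobounded2 min_less_iff_conj)
qed

lemma prod_list_norm_update_le:
  assumes "i < length vs" "norm w \<le> e * norm (vs ! i)"
  shows "prod_list (map norm (vs[i := w])) \<le> e * prod_list (map norm vs)"
  using assms
proof (induction vs arbitrary: i)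
  case (Cons v vs)
  show ?case
  proof (cases i)
    case 0
    thus ?thesis using Cons.prems mult_right_mono[OF _ prod_list_norm_nonneg, of "norm w" "e * norm v" vs]
      by (simp add: mult_ac)
  next
    case (Suc j)
    hence "prod_list (map norm (vs[j := w])) \<le> e * prod_list (map norm vs)" using Cons by simp
    from mult_left_mono[OF this norm_ge_zero, of v] show ?thesis using Suc by (simp add: mult_ac)
  qed
qed simp

lemma prod_list_norm_map_le:
  assumes "\<And>i. i < length vs \<Longrightarrow> norm ((vs ! i) t) \<le> E * norm (ws ! i)" "length ws = length vs" "0 \<le> E"
  shows "prod_list (map norm (map (\<lambda>v. v t) vs)) \<le> E ^ length vs * prod_list (map norm ws)"
  using assms
proof (induction vs arbitrary: ws)
  case (Cons v vs)
  then obtain w us where ws: "ws = w # us" by (cases ws) auto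
  have "prod_list (map norm (map (\<lambda>v. v t) vs)) \<le> E ^ length vs * prod_list (map norm us)"
    using Cons.prems(1)[of "Suc _"] Cons.prems(2,3) by (intro Cons.IH) (auto simp: ws)
  moreover have "norm (v t) \<le> E * norm w" using Cons.prems(1)[of 0] by (simp add: ws)
  ultimately have "norm (v t) * prod_list (map norm (map (\<lambda>v. v t) vs)) \<le> (E * norm w) * (E ^ length vs * prod_list (map norm us))"
    using Cons.prems(3) by (intro mult_mono prod_list_norm_nonneg) simp_all
  thus ?case by (simp add: ws mult_ac)
qed simp

lemma has_vector_derivative_halfline_imp_Icc: "(f has_vector_derivative D) (at t within {0..}) \<Longrightarrow> (f has_vector_derivative D) (at t within {0..T::real})"
  by (rule has_vector_derivative_within_subset) auto

text \<open>In the application $Q = D^k h$.  The map \<open>Lt y' y\<close> is $D_a f - Dh\,D_a g$; it has two base points because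
  the equation is quadratic in $Q$ for $k = 1$.\<close>

locale hyperbolic_section =
  fixes K :: "'a::euclidean_space set" and G :: "'a \<Rightarrow> 'a" and lam bet :: "'a \<Rightarrow> real" and c Lm S :: real
    and k :: nat and Q N :: "'a \<Rightarrow> 'a list \<Rightarrow> 'b::euclidean_space"
    and Lt :: "'a \<Rightarrow> 'a \<Rightarrow> 'b \<Rightarrow> 'b" and Err :: "'a \<Rightarrow> 'a \<Rightarrow> 'a list \<Rightarrow> 'b"
  assumes K: "open K" "convex K"
    and ex_traj: "\<And>z. z \<in> K \<Longrightarrow> \<exists>\<zeta>. \<zeta> 0 = z \<and> traj K G \<zeta>"
    and G: "C1b K G"
    and lam_cont: "continuous_on K lam" and bet_cont: "continuous_on K bet"
    and lam_nonneg: "\<And>z. z \<in> K \<Longrightarrow> 0 \<le> lam z"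
    and c: "0 < c" and Lm: "0 \<le> Lm" and S: "0 \<le> S"
    and spectral_gap: "\<And>z. z \<in> K \<Longrightarrow> (real k + 1) * lam z + c \<le> bet z"
    and G_growth: "\<And>y z v. y \<in> K \<Longrightarrow> z \<in> K \<Longrightarrow> v \<bullet> dd v G y \<le> (lam z + Lm * norm (y - z)) * (norm v)\<^sup>2"
    and Q_ml: "\<And>z. z \<in> K \<Longrightarrow> multilin k (Q z)"
    and Q_bound: "\<And>z vs. z \<in> K \<Longrightarrow> length vs = k \<Longrightarrow> norm (Q z vs) \<le> S * prod_list (map norm vs)"
    and Q_flow: "\<And>vs. length vs = k \<Longrightarrow> flow_deriv K G (\<lambda>z. Q z vs) (\<lambda>z. N z vs)"
    and N_diff: "\<And>y y' vs. y \<in> K \<Longrightarrow> y' \<in> K \<Longrightarrow> length vs = k \<Longrightarrow>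
      N y' vs - N y vs = Lt y' y (Q y' vs - Q y vs)
        - (\<Sum>i<k. Q y' (vs[i := dd (vs ! i) G y]) - Q y (vs[i := dd (vs ! i) G y])) + Err y' y vs"
    and Lt_lin: "\<And>y y'. y \<in> K \<Longrightarrow> y' \<in> K \<Longrightarrow> linear (Lt y' y)"
    and Lt_coercive: "\<And>y y' w. y \<in> K \<Longrightarrow> y' \<in> K \<Longrightarrow> bet y * (norm w)\<^sup>2 \<le> w \<bullet> Lt y' y w"
    and Lt_cont: "\<And>z e. z \<in> K \<Longrightarrow> 0 < e \<Longrightarrow> \<exists>d>0. close_maps K Lt e (ball z d)"
    and Err_sd: "\<And>vs. length vs = k \<Longrightarrow> \<exists>M. sd K (\<lambda>y' y. Err y' y vs) M"
begin

text \<open>\<open>N z\<close> is the derivative at time 0 of the multilinear maps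
  \<open>Q (\<zeta> t)\<close>. Uniqueness of this derivative transfers linearity in each
  argument.\<close>

lemma N_ml: assumes z: "z \<in> K" shows "multilin k (N z)"
  unfolding multilin_def
proof (intro allI impI)
  fix i :: nat and vs :: "'a list" assume i: "i < k" and l: "length vs = k"
  obtain \<zeta> where \<zeta>: "\<zeta> 0 = z" "traj K G \<zeta>" using ex_traj[OF z] by blast
  have d: "((\<lambda>t. Q (\<zeta> t) (vs[i := v])) has_vector_derivative N z (vs[i := v])) (at 0 within {0..})" for v
    using flow_derivD[OF Q_flow \<zeta>(2), of "vs[i := v]" 0] l \<zeta>(1) by simp
  have lin: "linear (\<lambda>v. Q (\<zeta> t) (vs[i := v]))" if "t \<in> {0..}" for t
    using multilin_linear[OF Q_ml i l] trajD(1)[OF \<zeta>(2), of t] that by simp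
  have uniq: "a = b" if "(f has_vector_derivative a) (at 0 within {0..})" "(g has_vector_derivative b) (at 0 within {0..})"
    "\<And>t. t \<in> {0..} \<Longrightarrow> f t = g t" for f g :: "real \<Rightarrow> 'b" and a b
    by (rule vector_derivative_unique_within[OF at_0_halfline_nontriv that(1)])
       (rule has_vector_derivative_transform[OF _ _ that(2)], use that(3) in auto)
  show "linear (\<lambda>v. N z (vs[i := v]))"
  proof (rule linearI)
    show "N z (vs[i := a + b]) = N z (vs[i := a]) + N z (vs[i := b])" for a b
      by (rule uniq[OF d has_vector_derivative_add[OF d d]]) (use linear_add[OF lin] in auto)
    show "N z (vs[i := r *\<^sub>R a]) = r *\<^sub>R N z (vs[i := a])" for r a
      by (rule uniq[OF d bounded_linear.has_vector_derivative[OF bounded_linear_scaleR_right d]])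
         (use linear_cmul[OF lin] in auto)
  qed
qed

lemma G_diff: "z \<in> K \<Longrightarrow> G differentiable (at z)"
  using G by (simp add: C1b_def)

text \<open>The equation \<open>N_diff\<close> can be solved for \<open>Err\<close>, and all its
  other terms are multilinear.\<close>

lemma Err_ml: assumes "y \<in> K" "y' \<in> K" shows "multilin k (Err y' y)"
proof -
  have "multilin k (\<lambda>vs. N y' vs - N y vs - Lt y' y (Q y' vs - Q y vs)
     + (\<Sum>i<k. Q y' (vs[i := dd (vs ! i) G y]) - Q y (vs[i := dd (vs ! i) G y])))"
    using assms
    by (intro multilin_add multilin_diff multilin_linear_comp[OF _ Lt_lin] multilin_sum multilin_subst
        N_ml Q_ml linear_dd G_diff) auto
  also have "?this = multilin k (Err y' y)"
    by (rule multilin_cong) (simp add: N_diff[OF assms])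
  finally show ?thesis .
qed

text \<open>\<open>Err_sd\<close> speaks of one argument list at a time. Summing its constants over
  the finitely many basis lists gives bounds that are uniform in the arguments.\<close>

lemma Err_bounds:
  obtains ME where "0 \<le> ME"
    "\<And>y y' vs. y \<in> K \<Longrightarrow> y' \<in> K \<Longrightarrow> length vs = k \<Longrightarrow> norm (Err y' y vs) \<le> ME * norm (y' - y) * prod_list (map norm vs)"
    "\<And>z e. z \<in> K \<Longrightarrow> 0 < e \<Longrightarrow> \<exists>d>0. close_ml_quotients k K Err ME e (ball z d)"
proof -
  have "\<forall>vs. \<exists>M. length vs = k \<longrightarrow> sd K (\<lambda>y' y. Err y' y vs) M" using Err_sd by blast
  then obtain M where M: "\<And>vs. length vs = k \<Longrightarrow> sd K (\<lambda>y' y. Err y' y vs) (M vs)" by metis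
  have basis_lists: "length bs = k" if "bs \<in> basis_lists k" for bs :: "'a list" using that by (simp add: basis_lists_def)
  define ME where "ME = sum M (basis_lists k)"
  show ?thesis
  proof (rule that[of ME])
    show "0 \<le> ME" unfolding ME_def by (intro sum_nonneg) (use sd_nonneg[OF M] basis_lists in blast)
    show "norm (Err y' y vs) \<le> ME * norm (y' - y) * prod_list (map norm vs)"
      if y: "y \<in> K" "y' \<in> K" and l: "length vs = k" for y y' vs
    proof -
      have "norm (Err y' y vs) \<le> (\<Sum>bs\<in>basis_lists k. M bs * norm (y' - y)) * prod_list (map norm vs)"
        by (rule multilin_norm_le[OF Err_ml[OF y] l]) (use sd_lipschitz[OF M y] basis_lists in blast)
      thus ?thesis by (simp add: ME_def sum_distrib_right)
    qed
    fix z and e :: real assume z: "z \<in> K" and e: "0 < e"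
    define e' where "e' = e / (real (card (basis_lists k :: 'a list set)) + 1)"
    have e': "0 < e'" using e by (simp add: e'_def add_nonneg_pos)
    have ce: "real (card (basis_lists k :: 'a list set)) * e' \<le> e"
    proof -
      have "real (card (basis_lists k :: 'a list set)) * e' \<le> (real (card (basis_lists k :: 'a list set)) + 1) * e'" using e' by (intro mult_right_mono) auto
      also have "\<dots> = e" by (simp add: e'_def add_nonneg_pos field_simps)
      finally show ?thesis .
    qed
    let ?P = "\<lambda>bs d. close_quotients K (\<lambda>y' y. Err y' y bs) (M bs) e' (ball z d)"
    have "\<exists>d>0. \<forall>bs\<in>basis_lists k. ?P bs d"
    proof (rule finite_min_radius[OF finite_basis_lists])
      show "\<exists>d>0. ?P bs d" if "bs \<in> basis_lists k" for bs by (rule sd_close_quotients[OF M[OF basis_lists[OF that]] z e'])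
      fix bs and d d' :: real assume P: "?P bs d" and "d' \<le> d"
      hence "ball z d' \<inter> K \<subseteq> ball z d \<inter> K" by auto
      thus "?P bs d'" using P by blast
    qed
    then obtain d where d: "0 < d" and P: "\<And>bs. bs \<in> basis_lists k \<Longrightarrow> ?P bs d" by blast
    show "\<exists>d>0. close_ml_quotients k K Err ME e (ball z d)"
    proof (intro exI[of _ d] conjI d ballI allI impI)
      fix y y' x x' and p q :: real and vs :: "'a list"
      assume m: "y \<in> ball z d \<inter> K" "y' \<in> ball z d \<inter> K" "x \<in> ball z d \<inter> K" "x' \<in> ball z d \<inter> K" and pq: "0 < p" "0 < q" and l: "length vs = k"
      let ?m = "norm (p *\<^sub>R (y' - y) - q *\<^sub>R (x' - x))" let ?n = "p * norm (y' - y) + q * norm (x' - x)"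
      have "norm (p *\<^sub>R Err y' y vs - q *\<^sub>R Err x' x vs) \<le> (\<Sum>bs\<in>basis_lists k. M bs * ?m + e' * ?n) * prod_list (map norm vs)"
      proof (rule multilin_norm_le[where M = "\<lambda>vs. p *\<^sub>R Err y' y vs - q *\<^sub>R Err x' x vs", OF _ l])
        show "multilin k (\<lambda>vs. p *\<^sub>R Err y' y vs - q *\<^sub>R Err x' x vs)"
          using m by (intro multilin_diff multilin_scaleR Err_ml) auto
        show "norm (p *\<^sub>R Err y' y bs - q *\<^sub>R Err x' x bs) \<le> M bs * ?m + e' * ?n" if "bs \<in> basis_lists k" for bs
          using P[OF that] m pq by blast
      qed
      also have "(\<Sum>bs\<in>basis_lists k. M bs * ?m + e' * ?n) = ME * ?m + (real (card (basis_lists k :: 'a list set)) * e') * ?n"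
        by (simp add: sum.distrib ME_def sum_distrib_right)
      also have "\<dots> * prod_list (map norm vs) \<le> (ME * ?m + e * ?n) * prod_list (map norm vs)"
        using pq by (intro mult_right_mono add_mono order_refl ce prod_list_norm_nonneg) auto
      finally show "norm (p *\<^sub>R Err y' y vs - q *\<^sub>R Err x' x vs) \<le> (ME * ?m + e * ?n) * prod_list (map norm vs)" .
    qed
  qed
qed

section \<open>Growth and separation of trajectories\<close>

lemma traj_int_deriv:
  assumes "continuous_on K \<phi>" "traj K G \<zeta>" "t \<in> {0..T}"
  shows "((\<lambda>u. integral {0..u} (\<lambda>s. \<phi> (\<zeta> s))) has_real_derivative \<phi> (\<zeta> t)) (at t within {0..T})"
proof -
  have "continuous_on {0..} (\<lambda>s. \<phi> (\<zeta> s))"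
    by (rule continuous_on_compose2[OF assms(1) traj_continuous_on[OF assms(2)]]) (use trajD(1)[OF assms(2)] in auto)
  from has_vector_derivative_halfline_imp_Icc[OF integral_has_vector_derivative_halfline[OF this, of t]] assms(3)
  show ?thesis by (simp add: has_real_derivative_iff_has_vector_derivative)
qed

text \<open>Accumulated exponents: \<open>exp (Lam \<zeta> t)\<close> bounds the growth of the
  linearised reduced flow along \<open>\<zeta>\<close>, and \<open>exp (Bet \<zeta> t)\<close> is a
  guaranteed expansion of \<open>w' = Lt y' y w\<close> when \<open>y\<close> runs along
  \<open>\<zeta>\<close>.\<close>

definition Lam :: "(real \<Rightarrow> 'a) \<Rightarrow> real \<Rightarrow> real" where "Lam \<zeta> t = integral {0..t} (\<lambda>s. lam (\<zeta> s))"
definition Bet :: "(real \<Rightarrow> 'a) \<Rightarrow> real \<Rightarrow> real" where "Bet \<zeta> t = integral {0..t} (\<lambda>s. bet (\<zeta> s))"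

lemma Lam_deriv: "traj K G \<zeta> \<Longrightarrow> t \<in> {0..T} \<Longrightarrow> (Lam \<zeta> has_real_derivative lam (\<zeta> t)) (at t within {0..T})"
  unfolding Lam_def[abs_def] by (rule traj_int_deriv[OF lam_cont])

lemma Bet_deriv: "traj K G \<zeta> \<Longrightarrow> t \<in> {0..T} \<Longrightarrow> (Bet \<zeta> has_real_derivative bet (\<zeta> t)) (at t within {0..T})"
  unfolding Bet_def[abs_def] by (rule traj_int_deriv[OF bet_cont])

lemma Lam_0 [simp]: "Lam \<zeta> 0 = 0" and Bet_0 [simp]: "Bet \<zeta> 0 = 0"
  by (simp_all add: Lam_def Bet_def)

lemma Lam_nonneg: assumes tr: "traj K G \<zeta>" and t: "0 \<le> t" shows "0 \<le> Lam \<zeta> t"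
  using nondecreasing_within[OF t Lam_deriv[OF tr]] lam_nonneg trajD(1)[OF tr] by simp

lemma Bet_ge: assumes tr: "traj K G \<zeta>" and t: "0 \<le> t" shows "(real k + 1) * Lam \<zeta> t + c * t \<le> Bet \<zeta> t"
proof -
  let ?g = "\<lambda>t. Bet \<zeta> t - ((real k + 1) * Lam \<zeta> t + c * t)"
  have "?g 0 \<le> ?g t"
  proof (rule nondecreasing_within[OF t])
    fix s assume s: "s \<in> {0..t}"
    show "(?g has_real_derivative (bet (\<zeta> s) - ((real k + 1) * lam (\<zeta> s) + c))) (at s within {0..t})"
      using Lam_deriv[OF tr s] Bet_deriv[OF tr s] by (auto intro!: derivative_eq_intros)
    show "0 \<le> bet (\<zeta> s) - ((real k + 1) * lam (\<zeta> s) + c)"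
      using spectral_gap[of "\<zeta> s"] trajD(1)[OF tr, of s] s by simp
  qed
  thus ?thesis by simp
qed

text \<open>The mean value theorem is applied to the scalar function
  \<open>(y' - y) \<bullet> G\<close> on the segment. A bound on \<open>norm (G y' - G y)\<close>
  would lose the one-sided information in \<open>G_growth\<close>. The rate is taken at a reference
  point \<open>z\<close> near the segment, so it can be shared by many pairs.\<close>

lemma G_mono_segment:
  assumes y: "y \<in> K" "y' \<in> K" and z: "z \<in> K" and r: "norm (y - z) \<le> \<rho>" "norm (y' - z) \<le> \<rho>"
  shows "(y' - y) \<bullet> (G y' - G y) \<le> (lam z + Lm * \<rho>) * (norm (y' - y))\<^sup>2"
proof -
  let ?d = "y' - y"
  let ?p = "\<lambda>s. y + s *\<^sub>R ?d"
  have pK: "?p s \<in> K" and pr: "norm (?p s - z) \<le> \<rho>" if "0 \<le> s" "s \<le> 1" for s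
  proof -
    have eq: "?p s = (1 - s) *\<^sub>R y + s *\<^sub>R y'" by (simp add: algebra_simps)
    show "?p s \<in> K" unfolding eq using K(2) y that by (auto intro: convexD)
    have "?p s \<in> cball z \<rho>" unfolding eq
      using convex_cball[of z \<rho>] r that by (intro convexD) (auto simp: dist_norm norm_minus_commute)
    thus "norm (?p s - z) \<le> \<rho>" by (simp add: dist_norm norm_minus_commute)
  qed
  have d: "((\<lambda>s. ?d \<bullet> G (?p s)) has_real_derivative (?d \<bullet> dd ?d G (?p s))) (at s)" if "0 \<le> s" "s \<le> 1" for s
  proof -
    have "(?p has_vector_derivative ?d) (at s)" by (auto intro!: derivative_eq_intros)
    from has_vector_derivative_chain_dd[OF G_diff[OF pK[OF that]] this]
    have "((\<lambda>s. G (?p s)) has_vector_derivative dd ?d G (?p s)) (at s)" .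
    from bounded_linear.has_vector_derivative[OF bounded_linear_inner_right this]
    show ?thesis by (simp add: has_real_derivative_iff_has_vector_derivative)
  qed
  obtain s where s: "0 < s" "s < 1" "?d \<bullet> G (?p 1) - ?d \<bullet> G (?p 0) = (1 - 0) * (?d \<bullet> dd ?d G (?p s))"
    using MVT2[of 0 1 "\<lambda>s. ?d \<bullet> G (?p s)" "\<lambda>s. ?d \<bullet> dd ?d G (?p s)"] d by auto
  have "?d \<bullet> (G y' - G y) = ?d \<bullet> dd ?d G (?p s)" using s(3) by (simp add: inner_diff_right)
  also have "\<dots> \<le> (lam z + Lm * norm (?p s - z)) * (norm ?d)\<^sup>2"
    using s by (intro G_growth pK z) auto
  also have "\<dots> \<le> (lam z + Lm * \<rho>) * (norm ?d)\<^sup>2"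
    using s Lm by (intro mult_right_mono add_left_mono mult_left_mono pr) auto
  finally show ?thesis .
qed

text \<open>The exponent is read off along the reference trajectory \<open>\<zeta>\<close> alone;
  staying in the tube of radius \<open>\<rho>\<close> costs \<open>Lm * \<rho>\<close> in the
  rate.\<close>

lemma traj_sharp:
  assumes \<zeta>: "traj K G \<zeta>" and y: "traj K G y" "traj K G y'" and T: "0 \<le> T"
    and r: "\<And>t. t \<in> {0..T} \<Longrightarrow> norm (y t - \<zeta> t) \<le> \<rho>" "\<And>t. t \<in> {0..T} \<Longrightarrow> norm (y' t - \<zeta> t) \<le> \<rho>"
  shows "norm (y' T - y T) \<le> exp (Lam \<zeta> T + Lm * \<rho> * T) * norm (y' 0 - y 0)"
proof -
  let ?A = "\<lambda>t. Lam \<zeta> t + Lm * \<rho> * t"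
  have "norm (y' T - y T) \<le> exp (?A T - ?A 0) * norm (y' 0 - y 0)"
  proof (rule gronwall_upper[OF T])
    fix t assume t: "t \<in> {0..T}"
    show "((\<lambda>t. y' t - y t) has_vector_derivative G (y' t) - G (y t)) (at t within {0..T})"
      using t trajD(2)[OF y(1), of t] trajD(2)[OF y(2), of t]
      by (intro has_vector_derivative_diff) (auto intro: has_vector_derivative_halfline_imp_Icc)
    show "(?A has_real_derivative lam (\<zeta> t) + Lm * \<rho>) (at t within {0..T})"
      using Lam_deriv[OF \<zeta> t] by (auto intro!: derivative_eq_intros)
    show "(y' t - y t) \<bullet> (G (y' t) - G (y t)) \<le> (lam (\<zeta> t) + Lm * \<rho>) * (norm (y' t - y t))\<^sup>2"
      using t G_mono_segment[of "y t" "y' t" "\<zeta> t" \<rho>] r[OF t] trajD(1)[OF y(1)] trajD(1)[OF y(2)] trajD(1)[OF \<zeta>] by simp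
  qed
  thus ?thesis by simp
qed

text \<open>The rate \<open>MG\<close> is too large for the gap, but it presupposes no closeness.
  For a fixed time it confines trajectories to the tube in which \<open>traj_sharp\<close>
  applies.\<close>

lemma traj_crude:
  assumes y: "traj K G y" "traj K G y'" and T: "0 \<le> T"
    and MG: "\<And>x v. x \<in> K \<Longrightarrow> norm (dd v G x) \<le> MG * norm v"
  shows "norm (y' T - y T) \<le> exp (MG * T) * norm (y' 0 - y 0)"
proof -
  have "norm (y' T - y T) \<le> exp (MG * T - MG * 0) * norm (y' 0 - y 0)"
  proof (rule gronwall_upper[where A = "\<lambda>t. MG * t" and a = "\<lambda>_. MG", OF T])
    fix t assume t: "t \<in> {0..T}"
    show "((\<lambda>t. y' t - y t) has_vector_derivative G (y' t) - G (y t)) (at t within {0..T})"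
      using t trajD(2)[OF y(1), of t] trajD(2)[OF y(2), of t]
      by (intro has_vector_derivative_diff) (auto intro: has_vector_derivative_halfline_imp_Icc)
    have "norm (G (y' t) - G (y t)) \<le> MG * norm (y' t - y t)"
      using t by (intro C1b_lipschitz[OF K(2) G_diff MG] trajD(1)[OF y(1)] trajD(1)[OF y(2)]) auto
    hence "norm (y' t - y t) * norm (G (y' t) - G (y t)) \<le> MG * (norm (y' t - y t))\<^sup>2"
      using mult_left_mono[OF _ norm_ge_zero, of _ _ "y' t - y t"] by (fastforce simp: power2_eq_square mult_ac)
    thus "(y' t - y t) \<bullet> (G (y' t) - G (y t)) \<le> MG * (norm (y' t - y t))\<^sup>2"
      using norm_cauchy_schwarz[of "y' t - y t" "G (y' t) - G (y t)"] by simp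
  qed (auto intro!: derivative_eq_intros)
  thus ?thesis by simp
qed

text \<open>Global existence rests on the Lipschitz constant of \<open>G\<close>, the growth bound
  on the one-sided rate: it is \<open>G_growth\<close> with both points equal.\<close>

lemma variation_exists:
  assumes \<zeta>: "traj K G \<zeta>"
  shows "\<exists>v. v 0 = w \<and> (\<forall>t\<ge>0. (v has_vector_derivative dd (v t) G (\<zeta> t)) (at t within {0..}) \<and> norm (v t) \<le> exp (Lam \<zeta> t) * norm w)"
proof -
  obtain MG where MG: "0 < MG" "\<And>x v. x \<in> K \<Longrightarrow> norm (dd v G x) \<le> MG * norm v" using C1b_bound[OF G] by metis
  have "\<exists>v. v 0 = w \<and> (\<forall>t\<ge>0. (v has_vector_derivative dd (v t) G (\<zeta> t)) (at t within {0..}))"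
  proof (rule linear_ode_exists[where A = "\<lambda>t v. dd v G (\<zeta> t)", OF _ _ MG(1)])
    show "linear (\<lambda>v. dd v G (\<zeta> t))" if "0 \<le> t" for t by (intro linear_dd G_diff trajD(1)[OF \<zeta> that])
    show "continuous_on {0..} (\<lambda>t. dd v G (\<zeta> t))" for v
      by (rule continuous_on_compose2[OF _ traj_continuous_on[OF \<zeta>], of K])
         (use G trajD(1)[OF \<zeta>] in \<open>auto simp: C1b_def\<close>)
    show "norm (dd v G (\<zeta> t)) \<le> MG * norm v" if "0 \<le> t" for t v by (intro MG(2) trajD(1)[OF \<zeta> that])
  qed
  then obtain v where v: "v 0 = w" "\<And>t. 0 \<le> t \<Longrightarrow> (v has_vector_derivative dd (v t) G (\<zeta> t)) (at t within {0..})" by blast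
  have "norm (v T) \<le> exp (Lam \<zeta> T) * norm w" if T: "0 \<le> T" for T
  proof -
    have "norm (v T) \<le> exp (Lam \<zeta> T - Lam \<zeta> 0) * norm (v 0)"
    proof (rule gronwall_upper[OF T _ Lam_deriv[OF \<zeta>]])
      fix t assume t: "t \<in> {0..T}"
      show "(v has_vector_derivative dd (v t) G (\<zeta> t)) (at t within {0..T})"
        using t by (intro has_vector_derivative_halfline_imp_Icc v(2)) auto
      show "v t \<bullet> dd (v t) G (\<zeta> t) \<le> lam (\<zeta> t) * (norm (v t))\<^sup>2"
        using G_growth[of "\<zeta> t" "\<zeta> t" "v t"] trajD(1)[OF \<zeta>] t by simp
    qed
    thus ?thesis using v(1) by simp
  qed
  thus ?thesis using v by blast
qed

text \<open>Evaluating $D$ on solutions of the variational equation along $\zeta$ removes the sum over the arguments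
  of $D$ from the equation.\<close>

lemma backward_estimate:
  assumes \<zeta>: "traj K G \<zeta>" and T: "0 \<le> T"
    and D: "\<And>t. t \<in> {0..T} \<Longrightarrow> multilin k (D t)" and D': "\<And>t. t \<in> {0..T} \<Longrightarrow> multilin k (D' t)"
    and deriv: "\<And>t vs. t \<in> {0..T} \<Longrightarrow> length vs = k \<Longrightarrow> ((\<lambda>t. D t vs) has_vector_derivative D' t vs) (at t within {0..T})"
    and eq: "\<And>t vs. t \<in> {0..T} \<Longrightarrow> length vs = k \<Longrightarrow>
      D' t vs = Lx t (D t vs) - (\<Sum>i<k. D t (vs[i := dd (vs ! i) G (\<zeta> t)])) + E t vs"
    and coer: "\<And>t w. t \<in> {0..T} \<Longrightarrow> bet (\<zeta> t) * (norm w)\<^sup>2 \<le> w \<bullet> Lx t w"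
    and E: "\<And>t vs. t \<in> {0..T} \<Longrightarrow> length vs = k \<Longrightarrow> norm (E t vs) \<le> exp (c * t + Lam \<zeta> t) * R' t * prod_list (map norm vs)"
    and R: "\<And>t. t \<in> {0..T} \<Longrightarrow> (R has_real_derivative R' t) (at t within {0..T})" and R': "\<And>t. t \<in> {0..T} \<Longrightarrow> 0 \<le> R' t"
    and X: "\<And>vs. length vs = k \<Longrightarrow> norm (D T vs) \<le> X * prod_list (map norm vs)" and X0: "0 \<le> X"
    and ws: "length ws = k"
  shows "norm (D 0 ws) \<le> (exp (- c * T - Lam \<zeta> T) * X + R T - R 0) * prod_list (map norm ws)"
proof -
  have "\<forall>w. \<exists>v. v 0 = w \<and> (\<forall>t\<ge>0. (v has_vector_derivative dd (v t) G (\<zeta> t)) (at t within {0..}) \<and> norm (v t) \<le> exp (Lam \<zeta> t) * norm w)"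
    using variation_exists[OF \<zeta>] by blast
  then obtain V where V: "\<And>w. V w 0 = w" "\<And>w t. 0 \<le> t \<Longrightarrow> (V w has_vector_derivative dd (V w t) G (\<zeta> t)) (at t within {0..})"
    "\<And>w t. 0 \<le> t \<Longrightarrow> norm (V w t) \<le> exp (Lam \<zeta> t) * norm w" by metis
  define vs where "vs = map V ws"
  define vt where "vt t = map (\<lambda>v. v t) vs" for t
  have l: "length (vt t) = k" for t using ws by (simp add: vt_def vs_def)
  have vt0: "vt 0 = ws" using V(1) by (simp add: vt_def vs_def map_idI)
  let ?P = "prod_list (map norm ws)"
  have vt_norm: "prod_list (map norm (vt t)) \<le> exp (real k * Lam \<zeta> t) * ?P" if "0 \<le> t" for t
  proof -
    have "prod_list (map norm (vt t)) \<le> exp (Lam \<zeta> t) ^ length vs * ?P"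
      unfolding vt_def by (rule prod_list_norm_map_le) (use V(3)[OF that] in \<open>auto simp: vs_def\<close>)
    thus ?thesis using ws by (simp add: vs_def exp_of_nat_mult)
  qed
  let ?W = "\<lambda>t. D t (vt t)"
  let ?W' = "\<lambda>t. Lx t (D t (vt t)) + E t (vt t)"
  have "exp (- Bet \<zeta> 0) * norm (?W 0) \<le> exp (- Bet \<zeta> T) * norm (?W T) + R T * ?P - R 0 * ?P"
  proof (rule gronwall_lower[where R = "\<lambda>t. R t * ?P" and R' = "\<lambda>t. R' t * ?P", OF T _ Bet_deriv[OF \<zeta>]])
    fix t assume t: "t \<in> {0..T}"
    have "(?W has_vector_derivative D' t (vt t) + (\<Sum>i<k. D t ((vt t)[i := map (\<lambda>v. dd (v t) G (\<zeta> t)) vs ! i]))) (at t within {0..T})"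
      unfolding vt_def
    proof (rule multilin_curve_deriv[where k = k, OF D D'[OF t] t deriv[OF t]])
      show "(vs ! i has_vector_derivative map (\<lambda>v. dd (v t) G (\<zeta> t)) vs ! i) (at t within {0..T})" if "i < k" for i
        using V(2)[of t "ws ! i"] t that ws by (auto simp: vs_def intro: has_vector_derivative_halfline_imp_Icc)
    qed (use ws in \<open>auto simp: vs_def\<close>)
    also have "(\<Sum>i<k. D t ((vt t)[i := map (\<lambda>v. dd (v t) G (\<zeta> t)) vs ! i])) = (\<Sum>i<k. D t ((vt t)[i := dd (vt t ! i) G (\<zeta> t)]))"
      using ws by (intro sum.cong) (auto simp: vt_def vs_def)
    also have "D' t (vt t) + \<dots> = ?W' t" unfolding eq[OF t l] by simp
    finally show "(?W has_vector_derivative ?W' t) (at t within {0..T})" .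
    show "((\<lambda>t. R t * ?P) has_real_derivative R' t * ?P) (at t within {0..T})"
      using R[OF t] by (auto intro!: derivative_eq_intros)
    show "0 \<le> R' t * ?P" using R'[OF t] prod_list_norm_nonneg by (intro mult_nonneg_nonneg)
    have t0: "0 \<le> t" using t by simp
    have "norm (E t (vt t)) \<le> exp (c * t + Lam \<zeta> t) * R' t * prod_list (map norm (vt t))" by (rule E[OF t l])
    also have "\<dots> \<le> exp (c * t + Lam \<zeta> t) * R' t * (exp (real k * Lam \<zeta> t) * ?P)"
      by (intro mult_left_mono vt_norm t0 mult_nonneg_nonneg R'[OF t]) auto
    \<comment> \<open>Here the factor \<open>k + 1\<close> of the gap is spent: \<open>k\<close>
      exponents come from the arguments of \<open>D\<close> and one from the growth allowed to
      \<open>E\<close>.\<close>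
    also have "\<dots> = exp ((real k + 1) * Lam \<zeta> t + c * t) * (R' t * ?P)"
      by (simp add: exp_add algebra_simps)
    also have "\<dots> \<le> exp (Bet \<zeta> t) * (R' t * ?P)"
      using Bet_ge[OF \<zeta> t0] R'[OF t] prod_list_norm_nonneg[of ws] by (intro mult_right_mono) auto
    finally have "norm (E t (vt t)) * norm (?W t) \<le> exp (Bet \<zeta> t) * (R' t * ?P) * norm (?W t)"
      by (intro mult_right_mono) auto
    moreover have "- (?W t \<bullet> E t (vt t)) \<le> norm (E t (vt t)) * norm (?W t)"
      using Cauchy_Schwarz_ineq2[of "?W t" "E t (vt t)"] by (simp add: mult.commute abs_le_iff)
    ultimately show "bet (\<zeta> t) * (norm (?W t))\<^sup>2 - exp (Bet \<zeta> t) * (R' t * ?P) * norm (?W t) \<le> ?W t \<bullet> ?W' t"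
      using coer[OF t, of "?W t"] by (simp add: inner_add_right)
  qed
  hence "norm (D 0 ws) \<le> exp (- Bet \<zeta> T) * norm (?W T) + (R T - R 0) * ?P"
    by (simp add: vt0 algebra_simps)
  also have "exp (- Bet \<zeta> T) * norm (?W T) \<le> exp (- Bet \<zeta> T) * (X * (exp (real k * Lam \<zeta> T) * ?P))"
    using X[OF l, of T] mult_left_mono[OF vt_norm[OF T] X0] by (intro mult_left_mono) auto
  also have "\<dots> = exp (real k * Lam \<zeta> T - Bet \<zeta> T) * (X * ?P)" by (simp add: exp_diff exp_minus field_simps)
  \<comment> \<open>Once the \<open>k\<close> arguments are paid for, one
    \<open>Lam \<zeta> T\<close> is left over. It offsets the growth of the distance of
    trajectories, which is contained in \<open>X\<close>.\<close>
  also have "\<dots> \<le> exp (- c * T - Lam \<zeta> T) * (X * ?P)"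
    using Bet_ge[OF \<zeta> T] X0 prod_list_norm_nonneg[of ws] by (intro mult_right_mono) (auto simp: algebra_simps)
  finally show ?thesis by (simp add: algebra_simps)
qed

text \<open>A bound $b\,(|y - z| + \varepsilon)$ on the increments of $Q$ propagates backward over a fixed time to a bound of
  the same form with $b/2$ plus a constant in place of $b$.  The $\varepsilon$ only serves to have a finite
  $b$ to start from.\<close>

lemma Q_lipschitz:
  obtains LQ where "0 \<le> LQ"
    "\<And>y z vs. y \<in> K \<Longrightarrow> z \<in> K \<Longrightarrow> length vs = k \<Longrightarrow> norm (Q y vs - Q z vs) \<le> LQ * norm (y - z) * prod_list (map norm vs)"
proof -
  obtain ME where ME: "0 \<le> ME"
    "\<And>y y' vs. y \<in> K \<Longrightarrow> y' \<in> K \<Longrightarrow> length vs = k \<Longrightarrow> norm (Err y' y vs) \<le> ME * norm (y' - y) * prod_list (map norm vs)"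
    using Err_bounds by metis
  obtain MG where MG: "0 < MG" "\<And>x v. x \<in> K \<Longrightarrow> norm (dd v G x) \<le> MG * norm v" using C1b_bound[OF G] by metis
  \<comment> \<open>In a tube of this radius the rate rises by at most \<open>c / 2\<close>;
    \<open>Lm + 1\<close> avoids dividing by 0.\<close>
  define \<rho> where "\<rho> = c / (2 * (Lm + 1))"
  have \<rho>: "0 < \<rho>" "Lm * \<rho> \<le> c / 2"
    using c Lm by (simp_all add: \<rho>_def divide_simps)
  \<comment> \<open>Chosen so that the remaining decay \<open>exp (- (c / 2) * T)\<close> is exactly
    \<open>1 / 2\<close>.\<close>
  define T where "T = 2 * ln 2 / c"
  have T: "0 \<le> T" and expT: "exp (- (c / 2) * T) = 1 / 2"
    using c by (simp_all add: T_def exp_minus)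
  \<comment> \<open>Trajectories starting this close remain within \<open>\<rho>\<close> on
    \<open>[0, T]\<close> even at the crude rate.\<close>
  define \<rho>1 where "\<rho>1 = \<rho> / exp (MG * T)"
  have \<rho>1: "0 < \<rho>1" using \<rho> by (simp add: \<rho>1_def)
  \<comment> \<open>The integral of \<open>ME * exp (- (c / 2) * t)\<close> over all
    \<open>t \<ge> 0\<close>.\<close>
  define M' where "M' = 2 * ME / c"
  have M': "0 \<le> M'" using ME c by (simp add: M'_def)
  have trivial_bound: "norm (Q y vs - Q z vs) \<le> 2 * S * prod_list (map norm vs)"
    if "y \<in> K" "z \<in> K" "length vs = k" for y z vs
    using norm_triangle_ineq4[of "Q y vs" "Q z vs"] Q_bound[OF that(1,3)] Q_bound[OF that(2,3)] by simp
  have small: "norm (Q y0 ws - Q z0 ws) \<le> (b / 2 + M') * (norm (y0 - z0) + \<epsilon>) * prod_list (map norm ws)"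
    if y0: "y0 \<in> K" and z0: "z0 \<in> K" and ws: "length ws = k" and near: "norm (y0 - z0) \<le> \<rho>1"
      and b: "0 \<le> b" and \<epsilon>: "0 < \<epsilon>"
      and P: "\<And>y z vs. y \<in> K \<Longrightarrow> z \<in> K \<Longrightarrow> length vs = k \<Longrightarrow> norm (Q y vs - Q z vs) \<le> b * (norm (y - z) + \<epsilon>) * prod_list (map norm vs)"
    for y0 z0 ws b \<epsilon>
  proof -
    obtain y where y: "y 0 = y0" "traj K G y" using ex_traj[OF y0] by blast
    obtain z where z: "z 0 = z0" "traj K G z" using ex_traj[OF z0] by blast
    let ?d = "norm (y0 - z0)"
    have yK: "y t \<in> K" and zK: "z t \<in> K" if "t \<in> {0..T}" for t
      using trajD(1)[OF y(2)] trajD(1)[OF z(2)] that by auto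
    have close: "norm (y t - z t) \<le> \<rho>" if "t \<in> {0..T}" for t
    proof -
      have "norm (y t - z t) \<le> exp (MG * t) * norm (y 0 - z 0)"
        by (rule traj_crude[OF z(2) y(2) _ MG(2)]) (use that in auto)
      also have "\<dots> \<le> exp (MG * T) * \<rho>1"
        using that near MG y(1) z(1) by (intro mult_mono) auto
      finally show ?thesis by (simp add: \<rho>1_def)
    qed
    have sharp: "norm (y t - z t) \<le> exp (Lam z t + c / 2 * t) * ?d" if "t \<in> {0..T}" for t
    proof -
      have "norm (y t - z t) \<le> exp (Lam z t + Lm * \<rho> * t) * norm (y 0 - z 0)"
        by (rule traj_sharp[OF z(2) z(2) y(2)]) (use that close \<rho> in auto)
      also have "\<dots> \<le> exp (Lam z t + c / 2 * t) * ?d"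
        using \<rho>(2) that y(1) z(1) mult_right_mono[OF \<rho>(2), of t] by (intro mult_mono) auto
      finally show ?thesis .
    qed
    have "norm (Q (y 0) ws - Q (z 0) ws) \<le> (exp (- c * T - Lam z T) * (b * (exp (Lam z T + c / 2 * T) * ?d + \<epsilon>))
      + (- M' * ?d * exp (- (c / 2) * T)) - (- M' * ?d * exp (- (c / 2) * 0))) * prod_list (map norm ws)"
    proof (rule backward_estimate[where D = "\<lambda>t vs. Q (y t) vs - Q (z t) vs" and D' = "\<lambda>t vs. N (y t) vs - N (z t) vs"
          and Lx = "\<lambda>t. Lt (y t) (z t)" and E = "\<lambda>t. Err (y t) (z t)" and R' = "\<lambda>t. ME * ?d * exp (- (c / 2) * t)"
          and R = "\<lambda>t. - M' * ?d * exp (- (c / 2) * t)" and T = T and \<zeta> = z, OF z(2) T])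
      fix t assume t: "t \<in> {0..T}"
      note ytK = yK[OF t] and ztK = zK[OF t]
      show "multilin k (\<lambda>vs. Q (y t) vs - Q (z t) vs)" by (intro multilin_diff Q_ml ytK ztK)
      show "multilin k (\<lambda>vs. N (y t) vs - N (z t) vs)" by (intro multilin_diff N_ml ytK ztK)
      show "bet (z t) * (norm w)\<^sup>2 \<le> w \<bullet> Lt (y t) (z t) w" for w by (rule Lt_coercive[OF ztK ytK])
      show "((\<lambda>t. - M' * ?d * exp (- (c / 2) * t)) has_real_derivative ME * ?d * exp (- (c / 2) * t)) (at t within {0..T})"
        using c by (auto intro!: derivative_eq_intros simp: M'_def)
      show "0 \<le> ME * ?d * exp (- (c / 2) * t)" using ME by simp
      fix vs :: "'a list" assume l: "length vs = k"
      show "((\<lambda>t. Q (y t) vs - Q (z t) vs) has_vector_derivative N (y t) vs - N (z t) vs) (at t within {0..T})"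
        using t flow_derivD[OF Q_flow[OF l] y(2), of t] flow_derivD[OF Q_flow[OF l] z(2), of t]
        by (intro has_vector_derivative_diff has_vector_derivative_halfline_imp_Icc) auto
      show "N (y t) vs - N (z t) vs = Lt (y t) (z t) (Q (y t) vs - Q (z t) vs)
          - (\<Sum>i<k. Q (y t) (vs[i := dd (vs ! i) G (z t)]) - Q (z t) (vs[i := dd (vs ! i) G (z t)])) + Err (y t) (z t) vs"
        by (rule N_diff[OF ztK ytK l])
      have "norm (Err (y t) (z t) vs) \<le> ME * norm (y t - z t) * prod_list (map norm vs)" by (rule ME(2)[OF ztK ytK l])
      also have "\<dots> \<le> ME * (exp (Lam z t + c / 2 * t) * ?d) * prod_list (map norm vs)"
        using ME by (intro mult_right_mono mult_left_mono sharp t prod_list_norm_nonneg)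
      also have "exp (Lam z t + c / 2 * t) = exp (c * t + Lam z t) * exp (- (c / 2) * t)"
        unfolding exp_add[symmetric] by (simp add: field_simps)
      finally show "norm (Err (y t) (z t) vs) \<le> exp (c * t + Lam z t) * (ME * ?d * exp (- (c / 2) * t)) * prod_list (map norm vs)"
        by (simp add: mult_ac)
    next
      fix vs :: "'a list" assume l: "length vs = k"
      have TT: "T \<in> {0..T}" using T by simp
      have "norm (Q (y T) vs - Q (z T) vs) \<le> b * (norm (y T - z T) + \<epsilon>) * prod_list (map norm vs)"
        by (rule P[OF yK[OF TT] zK[OF TT] l])
      also have "\<dots> \<le> b * (exp (Lam z T + c / 2 * T) * ?d + \<epsilon>) * prod_list (map norm vs)"
        using b by (intro mult_right_mono mult_left_mono add_right_mono sharp TT prod_list_norm_nonneg)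
      finally show "norm (Q (y T) vs - Q (z T) vs) \<le> b * (exp (Lam z T + c / 2 * T) * ?d + \<epsilon>) * prod_list (map norm vs)" .
    next
      show "0 \<le> b * (exp (Lam z T + c / 2 * T) * ?d + \<epsilon>)" using b \<epsilon> by (simp add: add_nonneg_nonneg)
    qed (rule ws)
    also have "\<dots> \<le> ((b / 2 + M') * (?d + \<epsilon>)) * prod_list (map norm ws)"
    proof (rule mult_right_mono[OF _ prod_list_norm_nonneg])
      have Lm0: "0 \<le> Lam z T" by (rule Lam_nonneg[OF z(2) T])
      have e1: "exp (- c * T - Lam z T) * exp (Lam z T + c / 2 * T) = 1 / 2"
        unfolding exp_add[symmetric] expT[symmetric] by (simp add: field_simps)
      have e2: "exp (- c * T - Lam z T) \<le> 1 / 2"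
        unfolding expT[symmetric] using Lm0 mult_nonneg_nonneg[OF T less_imp_le[OF c]] by (simp add: field_simps)
      have "exp (- c * T - Lam z T) * (b * (exp (Lam z T + c / 2 * T) * ?d + \<epsilon>))
        = b * (exp (- c * T - Lam z T) * exp (Lam z T + c / 2 * T) * ?d) + b * (exp (- c * T - Lam z T) * \<epsilon>)"
        by (simp add: algebra_simps)
      also have "\<dots> \<le> b * (1 / 2 * ?d) + b * (1 / 2 * \<epsilon>)"
        unfolding e1 using b \<epsilon> e2 by (intro add_mono mult_left_mono mult_right_mono order_refl) auto
      finally have "exp (- c * T - Lam z T) * (b * (exp (Lam z T + c / 2 * T) * ?d + \<epsilon>)) \<le> b / 2 * (?d + \<epsilon>)"
        by (simp add: algebra_simps)
      moreover have "0 \<le> M' * ?d * exp (- (c / 2) * T)" "0 \<le> M' * \<epsilon>" using M' \<epsilon> by simp_all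
      ultimately show "exp (- c * T - Lam z T) * (b * (exp (Lam z T + c / 2 * T) * ?d + \<epsilon>))
          + (- M' * ?d * exp (- (c / 2) * T)) - (- M' * ?d * exp (- (c / 2) * 0)) \<le> (b / 2 + M') * (?d + \<epsilon>)"
        by (simp add: distrib_left distrib_right)
    qed
    finally show ?thesis by (simp add: y(1) z(1))
  qed
  \<comment> \<open>The map \<open>b \<mapsto> b / 2 + M'\<close> has the fixed point
    \<open>2 * M'\<close>. The other summand serves pairs more than \<open>\<rho>1\<close> apart,
    for which the bound \<open>2 * S\<close> on increments is enough.\<close>
  define LQ where "LQ = 2 * S / \<rho>1 + 2 * M'"
  have LQ: "0 \<le> LQ" using S \<rho>1 M' by (simp add: LQ_def)
  have iter: "norm (Q y vs - Q z vs) \<le> (LQ + 2 * S / \<epsilon> / 2 ^ n) * (norm (y - z) + \<epsilon>) * prod_list (map norm vs)"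
    if "y \<in> K" "z \<in> K" "length vs = k" "0 < \<epsilon>" for y z vs \<epsilon> n
    using that
  proof (induction n arbitrary: y z vs)
    case 0
    have "2 * S = 2 * S / \<epsilon> * \<epsilon>" using 0 by simp
    also have "\<dots> \<le> (LQ + 2 * S / \<epsilon> / 2 ^ 0) * (norm (y - z) + \<epsilon>)"
      using 0 LQ S by (intro mult_mono) auto
    finally have "2 * S * prod_list (map norm vs) \<le> (LQ + 2 * S / \<epsilon> / 2 ^ 0) * (norm (y - z) + \<epsilon>) * prod_list (map norm vs)"
      by (intro mult_right_mono prod_list_norm_nonneg)
    thus ?case using trivial_bound[OF 0(1,2,3)] by linarith
  next
    case (Suc n)
    let ?B = "LQ + 2 * S / \<epsilon> / 2 ^ n" and ?B' = "LQ + 2 * S / \<epsilon> / 2 ^ Suc n"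
    have B: "0 \<le> ?B" "0 \<le> 2 * S / \<epsilon> / 2 ^ Suc n" using LQ S Suc.prems(4) by simp_all
    show ?case
    proof (cases "norm (y - z) \<le> \<rho>1")
      case True
      have "norm (Q y vs - Q z vs) \<le> (?B / 2 + M') * (norm (y - z) + \<epsilon>) * prod_list (map norm vs)"
        by (rule small[OF Suc.prems(1,2,3) True B(1) Suc.prems(4) Suc.IH]) (use Suc.prems in auto)
      also have "\<dots> \<le> ?B' * (norm (y - z) + \<epsilon>) * prod_list (map norm vs)"
        using S \<rho>1 Suc.prems(4) by (intro mult_right_mono prod_list_norm_nonneg) (auto simp: LQ_def field_simps)
      finally show ?thesis .
    next
      case False
      have "2 * S = 2 * S / \<rho>1 * \<rho>1" using \<rho>1 by simp
      also have "\<dots> \<le> ?B' * (norm (y - z) + \<epsilon>)"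
        using False \<rho>1 S M' B(2) LQ Suc.prems(4) by (intro mult_mono) (auto simp: LQ_def)
      finally have "2 * S * prod_list (map norm vs) \<le> ?B' * (norm (y - z) + \<epsilon>) * prod_list (map norm vs)"
        by (intro mult_right_mono prod_list_norm_nonneg)
      thus ?thesis using trivial_bound[OF Suc.prems(1,2,3)] by linarith
    qed
  qed
  show ?thesis
  proof (rule that[OF LQ])
    fix y z and vs :: "'a list" assume yz: "y \<in> K" "z \<in> K" and l: "length vs = k"
    let ?p = "prod_list (map norm vs)"
    have 1: "norm (Q y vs - Q z vs) \<le> LQ * (norm (y - z) + \<epsilon>) * ?p" if \<epsilon>: "0 < \<epsilon>" for \<epsilon>
    proof -
      have "(\<lambda>n. (LQ + 2 * S / \<epsilon> / 2 ^ n) * (norm (y - z) + \<epsilon>) * ?p) \<longlonglongrightarrow> (LQ + 0) * (norm (y - z) + \<epsilon>) * ?p"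
        by (intro tendsto_intros LIMSEQ_divide_realpow_zero) auto
      from LIMSEQ_le_const[OF this] iter[OF yz l \<epsilon>] show ?thesis by simp
    qed
    have "((\<lambda>n. LQ * (norm (y - z) + 1 / real (Suc n)) * ?p) \<longlongrightarrow> LQ * (norm (y - z) + 0) * ?p) sequentially"
      by (intro tendsto_intros LIMSEQ_Suc[OF lim_1_over_n])
    from LIMSEQ_le_const[OF this] 1 show "norm (Q y vs - Q z vs) \<le> LQ * norm (y - z) * ?p" by simp
  qed
qed

text \<open>All moduli used along one trajectory, bundled into a single property of \<open>U\<close>
  that passes to subsets. One application of compactness then gives a common radius for a whole
  trajectory segment.\<close>

definition uniform_moduli :: "real \<Rightarrow> real \<Rightarrow> real \<Rightarrow> 'a set \<Rightarrow> bool" where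
  "uniform_moduli M1 ME e U \<longleftrightarrow> (\<forall>y\<in>U \<inter> K. \<forall>y'\<in>U \<inter> K. \<forall>x\<in>U \<inter> K. \<forall>x'\<in>U \<inter> K.
     (\<forall>w. norm (Lt y' y w - Lt x' x w) \<le> e * norm w) \<and>
     (\<forall>v. norm (dd v G y - dd v G x) \<le> e * norm v) \<and>
     (\<forall>p>0. \<forall>q>0. norm (p *\<^sub>R (G y' - G y) - q *\<^sub>R (G x' - G x)) \<le>
        M1 * norm (p *\<^sub>R (y' - y) - q *\<^sub>R (x' - x)) + e * (p * norm (y' - y) + q * norm (x' - x))) \<and>
     (\<forall>p>0. \<forall>q>0. \<forall>vs. length vs = k \<longrightarrow> norm (p *\<^sub>R Err y' y vs - q *\<^sub>R Err x' x vs) \<le>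
        (ME * norm (p *\<^sub>R (y' - y) - q *\<^sub>R (x' - x)) + e * (p * norm (y' - y) + q * norm (x' - x))) * prod_list (map norm vs)))"

lemma uniform_moduli_antimono: 
  assumes g: "uniform_moduli M1 ME e V" and "U \<subseteq> V"
  shows "uniform_moduli M1 ME e U"
proof -
  have "x \<in> U \<inter> K \<Longrightarrow> x \<in> V \<inter> K" for x using assms(2) by blast
  thus ?thesis unfolding uniform_moduli_def
    by (intro ballI, intro g[unfolded uniform_moduli_def, THEN bspec, THEN bspec, THEN bspec, THEN bspec])
qed

lemma uniform_moduliD:
  assumes "uniform_moduli M1 ME e U" "y \<in> U" "y' \<in> U" "x \<in> U" "x' \<in> U" "y \<in> K" "y' \<in> K" "x \<in> K" "x' \<in> K"
  shows "norm (Lt y' y w - Lt x' x w) \<le> e * norm w"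
    and "norm (dd v G y - dd v G x) \<le> e * norm v"
    and "0 < p \<Longrightarrow> 0 < q \<Longrightarrow> norm (p *\<^sub>R (G y' - G y) - q *\<^sub>R (G x' - G x)) \<le>
        M1 * norm (p *\<^sub>R (y' - y) - q *\<^sub>R (x' - x)) + e * (p * norm (y' - y) + q * norm (x' - x))"
    and "0 < p \<Longrightarrow> 0 < q \<Longrightarrow> length vs = k \<Longrightarrow> norm (p *\<^sub>R Err y' y vs - q *\<^sub>R Err x' x vs) \<le>
        (ME * norm (p *\<^sub>R (y' - y) - q *\<^sub>R (x' - x)) + e * (p * norm (y' - y) + q * norm (x' - x))) * prod_list (map norm vs)"
  using assms unfolding uniform_moduli_def by simp_all

lemma uniform_moduli_exist:
  obtains M1 ME where "0 \<le> M1" "0 \<le> ME"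
    "\<And>e Z. 0 < e \<Longrightarrow> compact Z \<Longrightarrow> Z \<subseteq> K \<Longrightarrow> \<exists>d>0. \<forall>z\<in>Z. uniform_moduli M1 ME e (ball z d)"
proof -
  obtain ME where ME: "0 \<le> ME"
    and "\<And>y y' vs. y \<in> K \<Longrightarrow> y' \<in> K \<Longrightarrow> length vs = k \<Longrightarrow> norm (Err y' y vs) \<le> ME * norm (y' - y) * prod_list (map norm vs)"
    and MEq: "\<And>z e. z \<in> K \<Longrightarrow> 0 < e \<Longrightarrow> \<exists>d>0. close_ml_quotients k K Err ME e (ball z d)"
    by (rule Err_bounds, rule that)
  obtain M1 where M1: "sd K (\<lambda>y' y. G y' - G y) M1" using sd_C1b[OF K G] ..
  show ?thesis
  proof (rule that[OF sd_nonneg[OF M1] ME])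
    fix e :: real and Z assume e: "0 < e" and Z: "compact Z" "Z \<subseteq> K"
    show "\<exists>d>0. \<forall>z\<in>Z. uniform_moduli M1 ME e (ball z d)"
    proof (rule compact_uniform_radius[OF Z(1) _ uniform_moduli_antimono])
      fix z assume "z \<in> Z"
      hence z: "z \<in> K" using Z by blast
      from Lt_cont[OF z e] obtain d1 where d1: "0 < d1" "close_maps K Lt e (ball z d1)" by (elim exE conjE)
      from dd_locally_close[OF K(1) G z e] obtain d2 where d2: "0 < d2" "\<forall>y\<in>ball z d2. \<forall>y'\<in>ball z d2. y \<in> K \<and> y' \<in> K \<and> (\<forall>v. norm (dd v G y - dd v G y') \<le> e * norm v)" by (elim exE conjE)
      from sd_close_quotients[OF M1 z e] obtain d3 where d3: "0 < d3" "close_quotients K (\<lambda>y' y. G y' - G y) M1 e (ball z d3)" by (elim exE conjE)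
      from MEq[OF z e] obtain d4 where d4: "0 < d4" "close_ml_quotients k K Err ME e (ball z d4)" by (elim exE conjE)
      define d where "d = min (min d1 d2) (min d3 d4)"
      show "\<exists>d>0. uniform_moduli M1 ME e (ball z d)"
      proof (intro exI[of _ d] conjI)
        show "0 < d" using d1(1) d2(1) d3(1) d4(1) by (simp add: d_def)
        have s: "x \<in> ball z d \<inter> K \<Longrightarrow> x \<in> ball z d1 \<inter> K" "x \<in> ball z d \<inter> K \<Longrightarrow> x \<in> ball z d2"
          "x \<in> ball z d \<inter> K \<Longrightarrow> x \<in> ball z d3 \<inter> K" "x \<in> ball z d \<inter> K \<Longrightarrow> x \<in> ball z d4 \<inter> K" for x
          by (simp_all add: d_def)
        show "uniform_moduli M1 ME e (ball z d)"
          unfolding uniform_moduli_def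
        proof (intro ballI, intro conjI)
          fix y y' x x' assume m: "y \<in> ball z d \<inter> K" "y' \<in> ball z d \<inter> K" "x \<in> ball z d \<inter> K" "x' \<in> ball z d \<inter> K"
          note s1 = m[THEN s(1)] and s2 = m[THEN s(2)] and s3 = m[THEN s(3)] and s4 = m[THEN s(4)]
          show "\<forall>w. norm (Lt y' y w - Lt x' x w) \<le> e * norm w"
            using d1(2)[THEN bspec[OF _ s1(1)], THEN bspec[OF _ s1(2)], THEN bspec[OF _ s1(3)], THEN bspec[OF _ s1(4)]] .
          show "\<forall>v. norm (dd v G y - dd v G x) \<le> e * norm v"
            using d2(2)[THEN bspec[OF _ s2(1)], THEN bspec[OF _ s2(3)]] by blast
          show "\<forall>p>0. \<forall>q>0. norm (p *\<^sub>R (G y' - G y) - q *\<^sub>R (G x' - G x)) \<le>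
            M1 * norm (p *\<^sub>R (y' - y) - q *\<^sub>R (x' - x)) + e * (p * norm (y' - y) + q * norm (x' - x))"
            using d3(2)[THEN bspec[OF _ s3(1)], THEN bspec[OF _ s3(2)], THEN bspec[OF _ s3(3)], THEN bspec[OF _ s3(4)]] .
          show "\<forall>p>0. \<forall>q>0. \<forall>vs. length vs = k \<longrightarrow> norm (p *\<^sub>R Err y' y vs - q *\<^sub>R Err x' x vs) \<le>
            (ME * norm (p *\<^sub>R (y' - y) - q *\<^sub>R (x' - x)) + e * (p * norm (y' - y) + q * norm (x' - x))) * prod_list (map norm vs)"
            using d4(2)[THEN bspec[OF _ s4(1)], THEN bspec[OF _ s4(2)], THEN bspec[OF _ s4(3)], THEN bspec[OF _ s4(4)]] .
        qed
      qed
    qed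
  qed
qed

text \<open>The difference of two difference quotients of \<open>Q\<close> satisfies the equation of
  \<open>Q\<close> up to an inhomogeneity of order \<open>e\<close>. What it may be at time
  \<open>T\<close> is damped to \<open>2 * LQ * exp (- (c / 2) * T)\<close>; the inhomogeneity adds
  \<open>e\<close> times a constant depending on \<open>T\<close>. So a large \<open>T\<close>
  followed by a small \<open>e\<close> makes the quotients close.\<close>

lemma quotients_close:
  assumes LQ: "0 \<le> LQ" "\<And>y z vs. y \<in> K \<Longrightarrow> z \<in> K \<Longrightarrow> length vs = k \<Longrightarrow> norm (Q y vs - Q z vs) \<le> LQ * norm (y - z) * prod_list (map norm vs)"
    and M1: "0 \<le> M1" and ME: "0 \<le> ME"
    and MG: "0 < MG" "\<And>x v. x \<in> K \<Longrightarrow> norm (dd v G x) \<le> MG * norm v"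
    and T: "0 \<le> T" and e: "0 < e" and \<rho>: "0 < \<rho>" "Lm * \<rho> \<le> c / 2"
    and tr: "traj K G \<zeta>" "traj K G z'" "traj K G y" "traj K G y'"
    and X0: "X0 = exp (MG * T)"
    and near: "X0 * norm (y 0 - \<zeta> 0) < min d0 \<rho>" "X0 * norm (y' 0 - \<zeta> 0) < min d0 \<rho>" "X0 * norm (z' 0 - \<zeta> 0) < min d0 \<rho>"
    and d0: "0 < d0" and uniform_moduli: "\<And>t. t \<in> {0..T} \<Longrightarrow> uniform_moduli M1 ME e (ball (\<zeta> t) d0)"
    and pq: "0 < p" "0 < q" and u: "norm u \<le> 1" "p *\<^sub>R (z' 0 - \<zeta> 0) = u" "q *\<^sub>R (y' 0 - y 0) = u"
    and ws: "length ws = k"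
  shows "norm (p *\<^sub>R (Q (z' 0) ws - Q (\<zeta> 0) ws) - q *\<^sub>R (Q (y' 0) ws - Q (y 0) ws))
     \<le> (2 * LQ * exp (- (c / 2) * T) + e * ((1 + real k) * LQ * X0 + ME * (exp (M1 * T) * 2 * X0 * T) + 2 * X0) * T) * prod_list (map norm ws)"
proof -
  have inK: "\<zeta> t \<in> K" "z' t \<in> K" "y t \<in> K" "y' t \<in> K" if "t \<in> {0..T}" for t
    using trajD(1)[OF tr(1)] trajD(1)[OF tr(2)] trajD(1)[OF tr(3)] trajD(1)[OF tr(4)] that by auto
  have expt: "exp (MG * t) \<le> X0" if "t \<in> {0..T}" for t using that MG X0 by simp
  have X01: "1 \<le> X0" using MG T X0 by simp
  have close: "norm (x t - \<zeta> t) < min d0 \<rho>" if "t \<in> {0..T}" "traj K G x" "X0 * norm (x 0 - \<zeta> 0) < min d0 \<rho>" for x t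
  proof -
    have "norm (x t - \<zeta> t) \<le> exp (MG * t) * norm (x 0 - \<zeta> 0)"
      by (rule traj_crude[OF tr(1) that(2) _ MG(2)]) (use that in auto)
    also have "\<dots> \<le> X0 * norm (x 0 - \<zeta> 0)" by (intro mult_right_mono expt that) simp
    finally show ?thesis using that(3) by linarith
  qed
  have mem: "\<zeta> t \<in> ball (\<zeta> t) d0" "z' t \<in> ball (\<zeta> t) d0" "y t \<in> ball (\<zeta> t) d0" "y' t \<in> ball (\<zeta> t) d0" if "t \<in> {0..T}" for t
    using close[OF that tr(2) near(3)] close[OF that tr(3) near(1)] close[OF that tr(4) near(2)] d0
    by (simp_all add: dist_norm norm_minus_commute)
  have within: "norm (\<zeta> t - \<zeta> t) \<le> \<rho>" "norm (z' t - \<zeta> t) \<le> \<rho>" "norm (y t - \<zeta> t) \<le> \<rho>" "norm (y' t - \<zeta> t) \<le> \<rho>" if "t \<in> {0..T}" for t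
    using close[OF that tr(2) near(3)] close[OF that tr(3) near(1)] close[OF that tr(4) near(2)] \<rho> by simp_all
  define d1 where "d1 t = p *\<^sub>R (z' t - \<zeta> t)" for t
  define d2 where "d2 t = q *\<^sub>R (y' t - y t)" for t
  have n1: "norm (d1 t) = p * norm (z' t - \<zeta> t)" and n2: "norm (d2 t) = q * norm (y' t - y t)" for t
    using pq by (simp_all add: d1_def d2_def)
  have init: "p * norm (z' 0 - \<zeta> 0) \<le> 1" "q * norm (y' 0 - y 0) \<le> 1" 
    using n1[of 0] n2[of 0] u by (simp_all add: d1_def d2_def)
  have dbound: "norm (d1 t) \<le> X0" "norm (d2 t) \<le> X0" if "t \<in> {0..T}" for t
  proof -
    have "norm (z' t - \<zeta> t) \<le> exp (MG * t) * norm (z' 0 - \<zeta> 0)"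
      by (rule traj_crude[OF tr(1,2) _ MG(2)]) (use that in auto)
    hence "p * norm (z' t - \<zeta> t) \<le> exp (MG * t) * (p * norm (z' 0 - \<zeta> 0))" using pq by (simp add: mult.left_commute)
    also have "\<dots> \<le> X0 * 1" using X01 by (intro mult_mono init expt that) (use pq in auto)
    finally show "norm (d1 t) \<le> X0" by (simp add: n1)
    have "norm (y' t - y t) \<le> exp (MG * t) * norm (y' 0 - y 0)"
      by (rule traj_crude[OF tr(3,4) _ MG(2)]) (use that in auto)
    hence "q * norm (y' t - y t) \<le> exp (MG * t) * (q * norm (y' 0 - y 0))" using pq by (simp add: mult.left_commute)
    also have "\<dots> \<le> X0 * 1" using X01 by (intro mult_mono init expt that) (use pq in auto)
    finally show "norm (d2 t) \<le> X0" by (simp add: n2)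
  qed
  \<comment> \<open>The sharp rate matters only at time \<open>T\<close>, where the displacement
    enters the final value that has to be damped. In between, the crude bound \<open>X0\<close>
    suffices since it is multiplied by \<open>e\<close>.\<close>
  have dsharp: "norm (d1 T) \<le> exp (Lam \<zeta> T + c / 2 * T)" "norm (d2 T) \<le> exp (Lam \<zeta> T + c / 2 * T)"
  proof -
    have E: "exp (Lam \<zeta> T + Lm * \<rho> * T) \<le> exp (Lam \<zeta> T + c / 2 * T)" using mult_right_mono[OF \<rho>(2) T] by simp
    have "norm (z' T - \<zeta> T) \<le> exp (Lam \<zeta> T + Lm * \<rho> * T) * norm (z' 0 - \<zeta> 0)"
      by (rule traj_sharp[OF tr(1,1,2) T within(1,2)])
    hence "p * norm (z' T - \<zeta> T) \<le> exp (Lam \<zeta> T + Lm * \<rho> * T) * (p * norm (z' 0 - \<zeta> 0))" using pq by (simp add: mult.left_commute)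
    also have "\<dots> \<le> exp (Lam \<zeta> T + c / 2 * T) * 1" by (intro mult_mono init E) (use pq in auto)
    finally show "norm (d1 T) \<le> exp (Lam \<zeta> T + c / 2 * T)" by (simp add: n1)
    have "norm (y' T - y T) \<le> exp (Lam \<zeta> T + Lm * \<rho> * T) * norm (y' 0 - y 0)"
      by (rule traj_sharp[OF tr(1,3,4) T within(3,4)])
    hence "q * norm (y' T - y T) \<le> exp (Lam \<zeta> T + Lm * \<rho> * T) * (q * norm (y' 0 - y 0))" using pq by (simp add: mult.left_commute)
    also have "\<dots> \<le> exp (Lam \<zeta> T + c / 2 * T) * 1" by (intro mult_mono init E) (use pq in auto)
    finally show "norm (d2 T) \<le> exp (Lam \<zeta> T + c / 2 * T)" by (simp add: n2)
  qed
  define Y where "Y = exp (M1 * T) * 2 * X0 * T"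
  have Y: "0 \<le> Y" using X01 T by (simp add: Y_def)
  \<comment> \<open>Both rescaled displacements start at \<open>u\<close>. Strict differentiability
    of \<open>G\<close> feeds their difference only through a term of order
    \<open>e\<close>.\<close>
  have ddiff: "norm (d1 t - d2 t) \<le> e * Y" if t: "t \<in> {0..T}" for t
  proof -
    have t0: "0 \<le> t" using t by simp
    have "1 * (exp (- (M1 * t)) * norm (d1 t - d2 t)) \<le> 1 * (exp (- (M1 * 0)) * norm (d1 0 - d2 0)) + e * 2 * X0 * t - e * 2 * X0 * 0"
    proof (rule weighted_growth[where s = 1 and A = "\<lambda>t. M1 * t" and a = "\<lambda>_. M1" and R = "\<lambda>t. e * 2 * X0 * t" and R' = "\<lambda>_. e * 2 * X0", OF t0])
      fix s assume s: "s \<in> {0..t}"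
      hence sT: "s \<in> {0..T}" using t by simp
      have s0: "0 \<le> s" using s by simp
      let ?\<delta>' = "p *\<^sub>R (G (z' s) - G (\<zeta> s)) - q *\<^sub>R (G (y' s) - G (y s))"
      show "((\<lambda>t. d1 t - d2 t) has_vector_derivative ?\<delta>') (at s within {0..t})"
        unfolding d1_def d2_def
        using has_vector_derivative_halfline_imp_Icc[OF trajD(2)[OF tr(1) s0]] has_vector_derivative_halfline_imp_Icc[OF trajD(2)[OF tr(2) s0]]
          has_vector_derivative_halfline_imp_Icc[OF trajD(2)[OF tr(3) s0]] has_vector_derivative_halfline_imp_Icc[OF trajD(2)[OF tr(4) s0]]
        by (intro has_vector_derivative_diff bounded_linear.has_vector_derivative[OF bounded_linear_scaleR_right])
      show "((\<lambda>t. M1 * t) has_real_derivative M1) (at s within {0..t})" by (auto intro!: derivative_eq_intros)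
      show "((\<lambda>t. e * 2 * X0 * t) has_real_derivative e * 2 * X0) (at s within {0..t})" by (auto intro!: derivative_eq_intros)
      show "0 \<le> e * 2 * X0" using e X01 by simp
      have "norm ?\<delta>' \<le> M1 * norm (d1 s - d2 s) + e * (norm (d1 s) + norm (d2 s))"
        unfolding n1 n2 unfolding d1_def d2_def
        by (rule uniform_moduliD(3)[OF uniform_moduli[OF sT] mem(1,2,3,4)[OF sT] inK(1,2,3,4)[OF sT] pq])
      also have "\<dots> \<le> M1 * norm (d1 s - d2 s) + e * (X0 + X0)"
        using e by (intro add_mono mult_left_mono dbound sT order_refl) auto
      finally have "norm (d1 s - d2 s) * norm ?\<delta>' \<le> norm (d1 s - d2 s) * (M1 * norm (d1 s - d2 s) + e * 2 * X0)"
        by (intro mult_left_mono) auto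
      moreover have "1 * (e * 2 * X0 * norm (d1 s - d2 s)) \<le> exp (M1 * s) * (e * 2 * X0 * norm (d1 s - d2 s))"
        using M1 s0 e X01 by (intro mult_right_mono) auto
      ultimately show "1 * ((d1 s - d2 s) \<bullet> ?\<delta>') \<le> 1 * M1 * (norm (d1 s - d2 s))\<^sup>2 + exp (M1 * s) * (e * 2 * X0) * norm (d1 s - d2 s)"
        using norm_cauchy_schwarz[of "d1 s - d2 s" ?\<delta>'] by (simp add: power2_eq_square algebra_simps)
    qed simp
    hence "exp (M1 * t) * (exp (- (M1 * t)) * norm (d1 t - d2 t)) \<le> exp (M1 * t) * (e * 2 * X0 * t)"
      using u by (intro mult_left_mono) (simp_all add: d1_def d2_def)
    moreover have "exp (M1 * t) * (exp (- (M1 * t)) * norm (d1 t - d2 t)) = norm (d1 t - d2 t)"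
      by (simp add: exp_minus)
    ultimately have "norm (d1 t - d2 t) \<le> exp (M1 * t) * (e * 2 * X0 * t)" by linarith
    also have "\<dots> \<le> exp (M1 * T) * (e * 2 * X0 * T)"
      using t M1 e X01 by (intro mult_mono) (auto intro!: mult_left_mono)
    finally show ?thesis by (simp add: Y_def mult_ac)
  qed
  define Z0 where "Z0 = (1 + real k) * LQ * X0 + ME * Y + 2 * X0"
  have Z0: "0 \<le> Z0" using LQ X01 ME Y by (simp add: Z0_def)
  define q2 where "q2 t vs = q *\<^sub>R (Q (y' t) vs - Q (y t) vs)" for t vs
  have q2b: "norm (q2 t vs) \<le> LQ * X0 * prod_list (map norm vs)" if "t \<in> {0..T}" "length vs = k" for t vs
  proof -
    have "norm (q2 t vs) \<le> q * (LQ * norm (y' t - y t) * prod_list (map norm vs))"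
      using pq LQ(2)[OF inK(4)[OF that(1)] inK(3)[OF that(1)] that(2)] by (simp add: q2_def mult_left_mono)
    also have "\<dots> = LQ * norm (d2 t) * prod_list (map norm vs)" by (simp add: n2)
    also have "\<dots> \<le> LQ * X0 * prod_list (map norm vs)"
      by (intro mult_right_mono mult_left_mono dbound that LQ prod_list_norm_nonneg)
    finally show ?thesis .
  qed
  have q2ml: "multilin k (q2 t)" if "t \<in> {0..T}" for t
    unfolding q2_def[abs_def] by (intro multilin_scaleR multilin_diff Q_ml inK that)
  define D where "D t vs = p *\<^sub>R (Q (z' t) vs - Q (\<zeta> t) vs) - q *\<^sub>R (Q (y' t) vs - Q (y t) vs)" for t vs
  \<comment> \<open>The second quotient is forced into the equation of the first. The cost is the
    difference of the rescaled errors, the change of \<open>Lt\<close> acting on \<open>q2\<close>,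
    and the change of \<open>DG\<close> in each slot of \<open>q2\<close>.\<close>
  define E where "E t vs = (p *\<^sub>R Err (z' t) (\<zeta> t) vs - q *\<^sub>R Err (y' t) (y t) vs)
      + (Lt (z' t) (\<zeta> t) (q2 t vs) - Lt (y' t) (y t) (q2 t vs))
      + (\<Sum>i<k. q2 t (vs[i := dd (vs ! i) G (y t) - dd (vs ! i) G (\<zeta> t)]))" for t vs
  have "norm (D 0 ws) \<le> (exp (- c * T - Lam \<zeta> T) * (2 * LQ * exp (Lam \<zeta> T + c / 2 * T)) + e * Z0 * T - e * Z0 * 0) * prod_list (map norm ws)"
  proof (rule backward_estimate[where D = D and D' = "\<lambda>t vs. p *\<^sub>R (N (z' t) vs - N (\<zeta> t) vs) - q *\<^sub>R (N (y' t) vs - N (y t) vs)"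
        and Lx = "\<lambda>t. Lt (z' t) (\<zeta> t)" and E = E and R' = "\<lambda>_. e * Z0"
        and R = "\<lambda>t. e * Z0 * t" and T = T and \<zeta> = \<zeta>, OF tr(1) T])
    fix t assume t: "t \<in> {0..T}"
    have t0: "0 \<le> t" using t by simp
    show "multilin k (D t)" unfolding D_def[abs_def] by (intro multilin_diff multilin_scaleR Q_ml inK t)
    show "multilin k (\<lambda>vs. p *\<^sub>R (N (z' t) vs - N (\<zeta> t) vs) - q *\<^sub>R (N (y' t) vs - N (y t) vs))"
      by (intro multilin_diff multilin_scaleR N_ml inK t)
    show "bet (\<zeta> t) * (norm w)\<^sup>2 \<le> w \<bullet> Lt (z' t) (\<zeta> t) w" for w by (rule Lt_coercive[OF inK(1,2)[OF t]])
    show "((\<lambda>t. e * Z0 * t) has_real_derivative e * Z0) (at t within {0..T})" by (auto intro!: derivative_eq_intros)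
    show "0 \<le> e * Z0" using e Z0 by simp
    fix vs :: "'a list" assume l: "length vs = k"
    let ?P = "prod_list (map norm vs)"
    show "((\<lambda>t. D t vs) has_vector_derivative p *\<^sub>R (N (z' t) vs - N (\<zeta> t) vs) - q *\<^sub>R (N (y' t) vs - N (y t) vs)) (at t within {0..T})"
      unfolding D_def
      using has_vector_derivative_halfline_imp_Icc[OF flow_derivD[OF Q_flow[OF l] tr(1) t0]] has_vector_derivative_halfline_imp_Icc[OF flow_derivD[OF Q_flow[OF l] tr(2) t0]]
        has_vector_derivative_halfline_imp_Icc[OF flow_derivD[OF Q_flow[OF l] tr(3) t0]] has_vector_derivative_halfline_imp_Icc[OF flow_derivD[OF Q_flow[OF l] tr(4) t0]]
      by (intro has_vector_derivative_diff bounded_linear.has_vector_derivative[OF bounded_linear_scaleR_right])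
    show "p *\<^sub>R (N (z' t) vs - N (\<zeta> t) vs) - q *\<^sub>R (N (y' t) vs - N (y t) vs) =
        Lt (z' t) (\<zeta> t) (D t vs) - (\<Sum>i<k. D t (vs[i := dd (vs ! i) G (\<zeta> t)])) + E t vs"
    proof -
      note l1 = Lt_lin[OF inK(1,2)[OF t]] and l2 = Lt_lin[OF inK(3,4)[OF t]]
      have sub: "q2 t (vs[i := dd (vs ! i) G (y t) - dd (vs ! i) G (\<zeta> t)])
        = q2 t (vs[i := dd (vs ! i) G (y t)]) - q2 t (vs[i := dd (vs ! i) G (\<zeta> t)])" if "i < k" for i
        by (rule linear_diff[OF multilin_linear[OF q2ml[OF t] that l]])
      have D: "D t ws = p *\<^sub>R (Q (z' t) ws - Q (\<zeta> t) ws) - q2 t ws" for ws by (simp add: D_def q2_def)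
      have s: "(\<Sum>i<k. q2 t (vs[i := dd (vs ! i) G (y t) - dd (vs ! i) G (\<zeta> t)]))
        = (\<Sum>i<k. q2 t (vs[i := dd (vs ! i) G (y t)])) - (\<Sum>i<k. q2 t (vs[i := dd (vs ! i) G (\<zeta> t)]))"
        unfolding sum_subtractf[symmetric] by (intro sum.cong refl sub) simp
      have q2s: "(\<Sum>i<k. q2 t (vs[i := dd (vs ! i) G (y t)])) = q *\<^sub>R (\<Sum>i<k. Q (y' t) (vs[i := dd (vs ! i) G (y t)]) - Q (y t) (vs[i := dd (vs ! i) G (y t)]))"
        unfolding q2_def scaleR_sum_right ..
      have Ds: "(\<Sum>i<k. D t (vs[i := dd (vs ! i) G (\<zeta> t)]))
        = p *\<^sub>R (\<Sum>i<k. Q (z' t) (vs[i := dd (vs ! i) G (\<zeta> t)]) - Q (\<zeta> t) (vs[i := dd (vs ! i) G (\<zeta> t)])) - (\<Sum>i<k. q2 t (vs[i := dd (vs ! i) G (\<zeta> t)]))"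
        unfolding D by (simp add: sum_subtractf scaleR_sum_right scaleR_diff_right)
      have LD: "Lt (z' t) (\<zeta> t) (D t vs) = p *\<^sub>R Lt (z' t) (\<zeta> t) (Q (z' t) vs - Q (\<zeta> t) vs) - Lt (z' t) (\<zeta> t) (q2 t vs)"
        unfolding D linear_diff[OF l1, of "p *\<^sub>R (Q (z' t) vs - Q (\<zeta> t) vs)"] linear_cmul[OF l1] ..
      have Lq: "Lt (y' t) (y t) (q2 t vs) = q *\<^sub>R Lt (y' t) (y t) (Q (y' t) vs - Q (y t) vs)"
        unfolding q2_def linear_cmul[OF l2] ..
      show ?thesis
        unfolding N_diff[OF inK(1,2)[OF t] l] N_diff[OF inK(3,4)[OF t] l] LD Ds E_def s q2s Lq
        by (simp only: scaleR_add_right scaleR_diff_right) simp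
    qed
    have "norm (E t vs) \<le> (ME * (e * Y) + e * (X0 + X0)) * ?P + e * (LQ * X0 * ?P) + real k * (e * (LQ * X0 * ?P))"
      unfolding E_def
    proof (intro norm_triangle_le add_mono)
      have "norm (p *\<^sub>R Err (z' t) (\<zeta> t) vs - q *\<^sub>R Err (y' t) (y t) vs) \<le> (ME * norm (d1 t - d2 t) + e * (norm (d1 t) + norm (d2 t))) * ?P"
        unfolding n1 n2 unfolding d1_def d2_def
        by (rule uniform_moduliD(4)[OF uniform_moduli[OF t] mem(1,2,3,4)[OF t] inK(1,2,3,4)[OF t] pq l])
      also have "\<dots> \<le> (ME * (e * Y) + e * (X0 + X0)) * ?P"
        using ME e by (intro mult_right_mono add_mono mult_left_mono ddiff dbound t prod_list_norm_nonneg) auto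
      finally show "norm (p *\<^sub>R Err (z' t) (\<zeta> t) vs - q *\<^sub>R Err (y' t) (y t) vs) \<le> (ME * (e * Y) + e * (X0 + X0)) * ?P" .
      have "norm (Lt (z' t) (\<zeta> t) (q2 t vs) - Lt (y' t) (y t) (q2 t vs)) \<le> e * norm (q2 t vs)"
        by (rule uniform_moduliD(1)[OF uniform_moduli[OF t] mem(1,2,3,4)[OF t] inK(1,2,3,4)[OF t]])
      also have "\<dots> \<le> e * (LQ * X0 * ?P)" using e by (intro mult_left_mono q2b t l) auto
      finally show "norm (Lt (z' t) (\<zeta> t) (q2 t vs) - Lt (y' t) (y t) (q2 t vs)) \<le> e * (LQ * X0 * ?P)" .
      have "norm (\<Sum>i<k. q2 t (vs[i := dd (vs ! i) G (y t) - dd (vs ! i) G (\<zeta> t)])) \<le> real (card {..<k}) * (e * (LQ * X0 * ?P))"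
      proof (rule sum_norm_bound)
        fix i assume "i \<in> {..<k}"
        hence i: "i < length vs" using l by simp
        have "norm (q2 t (vs[i := dd (vs ! i) G (y t) - dd (vs ! i) G (\<zeta> t)])) \<le> LQ * X0 * prod_list (map norm (vs[i := dd (vs ! i) G (y t) - dd (vs ! i) G (\<zeta> t)]))"
          by (rule q2b[OF t]) (simp add: l)
        also have "\<dots> \<le> LQ * X0 * (e * ?P)"
          using LQ X01
          by (intro mult_left_mono prod_list_norm_update_le i uniform_moduliD(2)[OF uniform_moduli[OF t] mem(3,3,1,1)[OF t] inK(3,3,1,1)[OF t]]) auto
        finally show "norm (q2 t (vs[i := dd (vs ! i) G (y t) - dd (vs ! i) G (\<zeta> t)])) \<le> e * (LQ * X0 * ?P)" by (simp add: mult_ac)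
      qed
      thus "norm (\<Sum>i<k. q2 t (vs[i := dd (vs ! i) G (y t) - dd (vs ! i) G (\<zeta> t)])) \<le> real k * (e * (LQ * X0 * ?P))" by simp
    qed
    also have "\<dots> = 1 * (e * Z0 * ?P)" by (simp add: Z0_def algebra_simps)
    also have "\<dots> \<le> exp (c * t + Lam \<zeta> t) * (e * Z0 * ?P)"
      using c t0 Lam_nonneg[OF tr(1) t0] e Z0 prod_list_norm_nonneg[of vs] by (intro mult_right_mono) auto
    finally show "norm (E t vs) \<le> exp (c * t + Lam \<zeta> t) * (e * Z0) * ?P" by (simp add: mult_ac)
  next
    fix vs :: "'a list" assume l: "length vs = k"
    let ?P = "prod_list (map norm vs)"
    have TT: "T \<in> {0..T}" using T by simp
    have "norm (D T vs) \<le> norm (p *\<^sub>R (Q (z' T) vs - Q (\<zeta> T) vs)) + norm (q *\<^sub>R (Q (y' T) vs - Q (y T) vs))"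
      unfolding D_def by (rule norm_triangle_ineq4)
    also have "\<dots> \<le> p * (LQ * norm (z' T - \<zeta> T) * ?P) + q * (LQ * norm (y' T - y T) * ?P)"
      unfolding norm_scaleR abs_of_pos[OF pq(1)] abs_of_pos[OF pq(2)]
      using pq by (intro add_mono mult_left_mono LQ(2) inK TT l) auto
    also have "\<dots> = LQ * norm (d1 T) * ?P + LQ * norm (d2 T) * ?P" by (simp add: n1 n2)
    also have "\<dots> \<le> LQ * exp (Lam \<zeta> T + c / 2 * T) * ?P + LQ * exp (Lam \<zeta> T + c / 2 * T) * ?P"
      by (intro add_mono mult_right_mono mult_left_mono dsharp LQ prod_list_norm_nonneg)
    finally show "norm (D T vs) \<le> 2 * LQ * exp (Lam \<zeta> T + c / 2 * T) * ?P" by (simp add: mult_ac)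
  next
    show "0 \<le> 2 * LQ * exp (Lam \<zeta> T + c / 2 * T)" using LQ by simp
  qed (rule ws)
  also have "exp (- c * T - Lam \<zeta> T) * (2 * LQ * exp (Lam \<zeta> T + c / 2 * T)) = 2 * LQ * exp (- (c / 2) * T)"
  proof -
    have "exp (- c * T - Lam \<zeta> T) * exp (Lam \<zeta> T + c / 2 * T) = exp (- (c / 2) * T)"
      unfolding exp_add[symmetric] by (simp add: field_simps)
    thus ?thesis by (metis mult.assoc mult.left_commute)
  qed
  finally show ?thesis by (simp add: D_def Z0_def Y_def)
qed

text \<open>Order of the choices: the tolerance determines \<open>T\<close>, then \<open>T\<close>
  determines \<open>e\<close>, then compactness of the segment of \<open>\<zeta>\<close> over
  \<open>[0, T]\<close> determines \<open>d0\<close>, and finally the crude growth over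
  \<open>[0, T]\<close> determines the initial distance \<open>d\<close>.\<close>

theorem section_C1b:
  assumes ws: "length ws = k"
  shows "C1b K (\<lambda>z. Q z ws)"
proof -
  obtain LQ where LQ: "0 \<le> LQ"
    "\<And>y z vs. y \<in> K \<Longrightarrow> z \<in> K \<Longrightarrow> length vs = k \<Longrightarrow> norm (Q y vs - Q z vs) \<le> LQ * norm (y - z) * prod_list (map norm vs)"
    by (rule Q_lipschitz, rule that)
  obtain M1 ME where M1: "0 \<le> M1" and ME: "0 \<le> ME"
    and gd: "\<And>e Z. 0 < e \<Longrightarrow> compact Z \<Longrightarrow> Z \<subseteq> K \<Longrightarrow> \<exists>d>0. \<forall>z\<in>Z. uniform_moduli M1 ME e (ball z d)"
    by (rule uniform_moduli_exist, rule that)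
  obtain MG where MG: "0 < MG" "\<And>x v. x \<in> K \<Longrightarrow> norm (dd v G x) \<le> MG * norm v" using C1b_bound[OF G] by metis
  define \<rho> where "\<rho> = c / (2 * (Lm + 1))"
  have \<rho>: "0 < \<rho>" "Lm * \<rho> \<le> c / 2"
    using c Lm by (simp_all add: \<rho>_def divide_simps)
  let ?P = "prod_list (map norm ws)"
  have P: "0 \<le> ?P" by (rule prod_list_norm_nonneg)
  show ?thesis
  proof (rule strict_quotients_C1b[OF K(1)])
    show "0 \<le> LQ * ?P" using LQ P by simp
    show "norm (Q y ws - Q z ws) \<le> LQ * ?P * norm (y - z)" if "y \<in> K" "z \<in> K" for y z
      using LQ(2)[OF that ws] by (simp add: mult_ac)
    fix z and \<epsilon> :: real assume z: "z \<in> K" and \<epsilon>: "0 < \<epsilon>"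
    obtain \<zeta> where \<zeta>: "\<zeta> 0 = z" "traj K G \<zeta>" using ex_traj[OF z] by blast
    define e1 where "e1 = \<epsilon> / (?P + 1)"
    have e1: "0 < e1" "e1 * ?P \<le> \<epsilon>"
      using \<epsilon> P by (simp_all add: e1_def divide_simps mult_left_mono add_nonneg_pos)
    \<comment> \<open>With this choice \<open>exp (c / 2 * T) \<ge> 4 * LQ / e1\<close> follows from
      \<open>exp x \<ge> 1 + x\<close>.\<close>
    define T where "T = 2 / c * (4 * LQ / e1)"
    have T: "0 \<le> T" using c LQ e1 by (simp add: T_def)
    have T1: "2 * LQ * exp (- (c / 2) * T) \<le> e1 / 2"
    proof -
      have "4 * LQ / e1 = c / 2 * T" using c by (simp add: T_def)
      hence "4 * LQ / e1 \<le> exp (c / 2 * T)" using exp_ge_add_one_self[of "c / 2 * T"] by linarith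
      hence "4 * LQ \<le> e1 * exp (c / 2 * T)" using e1 by (simp add: field_simps)
      hence "4 * LQ * exp (- (c / 2 * T)) \<le> e1 * exp (c / 2 * T) * exp (- (c / 2 * T))" by (intro mult_right_mono) auto
      also have "\<dots> = e1" by (simp add: exp_minus)
      finally show ?thesis by simp
    qed
    define X0 where "X0 = exp (MG * T)"
    define Z0 where "Z0 = (1 + real k) * LQ * X0 + ME * (exp (M1 * T) * 2 * X0 * T) + 2 * X0"
    have X0: "0 < X0" by (simp add: X0_def)
    have Z0: "0 \<le> Z0" using LQ ME T X0 by (simp add: Z0_def)
    define e where "e = e1 / 2 / (Z0 * T + 1)"
    have den: "0 < Z0 * T + 1" using Z0 T by (simp add: add_nonneg_pos)
    have e: "0 < e" using e1 den by (simp add: e_def)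
    have e2: "e * Z0 * T \<le> e1 / 2"
    proof -
      have "e * (Z0 * T) \<le> e * (Z0 * T + 1)" using e by (intro mult_left_mono) auto
      also have "\<dots> = e1 / 2" unfolding e_def using den by (intro nonzero_eq_divide_eq[THEN iffD1]) auto
      finally show ?thesis by (simp add: mult.assoc)
    qed
    have "\<zeta> ` {0..T} \<subseteq> K" using trajD(1)[OF \<zeta>(2)] by auto
    from gd[OF e traj_compact[OF \<zeta>(2)] this] obtain d0 where d0: "0 < d0" "\<And>t. t \<in> {0..T} \<Longrightarrow> uniform_moduli M1 ME e (ball (\<zeta> t) d0)" by blast
    obtain r where r: "0 < r" "ball z r \<subseteq> K" using K(1) z open_contains_ball by blast
    \<comment> \<open>The factor 2 is for \<open>y'\<close>, which starts at
      \<open>y0 + s *\<^sub>R u\<close> and hence within \<open>2 * d\<close> of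
      \<open>z\<close>.\<close>
    define d where "d = min r (min d0 \<rho> / (2 * X0))"
    have d: "0 < d" "d \<le> r" using r d0 \<rho> X0 by (simp_all add: d_def)
    have dX: "X0 * w < min d0 \<rho>" if "w < 2 * d" for w
    proof -
      have "X0 * w < X0 * (2 * d)" using that X0 by simp
      also have "\<dots> \<le> X0 * (2 * (min d0 \<rho> / (2 * X0)))" using X0 by (intro mult_left_mono) (auto simp: d_def)
      also have "\<dots> = min d0 \<rho>" using X0 by simp
      finally show ?thesis .
    qed
    show "\<exists>d>0. ball z d \<subseteq> K \<and> (\<forall>y\<in>ball z d. \<forall>s s' u. 0 < s \<longrightarrow> s < d \<longrightarrow> 0 < s' \<longrightarrow> s' < d \<longrightarrow>
       norm u \<le> 1 \<longrightarrow> y + s *\<^sub>R u \<in> K \<longrightarrow> z + s' *\<^sub>R u \<in> K \<longrightarrow>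
       norm ((1 / s) *\<^sub>R (Q (y + s *\<^sub>R u) ws - Q y ws) - (1 / s') *\<^sub>R (Q (z + s' *\<^sub>R u) ws - Q z ws)) \<le> \<epsilon>)"
    proof (intro exI[of _ d] conjI d(1) ballI allI impI)
      show "ball z d \<subseteq> K" using r(2) d(2) by auto
      fix y0 u and s s' :: real
      assume y0: "y0 \<in> ball z d" and s: "0 < s" "s < d" "0 < s'" "s' < d" and u: "norm u \<le> 1"
        and K': "y0 + s *\<^sub>R u \<in> K" "z + s' *\<^sub>R u \<in> K"
      have y0K: "y0 \<in> K" using y0 \<open>ball z d \<subseteq> K\<close> by blast
      obtain y where y: "y 0 = y0" "traj K G y" using ex_traj[OF y0K] by blast
      obtain y' where y': "y' 0 = y0 + s *\<^sub>R u" "traj K G y'" using ex_traj[OF K'(1)] by blast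
      obtain z' where z': "z' 0 = z + s' *\<^sub>R u" "traj K G z'" using ex_traj[OF K'(2)] by blast
      have yz: "norm (y0 - z) < d" using y0 by (simp add: dist_norm norm_minus_commute)
      have su: "norm (s *\<^sub>R u) < d" "norm (s' *\<^sub>R u) < d"
      proof -
        have "norm (s *\<^sub>R u) \<le> s" "norm (s' *\<^sub>R u) \<le> s'" using s u by simp_all
        thus "norm (s *\<^sub>R u) < d" "norm (s' *\<^sub>R u) < d" using s by linarith+
      qed
      have "norm ((1 / s') *\<^sub>R (Q (z' 0) ws - Q (\<zeta> 0) ws) - (1 / s) *\<^sub>R (Q (y' 0) ws - Q (y 0) ws))
        \<le> (2 * LQ * exp (- (c / 2) * T) + e * ((1 + real k) * LQ * X0 + ME * (exp (M1 * T) * 2 * X0 * T) + 2 * X0) * T) * ?P"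
      proof (rule quotients_close[OF LQ M1 ME MG T e \<rho> \<zeta>(2) z'(2) y(2) y'(2) X0_def _ _ _ d0 _ _ u _ _ ws])
        show "X0 * norm (y 0 - \<zeta> 0) < min d0 \<rho>" by (rule dX) (use y \<zeta> yz d(1) in simp)
        show "X0 * norm (y' 0 - \<zeta> 0) < min d0 \<rho>"
          by (rule dX) (use y' \<zeta> yz su norm_triangle_ineq[of "y0 - z" "s *\<^sub>R u"] in \<open>simp add: algebra_simps\<close>)
        show "X0 * norm (z' 0 - \<zeta> 0) < min d0 \<rho>" by (rule dX) (use z' \<zeta> su d(1) in simp)
      qed (use s y y' z' \<zeta> in simp_all)
      also have "\<dots> = (2 * LQ * exp (- (c / 2) * T) + e * Z0 * T) * ?P" by (simp add: Z0_def)
      also have "\<dots> \<le> (e1 / 2 + e1 / 2) * ?P" by (intro mult_right_mono add_mono T1 e2 P)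
      also have "\<dots> \<le> \<epsilon>" using e1(2) by simp
      finally show "norm ((1 / s) *\<^sub>R (Q (y0 + s *\<^sub>R u) ws - Q y0 ws) - (1 / s') *\<^sub>R (Q (z + s' *\<^sub>R u) ws - Q z ws)) \<le> \<epsilon>"
        by (simp add: y(1) y'(1) z'(1) \<zeta>(1) norm_minus_commute)
    qed
  qed
qed

end

section \<open>Smoothness of invariant graphs\<close>

text \<open>\<open>dd\<close> differentiates in constant directions, whereas the equations contain
  \<open>h\<close>, \<open>f\<close> and \<open>g\<close> differentiated in directions that move
  with \<open>z\<close>. Linearity in the direction reduces this to products of coefficients with
  constant-direction derivatives.\<close>

lemma Cb_lin_field:
  fixes T :: "'x::euclidean_space \<Rightarrow> 'a::real_normed_vector \<Rightarrow> 'b::real_normed_vector"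
  assumes K: "open K" and lin: "\<And>z. z \<in> K \<Longrightarrow> linear (\<lambda>x. T x z)"
    and T: "\<And>b. Cb s K (T b)" and X: "Cb s K X"
  shows "Cb s K (\<lambda>z. T (X z) z)"
proof (rule Cb_cong[OF K])
  show "Cb s K (\<lambda>z. \<Sum>b\<in>Basis. (X z \<bullet> b) *\<^sub>R T b z)"
    by (intro Cb_sum[OF K] Cb_scaleR[OF K] T Cb_bounded_linear[OF bounded_linear_inner_left K X])
  show "(\<Sum>b\<in>Basis. (X z \<bullet> b) *\<^sub>R T b z) = T (X z) z" if "z \<in> K" for z
    by (rule linear_expand[OF lin[OF that], symmetric])
qed

lemma dd_sum:
  assumes "\<And>i. i \<in> I \<Longrightarrow> F i differentiable (at x)"
  shows "dd v (\<lambda>x. \<Sum>i\<in>I. F i x) x = (\<Sum>i\<in>I. dd v (F i) x)"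
  by (rule dd_eq) (intro has_derivative_sum has_derivative_dd assms)

lemma dd_diff:
  "F differentiable (at x) \<Longrightarrow> H differentiable (at x) \<Longrightarrow> dd v (\<lambda>x. F x - H x) x = dd v F x - dd v H x"
  by (rule dd_eq) (intro has_derivative_diff has_derivative_dd)

text \<open>Product rule for a moving argument: the derivative falls either on \<open>X\<close>, or
  on the field with the argument frozen at \<open>X z\<close>.\<close>

lemma dd_lin_field:
  fixes T :: "'x::euclidean_space \<Rightarrow> 'a::real_normed_vector \<Rightarrow> 'b::real_normed_vector"
  assumes K: "open K" and z: "z \<in> K" and lin: "\<And>z. z \<in> K \<Longrightarrow> linear (\<lambda>x. T x z)"
    and T: "\<And>b. T b differentiable (at z)" and X: "X differentiable (at z)"
  shows "dd w (\<lambda>z. T (X z) z) z = T (dd w X z) z + dd w (T (X z)) z"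
proof -
  have Xb: "(\<lambda>z. X z \<bullet> b) differentiable (at z)" for b
    using bounded_linear.has_derivative[OF bounded_linear_inner_left has_derivative_dd[OF X]] by (rule differentiableI)
  have sc: "(\<lambda>z. (X z \<bullet> b) *\<^sub>R T b z) differentiable (at z)" for b
    using has_derivative_scaleR[OF has_derivative_dd[OF Xb] has_derivative_dd[OF T]] by (rule differentiableI)
  have sc': "(\<lambda>y. (X z \<bullet> b) *\<^sub>R T b y) differentiable (at z)" for b
    using bounded_linear.has_derivative[OF bounded_linear_scaleR_right has_derivative_dd[OF T]] by (rule differentiableI)
  have "dd w (\<lambda>z. T (X z) z) z = dd w (\<lambda>z. \<Sum>b\<in>Basis. (X z \<bullet> b) *\<^sub>R T b z) z"
    by (rule dd_transform[OF K z]) (rule linear_expand[OF lin])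
  also have "\<dots> = (\<Sum>b\<in>Basis. (X z \<bullet> b) *\<^sub>R dd w (T b) z + (dd w X z \<bullet> b) *\<^sub>R T b z)"
    by (simp add: dd_sum sc dd_scaleR Xb T dd_bounded_linear[OF bounded_linear_inner_left X])
  also have "\<dots> = (\<Sum>b\<in>Basis. (X z \<bullet> b) *\<^sub>R dd w (T b) z) + T (dd w X z) z"
    by (simp add: sum.distrib linear_expand[OF lin[OF z], of "dd w X z"])
  also have "(\<Sum>b\<in>Basis. (X z \<bullet> b) *\<^sub>R dd w (T b) z) = dd w (\<lambda>y. \<Sum>b\<in>Basis. (X z \<bullet> b) *\<^sub>R T b y) z"
    by (simp add: dd_sum sc' dd_bounded_linear[OF bounded_linear_scaleR_right T])
  also have "\<dots> = dd w (T (X z)) z"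
    by (rule dd_transform[OF K z]) (rule linear_expand[OF lin, symmetric])
  finally show ?thesis by (simp add: add.commute)
qed

lemma linear_dd_param:
  fixes T :: "'x::real_vector \<Rightarrow> 'a::real_normed_vector \<Rightarrow> 'b::real_normed_vector"
  assumes K: "open K" and z: "z \<in> K" and lin: "\<And>z. z \<in> K \<Longrightarrow> linear (\<lambda>x. T x z)"
    and T: "\<And>b. T b differentiable (at z)"
  shows "linear (\<lambda>x. dd w (T x) z)"
proof (rule linearI)
  show "dd w (T (a + b)) z = dd w (T a) z + dd w (T b) z" for a b
    unfolding dd_add[OF T T, symmetric] by (rule dd_transform[OF K z]) (rule linear_add[OF lin])
  show "dd w (T (r *\<^sub>R a)) z = r *\<^sub>R dd w (T a) z" for r a
    unfolding dd_bounded_linear[OF bounded_linear_scaleR_right T, symmetric]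
    by (rule dd_transform[OF K z]) (rule linear_cmul[OF lin])
qed

text \<open>Prepending a vector takes one more derivative, as in the third clause of
  \<open>higher_derivs_on\<close>, so \<open>iter_dd h vs z\<close> is directly a candidate for
  \<open>D k z vs\<close>.\<close>

primrec iter_dd :: "('a::real_normed_vector \<Rightarrow> 'b::real_normed_vector) \<Rightarrow> 'a list \<Rightarrow> 'a \<Rightarrow> 'b" where
  "iter_dd h [] = h"
| "iter_dd h (v # vs) = dd v (iter_dd h vs)"

lemma Cb_iter_dd:
  assumes "\<And>u. Cb j K (dd u h)" "length vs + s = Suc j" "vs \<noteq> []"
  shows "Cb s K (iter_dd h vs)"
  using assms(2,3)
proof (induction vs arbitrary: s)
  case (Cons v vs)
  show ?case
  proof (cases "vs = []")
    case True
    thus ?thesis using Cons.prems assms(1) by simp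
  next
    case False
    hence "Cb (Suc s) K (iter_dd h vs)" using Cons.prems by (intro Cons.IH) auto
    thus ?thesis by simp
  qed
qed simp

text \<open>Linear in the head because a derivative is linear in its direction; in the other slots
  because differentiating in \<open>z\<close> preserves linearity in a parameter.\<close>

lemma multilin_iter_dd:
  fixes h :: "'a::real_normed_vector \<Rightarrow> 'b::real_normed_vector"
  assumes K: "open K" and d: "\<And>vs z. length vs < k \<Longrightarrow> z \<in> K \<Longrightarrow> iter_dd h vs differentiable (at z)"
    and z: "z \<in> K"
  shows "multilin k (\<lambda>vs. iter_dd h vs z)"
  using d z
proof (induction k arbitrary: z)
  case 0
  then show ?case by (simp add: multilin_def)
next
  case (Suc k)
  have IH: "multilin k (\<lambda>vs. iter_dd h vs z)" if "z \<in> K" for z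
    by (rule Suc.IH[OF Suc.prems(1) that]) auto
  show ?case
    unfolding multilin_def
  proof (intro allI impI)
    fix i :: nat and vs :: "'a list" assume i: "i < Suc k" and l: "length vs = Suc k"
    then obtain w ws where vs: "vs = w # ws" and lw: "length ws = k" by (auto simp: length_Suc_conv)
    show "linear (\<lambda>v. iter_dd h (vs[i := v]) z)"
    proof (cases i)
      case 0
      thus ?thesis using linear_dd[OF Suc.prems(1)[of ws z]] lw Suc.prems(2) by (simp add: vs)
    next
      case (Suc j)
      have "linear (\<lambda>x. dd w (iter_dd h (ws[j := x])) z)"
        using Suc i lw
        by (intro linear_dd_param[OF K Suc.prems(2)] multilin_linear[OF IH] Suc.prems(1)) (auto simp: Suc.prems)
      thus ?thesis by (simp add: vs Suc)
    qed
  qed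
qed

text \<open>The new order of smoothness is known only for the top derivatives and is passed down to
  the lower ones, by induction on the number of derivatives still to be taken. \<open>C1b\<close>
  lacks a bound on the function itself; that bound comes from the old order.\<close>

lemma Cb_Suc_from_top:
  assumes "\<And>u. Cb j K (dd u h)"
    and top: "\<And>vs. length vs = Suc j \<Longrightarrow> C1b K (iter_dd h vs)"
  shows "Cb (Suc j) K (dd u h)"
proof -
  have "Cb (Suc s) K (iter_dd h vs)" if "length vs + s = Suc j" "vs \<noteq> []" for vs s
    using that
  proof (induction s arbitrary: vs)
    case 0
    hence "Cb 0 K (iter_dd h vs)" by (intro Cb_iter_dd[OF assms(1)]) auto
    thus ?case using top[of vs] 0 by (auto simp: C1b_def)
  next
    case (Suc s)
    have "Cb (Suc s) K (iter_dd h (v # vs))" for v by (rule Suc.IH) (use Suc.prems in auto)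
    moreover have "Cb (Suc s) K (iter_dd h vs)" using Suc.prems by (intro Cb_iter_dd[OF assms(1)]) auto
    ultimately show ?case by simp
  qed
  from this[of "[u]" j] show ?thesis by simp
qed

text \<open>Here $\gamma$ stands for $\|D_a g\|$.\<close>

locale invariant_graph =
  fixes K :: "'a::euclidean_space set" and h :: "'a \<Rightarrow> 'b::euclidean_space"
    and f :: "'b \<times> 'a \<Rightarrow> 'b" and g :: "'b \<times> 'a \<Rightarrow> 'a" and U :: "('b \<times> 'a) set"
    and \<alpha> ell \<gamma> :: "'b \<times> 'a \<Rightarrow> real" and \<eta> c :: real and r :: nat
  assumes r: "2 \<le> r" and K: "open K" "convex K"
    and h_diff: "\<And>z. z \<in> K \<Longrightarrow> h differentiable (at z)"
    and h_C1: "\<And>u. Cb 0 K (dd u h)"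
    and \<eta>: "0 < \<eta>" and h_bound: "\<And>z u. z \<in> K \<Longrightarrow> norm (dd u h z) \<le> \<eta> * norm u"
    and U: "open U" and graph: "\<And>z. z \<in> K \<Longrightarrow> (h z, z) \<in> U"
    and f_diff: "\<And>x. x \<in> U \<Longrightarrow> f differentiable (at x)" and f_Cr: "\<And>\<xi>. Cb (r - 1) U (dd \<xi> f)"
    and g_diff: "\<And>x. x \<in> U \<Longrightarrow> g differentiable (at x)" and g_Cr: "\<And>\<xi>. Cb (r - 1) U (dd \<xi> g)"
    and \<alpha>_cont: "continuous_on U \<alpha>" and ell_cont: "continuous_on U ell" and \<gamma>_cont: "continuous_on U \<gamma>"
    and ell_nonneg: "\<And>x. x \<in> U \<Longrightarrow> 0 \<le> ell x" and \<gamma>_nonneg: "\<And>x. x \<in> U \<Longrightarrow> 0 \<le> \<gamma> x"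
    and c: "0 < c"
    and A_lower: "\<And>x a. x \<in> U \<Longrightarrow> \<alpha> x * (norm a)\<^sup>2 \<le> a \<bullet> dd (a, 0) f x"
    and E_upper: "\<And>x v. x \<in> U \<Longrightarrow> v \<bullet> dd (0, v) g x \<le> ell x * (norm v)\<^sup>2"
    and C_bound: "\<And>x a. x \<in> U \<Longrightarrow> norm (dd (a, 0) g x) \<le> \<gamma> x * norm a"
    and gap: "\<And>x. x \<in> U \<Longrightarrow> real r * ell x + (real r + 1) * \<eta> * \<gamma> x + c \<le> \<alpha> x"
    and ex_traj: "\<And>z. z \<in> K \<Longrightarrow> \<exists>\<zeta>. \<zeta> 0 = z \<and> traj K (\<lambda>z. g (h z, z)) \<zeta>"
    and h_flow: "flow_deriv K (\<lambda>z. g (h z, z)) h (\<lambda>z. f (h z, z))"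
begin

definition H :: "'a \<Rightarrow> 'b \<times> 'a" where "H z = (h z, z)"
definition G :: "'a \<Rightarrow> 'a" where "G z = g (H z)"
text \<open>The tangent vector of the graph over \<open>u\<close>, that is, the derivative of
  \<open>H\<close> in direction \<open>u\<close>.\<close>

definition \<xi> :: "'a \<Rightarrow> 'a \<Rightarrow> 'b \<times> 'a" where "\<xi> u z = (dd u h z, u)"

lemma HU: "z \<in> K \<Longrightarrow> H z \<in> U" using graph by (simp add: H_def)

lemma H_diff: "z \<in> K \<Longrightarrow> H differentiable (at z)" and dd_H: "z \<in> K \<Longrightarrow> dd u H z = \<xi> u z"
proof -
  assume z: "z \<in> K"
  have "(H has_derivative (\<lambda>u. \<xi> u z)) (at z)"
    unfolding H_def[abs_def] \<xi>_def by (intro has_derivative_Pair has_derivative_dd h_diff z has_derivative_ident)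
  thus "H differentiable (at z)" "dd u H z = \<xi> u z" by (auto intro: differentiableI dd_eq)
qed

lemma Cb_\<xi>: assumes "\<And>u. Cb s K (dd u h)" shows "Cb s K (\<xi> u)"
proof -
  have "Cb s K (\<lambda>z. (dd u h z, 0) + (0, u))"
    by (intro Cb_add[OF K(1)] Cb_const Cb_bounded_linear[OF _ K(1) assms] bounded_linear_Pair bounded_linear_ident bounded_linear_zero)
  thus ?thesis by (simp add: \<xi>_def[abs_def])
qed

text \<open>One order more than \<open>dd u h\<close> has: the first derivative of the composite
  involves no higher derivative of \<open>h\<close> than \<open>dd u h\<close>.\<close>

lemma Cb_comp_H:
  assumes "\<And>u. Cb j K (dd u h)" "Cb s U F" "s \<le> Suc j"
  shows "Cb s K (\<lambda>z. F (H z))"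
proof (rule Cb_compose[OF K(1) _ H_diff _ assms(2)])
  show "H ` K \<subseteq> U" using HU by auto
  show "Cb (s - 1) K (dd u H)" if "s \<noteq> 0" for u
    by (rule Cb_cong[OF K(1) _ Cb_le[OF Cb_\<xi>[OF assms(1)]]]) (use dd_H assms(3) in auto)
qed

lemma dd_comp_H: "z \<in> K \<Longrightarrow> F differentiable (at (H z)) \<Longrightarrow> dd u (\<lambda>z. F (H z)) z = dd (\<xi> u z) F (H z)"
  using dd_compose[OF H_diff] dd_H by metis

lemma G_diff: "z \<in> K \<Longrightarrow> G differentiable (at z)"
  unfolding G_def[abs_def] using differentiable_chain_at[OF H_diff g_diff[OF HU]] by (simp add: o_def)

lemma dd_G: "z \<in> K \<Longrightarrow> dd u G z = dd (\<xi> u z) g (H z)"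
  unfolding G_def[abs_def] by (rule dd_comp_H) (auto intro: g_diff HU)

lemma lin_fH: "z \<in> K \<Longrightarrow> linear (\<lambda>x. dd x f (H z))" and lin_gH: "z \<in> K \<Longrightarrow> linear (\<lambda>x. dd x g (H z))"
  using linear_dd f_diff g_diff HU by blast+

lemma lin_h: "z \<in> K \<Longrightarrow> linear (\<lambda>x. dd x h z)"
  using linear_dd h_diff by blast

lemma Cb_fH: "(\<And>u. Cb j K (dd u h)) \<Longrightarrow> s \<le> r - 1 \<Longrightarrow> s \<le> Suc j \<Longrightarrow> Cb s K (\<lambda>z. dd a f (H z))"
  and Cb_gH: "(\<And>u. Cb j K (dd u h)) \<Longrightarrow> s \<le> r - 1 \<Longrightarrow> s \<le> Suc j \<Longrightarrow> Cb s K (\<lambda>z. dd a g (H z))"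
  using Cb_comp_H Cb_le f_Cr g_Cr by blast+

lemma Cb_dd_G:
  assumes "\<And>u. Cb j K (dd u h)" "s \<le> r - 1" "s \<le> j"
  shows "Cb s K (dd u G)"
proof (rule Cb_cong[OF K(1)])
  show "Cb s K (\<lambda>z. dd (\<xi> u z) g (H z))"
    by (rule Cb_lin_field[OF K(1) lin_gH]) (use assms in \<open>auto intro!: Cb_gH[OF assms(1)] Cb_le[OF Cb_\<xi>[OF assms(1)]]\<close>)
qed (simp add: dd_G)

lemma Cb_dd_fH:
  assumes "\<And>u. Cb j K (dd u h)" "s \<le> r - 1" "s \<le> j"
  shows "Cb s K (dd u (\<lambda>z. f (H z)))"
proof (rule Cb_cong[OF K(1)])
  show "Cb s K (\<lambda>z. dd (\<xi> u z) f (H z))"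
    by (rule Cb_lin_field[OF K(1) lin_fH]) (use assms in \<open>auto intro!: Cb_fH[OF assms(1)] Cb_le[OF Cb_\<xi>[OF assms(1)]]\<close>)
qed (simp add: dd_comp_H f_diff HU)

lemma C1b_h: "C1b K h" using h_diff h_C1 by (simp add: C1b_def)

lemma C1b_G: "C1b K G"
  unfolding C1b_def using G_diff Cb_dd_G[OF h_C1, of 0] by simp

lemma C1b_fH: "C1b K (\<lambda>z. f (H z))"
  unfolding C1b_def
  using differentiable_chain_at[OF H_diff f_diff[OF HU]] Cb_dd_fH[OF h_C1, of 0] by (simp add: o_def)

lemma ex_traj': "z \<in> K \<Longrightarrow> \<exists>\<zeta>. \<zeta> 0 = z \<and> traj K G \<zeta>"
  using ex_traj by (simp add: G_def[abs_def] H_def)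

lemma h_flow': "flow_deriv K G h (\<lambda>z. f (H z))"
  using h_flow by (simp add: G_def[abs_def] H_def)

text \<open>\<open>lam\<close> bounds the growth of \<open>DG = D_z g + D_a g Dh\<close> from above
  and \<open>bet\<close> bounds \<open>D_a f - Dh D_a g\<close> from below, with \<open>Dh\<close>
  estimated by \<open>\<eta>\<close> in both.\<close>

definition lam where "lam z = ell (H z) + \<eta> * \<gamma> (H z)"
definition bet where "bet z = \<alpha> (H z) - \<eta> * \<gamma> (H z)"

lemma H_cont: "continuous_on K H"
  by (meson H_diff continuous_at_imp_continuous_on differentiable_imp_continuous_within)

lemma comp_H_cont: "continuous_on U F \<Longrightarrow> continuous_on K (\<lambda>z. F (H z))"
  using continuous_on_compose2[OF _ H_cont] HU by blast

lemma lam_bet_cont: "continuous_on K lam" "continuous_on K bet"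
  unfolding lam_def[abs_def] bet_def[abs_def]
  by (intro continuous_intros comp_H_cont \<alpha>_cont ell_cont \<gamma>_cont)+

lemma lam_nonneg: "z \<in> K \<Longrightarrow> 0 \<le> lam z"
  using ell_nonneg[OF HU] \<gamma>_nonneg[OF HU] \<eta> by (simp add: lam_def)

text \<open>Counting the copies of \<open>\<eta> * \<gamma>\<close>: \<open>lam\<close> brings
  \<open>k + 1\<close> of them and \<open>bet\<close> lacks one, and
  \<open>k + 2 \<le> r + 1\<close>.\<close>

lemma spectral_gap:
  assumes "k + 1 \<le> r" "z \<in> K"
  shows "(real k + 1) * lam z + c \<le> bet z"
proof -
  have "(real k + 1) * ell (H z) \<le> real r * ell (H z)"
    using ell_nonneg[OF HU] assms by (intro mult_right_mono) auto
  moreover have "(real k + 2) * (\<eta> * \<gamma> (H z)) \<le> (real r + 1) * (\<eta> * \<gamma> (H z))"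
    using \<gamma>_nonneg[OF HU] \<eta> assms by (intro mult_right_mono) auto
  ultimately show ?thesis using gap[OF HU[OF assms(2)]] by (simp add: lam_def bet_def algebra_simps)
qed

lemma \<xi>_norm: "z \<in> K \<Longrightarrow> norm (\<xi> u z) \<le> (\<eta> + 1) * norm u"
  using norm_Pair_le[of "dd u h z" u] h_bound[of z u] by (simp add: \<xi>_def distrib_right)

text \<open>\<open>DG\<close> is only continuous, since it contains \<open>Dh\<close>, so a
  Lipschitz error in \<open>y - z\<close> cannot come from \<open>G\<close> being smoother. Only
  \<open>Dg\<close> is moved from \<open>H y\<close> to \<open>H z\<close>, which is Lipschitz;
  \<open>Dh\<close> stays at \<open>y\<close>, where its norm is bounded by \<open>\<eta>\<close>
  just as well.\<close>

lemma G_growth: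
  obtains Lm where "0 \<le> Lm"
    "\<And>y z v. y \<in> K \<Longrightarrow> z \<in> K \<Longrightarrow> v \<bullet> dd v G y \<le> (lam z + Lm * norm (y - z)) * (norm v)\<^sup>2"
proof -
  have "\<exists>M. sd K (\<lambda>y z. dd b g (H y) - dd b g (H z)) M" for b
    using r by (intro sd_C1b[OF K Cb_imp_C1b[OF Cb_gH[OF h_C1, of 1]]]) auto
  then obtain M where M: "\<And>b. sd K (\<lambda>y z. dd b g (H y) - dd b g (H z)) (M b)" by metis
  define Lm where "Lm = sum M Basis * (\<eta> + 1)"
  have sM: "0 \<le> sum M Basis" by (intro sum_nonneg sd_nonneg[OF M])
  show ?thesis
  proof (rule that[of Lm])
    show "0 \<le> Lm" using sM \<eta> by (simp add: Lm_def)
    fix y z v assume y: "y \<in> K" and z: "z \<in> K"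
    let ?x = "\<xi> v y"
    have "norm (dd ?x g (H y) - dd ?x g (H z)) \<le> (\<Sum>b\<in>Basis. norm (dd b g (H y) - dd b g (H z))) * norm ?x"
      by (intro linear_norm_bound linear_compose_sub lin_gH y z)
    also have "\<dots> \<le> (\<Sum>b\<in>Basis. M b * norm (y - z)) * ((\<eta> + 1) * norm v)"
      by (intro mult_mono sum_mono sd_lipschitz[OF M] z y \<xi>_norm sum_nonneg mult_nonneg_nonneg sd_nonneg[OF M]) auto
    also have "\<dots> = Lm * norm (y - z) * norm v" by (simp add: Lm_def sum_distrib_right[symmetric])
    finally have "norm v * norm (dd ?x g (H y) - dd ?x g (H z)) \<le> norm v * (Lm * norm (y - z) * norm v)"
      by (intro mult_left_mono) auto
    hence 1: "v \<bullet> (dd ?x g (H y) - dd ?x g (H z)) \<le> Lm * norm (y - z) * (norm v)\<^sup>2"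
      using norm_cauchy_schwarz[of v "dd ?x g (H y) - dd ?x g (H z)"] by (simp add: power2_eq_square mult_ac)
    have "?x = (dd v h y, 0) + (0, v)" by (simp add: \<xi>_def)
    hence 2: "dd ?x g (H z) = dd (dd v h y, 0) g (H z) + dd (0, v) g (H z)"
      using linear_add[OF lin_gH[OF z]] by metis
    have "norm (dd (dd v h y, 0) g (H z)) \<le> \<gamma> (H z) * norm (dd v h y)" by (rule C_bound[OF HU[OF z]])
    also have "\<dots> \<le> \<gamma> (H z) * (\<eta> * norm v)" by (intro mult_left_mono h_bound y \<gamma>_nonneg HU z)
    finally have "norm v * norm (dd (dd v h y, 0) g (H z)) \<le> norm v * (\<gamma> (H z) * (\<eta> * norm v))"
      by (intro mult_left_mono) auto
    hence 3: "v \<bullet> dd (dd v h y, 0) g (H z) \<le> \<eta> * \<gamma> (H z) * (norm v)\<^sup>2"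
      using norm_cauchy_schwarz[of v "dd (dd v h y, 0) g (H z)"] by (simp add: power2_eq_square mult_ac)
    have "dd v G y = dd ?x g (H z) + (dd ?x g (H y) - dd ?x g (H z))" using dd_G[OF y] by simp
    hence "v \<bullet> dd v G y = v \<bullet> dd ?x g (H z) + v \<bullet> (dd ?x g (H y) - dd ?x g (H z))"
      by (simp only: inner_add_right)
    also have "\<dots> \<le> (lam z + Lm * norm (y - z)) * (norm v)\<^sup>2"
      using 1 3 E_upper[OF HU[OF z], of v] by (simp add: 2 lam_def inner_add_right distrib_right)
    finally show "v \<bullet> dd v G y \<le> (lam z + Lm * norm (y - z)) * (norm v)\<^sup>2" .
  qed
qed

definition Lt :: "'a \<Rightarrow> 'a \<Rightarrow> 'b \<Rightarrow> 'b" where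
  "Lt y' y w = dd (w, 0) f (H y) - dd (dd (w, 0) g (H y)) h y'"

lemma linear_inl: "linear (\<lambda>w. (w, 0))" by (simp add: linear_iff)

lemma Lt_lin: assumes "y \<in> K" "y' \<in> K" shows "linear (Lt y' y)"
  unfolding Lt_def[abs_def]
  using linear_compose[OF linear_inl lin_fH[OF assms(1)]]
    linear_compose[OF linear_compose[OF linear_inl lin_gH[OF assms(1)]] lin_h[OF assms(2)]]
  by (intro linear_compose_sub) (simp_all add: o_def)

lemma Lt_coercive: assumes y: "y \<in> K" and y': "y' \<in> K" shows "bet y * (norm w)\<^sup>2 \<le> w \<bullet> Lt y' y w"
proof -
  have "norm (dd (dd (w, 0) g (H y)) h y') \<le> \<eta> * norm (dd (w, 0) g (H y))" by (rule h_bound[OF y'])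
  also have "\<dots> \<le> \<eta> * (\<gamma> (H y) * norm w)" using \<eta> by (intro mult_left_mono C_bound HU y) auto
  finally have "norm w * norm (dd (dd (w, 0) g (H y)) h y') \<le> norm w * (\<eta> * (\<gamma> (H y) * norm w))" by (intro mult_left_mono) auto
  hence "w \<bullet> dd (dd (w, 0) g (H y)) h y' \<le> \<eta> * \<gamma> (H y) * (norm w)\<^sup>2"
    using norm_cauchy_schwarz[of w "dd (dd (w, 0) g (H y)) h y'"] by (simp add: power2_eq_square mult_ac)
  thus ?thesis using A_lower[OF HU[OF y], of w] by (simp add: Lt_def bet_def inner_diff_right left_diff_distrib)
qed

lemma Lt_cont:
  assumes z: "z \<in> K" and e: "0 < e"
  shows "\<exists>d>0. close_maps K Lt e (ball z d)"
proof -
  define e' where "e' = e / (2 * real DIM('b))"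
  have e': "0 < e'" using e by (simp add: e'_def)
  have fc: "continuous_on K (\<lambda>z. dd x f (H z))" and gc: "continuous_on K (\<lambda>z. dd x g (H z))" for x
    using Cb_continuous[OF Cb_fH[OF h_C1, of 0]] Cb_continuous[OF Cb_gH[OF h_C1, of 0]] by auto
  have hc: "continuous_on K (dd u h)" for u using h_C1 by simp
  have cont: "continuous_on (K \<times> K) (\<lambda>x. Lt (fst x) (snd x) b)" for b
  proof (rule continuous_on_eq)
    have "continuous_on (K \<times> K) (\<lambda>x. dd v f (H (snd x)))" for v
      by (rule continuous_on_compose2[OF fc continuous_on_snd]) (auto intro: continuous_on_id)
    moreover have "continuous_on (K \<times> K) (\<lambda>x. dd v g (H (snd x)))" for v
      by (rule continuous_on_compose2[OF gc continuous_on_snd]) (auto intro: continuous_on_id)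
    moreover have "continuous_on (K \<times> K) (\<lambda>x. dd d h (fst x))" for d
      by (rule continuous_on_compose2[OF hc continuous_on_fst]) (auto intro: continuous_on_id)
    ultimately show "continuous_on (K \<times> K) (\<lambda>x. dd (b, 0) f (H (snd x)) - (\<Sum>d\<in>Basis. (dd (b, 0) g (H (snd x)) \<bullet> d) *\<^sub>R dd d h (fst x)))"
      by (intro continuous_intros) auto
    show "dd (b, 0) f (H (snd x)) - (\<Sum>d\<in>Basis. (dd (b, 0) g (H (snd x)) \<bullet> d) *\<^sub>R dd d h (fst x)) = Lt (fst x) (snd x) b"
      if "x \<in> K \<times> K" for x
      unfolding Lt_def using that by (subst linear_expand[OF lin_h, of "fst x" "dd (b, 0) g (H (snd x))"]) auto
  qed
  let ?P = "\<lambda>b d. \<forall>y\<in>ball z d \<inter> K. \<forall>y'\<in>ball z d \<inter> K. dist (Lt y' y b) (Lt z z b) < e'"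
  have "\<exists>d>0. \<forall>b\<in>Basis. ?P b d"
  proof (rule finite_min_radius)
    fix b :: 'b
    obtain d where d: "0 < d" "\<And>x. x \<in> K \<times> K \<Longrightarrow> dist x (z, z) < d \<Longrightarrow> dist (Lt (fst x) (snd x) b) (Lt z z b) < e'"
      using cont[of b] z e' unfolding continuous_on_iff by (metis SigmaI fst_conv snd_conv)
    show "\<exists>d>0. ?P b d"
    proof (intro exI[of _ "d / 2"] conjI ballI)
      fix y y' assume m: "y \<in> ball z (d/2) \<inter> K" "y' \<in> ball z (d/2) \<inter> K"
      have "norm (y' - z, y - z) \<le> norm (y' - z) + norm (y - z)" by (rule norm_Pair_le)
      also have "\<dots> < d" using m by (simp add: dist_norm norm_minus_commute)
      finally show "dist (Lt y' y b) (Lt z z b) < e'" using d(2)[of "(y', y)"] m by (simp add: dist_norm)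
    qed (use d in simp)
  next
    fix b and d d' :: real assume P: "?P b d" and "d' \<le> d"
    hence "ball z d' \<inter> K \<subseteq> ball z d \<inter> K" by auto
    thus "?P b d'" using P by blast
  qed simp
  then obtain d where d: "0 < d" "\<And>b. b \<in> Basis \<Longrightarrow> ?P b d" by blast
  show ?thesis
  proof (intro exI[of _ d] conjI d(1) ballI allI)
    fix y y' x x' w assume m: "y \<in> ball z d \<inter> K" "y' \<in> ball z d \<inter> K" "x \<in> ball z d \<inter> K" "x' \<in> ball z d \<inter> K"
    have "norm (Lt y' y w - Lt x' x w) \<le> (\<Sum>b\<in>Basis. norm (Lt y' y b - Lt x' x b)) * norm w"
      using m by (intro linear_norm_bound linear_compose_sub Lt_lin) auto
    also have "\<dots> \<le> (\<Sum>b\<in>(Basis::'b set). 2 * e') * norm w"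
    proof (intro mult_right_mono sum_mono)
      fix b :: 'b assume b: "b \<in> Basis"
      have "dist (Lt y' y b) (Lt x' x b) \<le> dist (Lt y' y b) (Lt z z b) + dist (Lt x' x b) (Lt z z b)" by (rule dist_triangle2)
      moreover have "dist (Lt y' y b) (Lt z z b) < e'" "dist (Lt x' x b) (Lt z z b) < e'" using d(2)[OF b] m by blast+
      ultimately show "norm (Lt y' y b - Lt x' x b) \<le> 2 * e'" by (simp add: dist_norm)
    qed simp
    also have "(\<Sum>b\<in>(Basis::'b set). 2 * e') = e" by (simp add: e'_def)
    finally show "norm (Lt y' y w - Lt x' x w) \<le> e * norm w" .
  qed
qed

section \<open>Derivatives of the graph function as hyperbolic sections\<close>

lemma iter_dd_differentiable:
  assumes "\<And>u. Cb j K (dd u h)" "length vs \<le> j" "z \<in> K"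
  shows "iter_dd h vs differentiable (at z)"
proof (cases "vs = []")
  case False
  have "Cb (Suc j - length vs) K (iter_dd h vs)" using assms False by (intro Cb_iter_dd[OF assms(1)]) auto
  thus ?thesis using assms by (intro Cb_differentiable[OF _ _ assms(3)]) auto
qed (use h_diff assms in simp)

lemma multilin_iter_dd_h:
  assumes "\<And>u. Cb j K (dd u h)" "k \<le> Suc j" "z \<in> K"
  shows "multilin k (\<lambda>vs. iter_dd h vs z)"
  by (rule multilin_iter_dd[OF K(1) iter_dd_differentiable[OF assms(1)] assms(3)]) (use assms in auto)

lemma iter_dd_bound:
  assumes hl: "\<And>u. Cb j K (dd u h)"
  obtains S where "0 \<le> S" "\<And>z vs. z \<in> K \<Longrightarrow> length vs = Suc j \<Longrightarrow> norm (iter_dd h vs z) \<le> S * prod_list (map norm vs)"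
proof -
  have "\<exists>B. 0 \<le> B \<and> (length vs = Suc j \<longrightarrow> (\<forall>z\<in>K. norm (iter_dd h vs z) \<le> B))" for vs
  proof (cases "length vs = Suc j")
    case True
    have "Cb 0 K (iter_dd h vs)" using True by (intro Cb_iter_dd[OF hl]) auto
    then obtain B where "\<forall>z\<in>K. norm (iter_dd h vs z) \<le> B" by (auto simp: bounded_iff)
    thus ?thesis by (intro exI[of _ "\<bar>B\<bar>"]) fastforce
  qed (auto intro: exI[of _ 0])
  then obtain B where B: "\<And>vs. 0 \<le> B vs" "\<And>vs z. length vs = Suc j \<Longrightarrow> z \<in> K \<Longrightarrow> norm (iter_dd h vs z) \<le> B vs" by metis
  show ?thesis
  proof (rule that[of "sum B (basis_lists (Suc j))"])
    show "0 \<le> sum B (basis_lists (Suc j))" by (intro sum_nonneg B(1))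
    show "norm (iter_dd h vs z) \<le> sum B (basis_lists (Suc j)) * prod_list (map norm vs)" if "z \<in> K" "length vs = Suc j" for z vs
      by (rule multilin_norm_le[OF multilin_iter_dd_h[OF hl order_refl that(1)] that(2)])
         (use B(2) that in \<open>auto simp: basis_lists_def\<close>)
  qed
qed

text \<open>The order of the derivative is \<open>k = Suc j\<close>, so \<open>j + 2 \<le> r\<close>
  is the condition \<open>k + 1 \<le> r\<close> under which the spectral gap holds.\<close>

lemma section_smooth:
  assumes hl: "\<And>u. Cb j K (dd u h)" and j: "j + 2 \<le> r"
    and flow: "\<And>vs. length vs = Suc j \<Longrightarrow> flow_deriv K G (iter_dd h vs) (\<lambda>z. N z vs)"
    and N_diff: "\<And>y y' vs. y \<in> K \<Longrightarrow> y' \<in> K \<Longrightarrow> length vs = Suc j \<Longrightarrow>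
      N y' vs - N y vs = LL y' y (iter_dd h vs y' - iter_dd h vs y)
        - (\<Sum>i<Suc j. iter_dd h (vs[i := dd (vs ! i) G y]) y' - iter_dd h (vs[i := dd (vs ! i) G y]) y) + Err y' y vs"
    and LL: "\<And>y y'. y \<in> K \<Longrightarrow> y' \<in> K \<Longrightarrow> linear (LL y' y)"
      "\<And>y y' w. y \<in> K \<Longrightarrow> y' \<in> K \<Longrightarrow> bet y * (norm w)\<^sup>2 \<le> w \<bullet> LL y' y w"
      "\<And>z e. z \<in> K \<Longrightarrow> 0 < e \<Longrightarrow> \<exists>d>0. close_maps K LL e (ball z d)"
    and Err_sd: "\<And>vs. length vs = Suc j \<Longrightarrow> \<exists>M. sd K (\<lambda>y' y. Err y' y vs) M"
    and vs: "length vs = Suc j"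
  shows "C1b K (iter_dd h vs)"
proof -
  obtain S where S: "0 \<le> S" "\<And>z vs. z \<in> K \<Longrightarrow> length vs = Suc j \<Longrightarrow> norm (iter_dd h vs z) \<le> S * prod_list (map norm vs)"
    by (rule iter_dd_bound[OF hl], rule that)
  obtain Lm where Lm: "0 \<le> Lm" "\<And>y z v. y \<in> K \<Longrightarrow> z \<in> K \<Longrightarrow> v \<bullet> dd v G y \<le> (lam z + Lm * norm (y - z)) * (norm v)\<^sup>2"
    by (rule G_growth, rule that)
  interpret sec: hyperbolic_section K G lam bet c Lm S "Suc j" "\<lambda>z vs. iter_dd h vs z" N LL Err
  proof (rule hyperbolic_section.intro)
    show "(real (Suc j) + 1) * lam z + c \<le> bet z" if "z \<in> K" for z
      by (rule spectral_gap[OF _ that]) (use j in simp)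
  qed (fact K ex_traj' C1b_G lam_bet_cont lam_nonneg c Lm S flow N_diff LL Err_sd
        multilin_iter_dd_h[OF hl order_refl])+
  show ?thesis by (rule sec.section_C1b[OF vs])
qed

lemma ex_sd_cong: 
  "(\<And>y y'. y \<in> K \<Longrightarrow> y' \<in> K \<Longrightarrow> \<Delta> y' y = \<Delta>' y' y) \<Longrightarrow> \<exists>M. sd K \<Delta> M \<Longrightarrow> \<exists>M. sd K \<Delta>' M"
  using sd_cong by blast

text \<open>The increment is taken of the field alone, with the argument frozen at
  \<open>X y'\<close>. Hence \<open>X\<close> may be merely continuous; in the applications it
  contains the highest derivative of \<open>h\<close> known so far.\<close>

lemma sd_lin_left:
  fixes T :: "'x::euclidean_space \<Rightarrow> 'a \<Rightarrow> 'c::real_normed_vector"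
  assumes lin: "\<And>z. z \<in> K \<Longrightarrow> linear (\<lambda>x. T x z)" and T: "\<And>b. C1b K (T b)" and X: "Cb 0 K X"
  shows "\<exists>M. sd K (\<lambda>y' y. T (X y') y' - T (X y') y) M"
proof (rule ex_sd_cong)
  show "\<exists>M. sd K (\<lambda>y' y. \<Sum>b\<in>Basis. (X y' \<bullet> b) *\<^sub>R (T b y' - T b y)) M"
    by (intro ex_sd_sum ex_sd_scaleR[OF K(1)] sd_C1b[OF K T] Cb_bounded_linear[OF bounded_linear_inner_left K(1) X]) auto
  show "(\<Sum>b\<in>Basis. (X y' \<bullet> b) *\<^sub>R (T b y' - T b y)) = T (X y') y' - T (X y') y" if "y \<in> K" "y' \<in> K" for y y'
    by (rule linear_expand[symmetric]) (intro linear_compose_sub lin that)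
qed

text \<open>Complementary to \<open>sd_lin_left\<close>: the first-order smallness sits in the
  argument \<open>\<Delta>\<close>, so the field, here a derivative of \<open>h\<close> of top
  order, need only be continuous and bounded.\<close>

lemma sd_lin_right:
  fixes T :: "'x::euclidean_space \<Rightarrow> 'a \<Rightarrow> 'c::real_normed_vector"
  assumes lin: "\<And>z. z \<in> K \<Longrightarrow> linear (\<lambda>x. T x z)" and T: "\<And>b. Cb 0 K (T b)" and \<Delta>: "\<exists>M. sd K \<Delta> M"
  shows "\<exists>M. sd K (\<lambda>y' y. T (\<Delta> y' y) y') M"
proof (rule ex_sd_cong)
  obtain M where M: "sd K \<Delta> M" using \<Delta> ..
  have *: "\<exists>M. sd K (\<lambda>y' y. \<Delta> y' y \<bullet> b) M" for b
    using sd_prod[OF bounded_bilinear_inner K(1) M Cb_const[of 0 K b]] by (simp add: inner_commute)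
  show "\<exists>M. sd K (\<lambda>y' y. \<Sum>b\<in>Basis. (\<Delta> y' y \<bullet> b) *\<^sub>R T b y') M"
    by (intro ex_sd_sum ex_sd_scaleR_flip[OF K(1)] T *) auto
  show "(\<Sum>b\<in>Basis. (\<Delta> y' y \<bullet> b) *\<^sub>R T b y') = T (\<Delta> y' y) y'" if "y \<in> K" "y' \<in> K" for y y'
    by (rule linear_expand[symmetric]) (intro lin that)
qed

lemma C1b_fgH: "C1b K (\<lambda>z. dd b f (H z))" "C1b K (\<lambda>z. dd b g (H z))"
  using r Cb_imp_C1b[OF Cb_fH[OF h_C1, of 1]] Cb_imp_C1b[OF Cb_gH[OF h_C1, of 1]] by auto

lemma flow_first: "flow_deriv K G (dd u h) (\<lambda>z. dd u (\<lambda>z. f (H z)) z - dd (dd u G z) h z)"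
  by (rule flow_deriv_dd[OF K(1) ex_traj' C1b_G C1b_h C1b_fH h_flow'])

text \<open>Two base points in $L$ absorb the quadratic term $Dh\,D_a g\,Dh$ of the Riccati equation for $Dh$.\<close>

lemma first_smooth: "C1b K (dd u h)"
proof -
  define N where "N z vs = dd (hd vs) (\<lambda>z. f (H z)) z - dd (dd (hd vs) G z) h z" for z and vs :: "'a list"
  \<comment> \<open>In both brackets only the base point of \<open>Df\<close> and \<open>Dg\<close>
    moves, while \<open>\<xi>\<close> and \<open>Dh\<close> are frozen at \<open>y'\<close>. Every
    increment of \<open>Dh\<close> is thereby left to the principal terms.\<close>
  define Err where "Err y' y vs = (dd (\<xi> (hd vs) y') f (H y') - dd (\<xi> (hd vs) y') f (H y))
      - dd (dd (\<xi> (hd vs) y') g (H y') - dd (\<xi> (hd vs) y') g (H y)) h y'" for y' y and vs :: "'a list"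
  have "C1b K (iter_dd h [u])"
  proof (rule section_smooth[where j = 0 and N = N and Err = Err and LL = Lt, OF h_C1 _ _ _ Lt_lin Lt_coercive Lt_cont])
    show "0 + 2 \<le> r" using r by simp
    show "length [u] = Suc 0" by simp
    fix vs :: "'a list" assume "length vs = Suc 0"
    then obtain w where vs: "vs = [w]" by (auto simp: length_Suc_conv)
    show "flow_deriv K G (iter_dd h vs) (\<lambda>z. N z vs)" using flow_first by (simp add: vs N_def)
    show "\<exists>M. sd K (\<lambda>y' y. Err y' y vs) M"
      unfolding Err_def vs list.sel
      by (intro ex_sd_diff sd_lin_right[OF lin_h h_C1] sd_lin_left[OF lin_fH] sd_lin_left[OF lin_gH] C1b_fgH Cb_\<xi> h_C1)
    fix y y' assume y: "y \<in> K" and y': "y' \<in> K"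
    have fN: "dd w (\<lambda>z. f (H z)) z = dd (\<xi> w z) f (H z)" if "z \<in> K" for z
      by (rule dd_comp_H[OF that f_diff[OF HU[OF that]]])
    \<comment> \<open>Tangent vectors over the same \<open>w\<close> differ only in the first
      component, by the increment of \<open>Dh\<close> on which \<open>Lt y' y\<close> acts.\<close>
    have "\<xi> w y' = \<xi> w y + (dd w h y' - dd w h y, 0)" by (simp add: \<xi>_def)
    hence F: "dd (\<xi> w y') f (H y) = dd (\<xi> w y) f (H y) + dd (dd w h y' - dd w h y, 0) f (H y)"
      and Gq: "dd (\<xi> w y') g (H y) = dd (\<xi> w y) g (H y) + dd (dd w h y' - dd w h y, 0) g (H y)"
      using linear_add[OF lin_fH[OF y]] linear_add[OF lin_gH[OF y]] by metis+
    have h1: "dd (dd (\<xi> w y') g (H y') - dd (\<xi> w y') g (H y)) h y' = dd (dd (\<xi> w y') g (H y')) h y'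
        - (dd (dd (\<xi> w y) g (H y)) h y' + dd (dd (dd w h y' - dd w h y, 0) g (H y)) h y')"
      unfolding Gq linear_diff[OF lin_h[OF y']] linear_add[OF lin_h[OF y']] ..
    show "N y' vs - N y vs = Lt y' y (iter_dd h vs y' - iter_dd h vs y)
        - (\<Sum>i<Suc 0. iter_dd h (vs[i := dd (vs ! i) G y]) y' - iter_dd h (vs[i := dd (vs ! i) G y]) y) + Err y' y vs"
      by (simp add: vs N_def Err_def Lt_def fN[OF y] fN[OF y'] dd_G[OF y] dd_G[OF y'] F h1)
  qed
  thus ?thesis by simp
qed

section \<open>Flow equations for derivatives of order two and higher\<close>

lemma Cb_h_field:
  assumes hl: "\<And>u. Cb j K (dd u h)" and "s \<le> j" "Cb s K X"
  shows "Cb s K (\<lambda>z. dd (X z) h z)"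
  using Cb_lin_field[where T = "\<lambda>x. dd x h", OF K(1) lin_h Cb_le[OF hl assms(2)] assms(3)] .

lemma Cb_L:
  assumes "\<And>u. Cb j K (dd u h)" "s \<le> r - 1" "s \<le> j"
  shows "Cb s K (\<lambda>z. Lt z z b)"
  unfolding Lt_def
  by (intro Cb_diff[OF K(1)] Cb_h_field[OF assms(1,3)] Cb_fH[OF assms(1)] Cb_gH[OF assms(1)])
     (use assms in auto)

lemma L_lin: "z \<in> K \<Longrightarrow> linear (\<lambda>w. Lt z z w)"
  using Lt_lin by simp

lemma slot_lin:
  assumes "\<And>u. Cb j K (dd u h)" "length vs \<le> Suc j" "i < length vs" "z \<in> K"
  shows "linear (\<lambda>x. iter_dd h (vs[i := x]) z)"
  by (rule multilin_linear[OF multilin_iter_dd_h[OF assms(1,2,4)] assms(3) refl])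

lemma second_lin:
  fixes \<Phi> :: "'b \<times> 'a \<Rightarrow> 'c::real_normed_vector"
  assumes "\<And>x. x \<in> U \<Longrightarrow> \<Phi> differentiable (at x)" "\<And>x. Cb (r - 1) U (dd x \<Phi>)" "z \<in> K"
  shows "linear (\<lambda>b. dd a (dd b \<Phi>) (H z))" "linear (\<lambda>a. dd a (dd b \<Phi>) (H z))"
proof -
  have d: "dd b \<Phi> differentiable (at x)" if "x \<in> U" for b x
    using Cb_differentiable[OF assms(2) _ that] r by simp
  show "linear (\<lambda>b. dd a (dd b \<Phi>) (H z))"
    by (rule linear_dd_param[OF U HU[OF assms(3)] linear_dd[OF assms(1)] d[OF HU[OF assms(3)]]])
  show "linear (\<lambda>a. dd a (dd b \<Phi>) (H z))" by (rule linear_dd[OF d[OF HU[OF assms(3)]]])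
qed

lemma Cb_second:
  fixes \<Phi> :: "'b \<times> 'a \<Rightarrow> 'c::real_normed_vector"
  assumes \<Phi>: "\<And>x. x \<in> U \<Longrightarrow> \<Phi> differentiable (at x)" "\<And>x. Cb (r - 1) U (dd x \<Phi>)"
    and hl: "\<And>u. Cb j K (dd u h)" and s: "s \<le> r - 2" "s \<le> j"
  shows "Cb s K (\<lambda>z. dd (\<xi> v z) (dd (\<xi> u z) \<Phi>) (H z))"
proof (rule Cb_lin_field[where T = "\<lambda>x z. dd x (dd (\<xi> u z) \<Phi>) (H z)" and X = "\<xi> v", OF K(1)])
  show "linear (\<lambda>x. dd x (dd (\<xi> u z) \<Phi>) (H z))" if "z \<in> K" for z by (rule second_lin[OF \<Phi> that])
  show "Cb s K (\<xi> v)" by (rule Cb_le[OF Cb_\<xi>[OF hl] s(2)])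
  show "Cb s K (\<lambda>z. dd a (dd (\<xi> u z) \<Phi>) (H z))" for a
  proof (rule Cb_lin_field[where T = "\<lambda>x z. dd a (dd x \<Phi>) (H z)" and X = "\<xi> u", OF K(1)])
    show "linear (\<lambda>x. dd a (dd x \<Phi>) (H z))" if "z \<in> K" for z by (rule second_lin[OF \<Phi> that])
    show "Cb s K (\<xi> u)" by (rule Cb_le[OF Cb_\<xi>[OF hl] s(2)])
    show "Cb s K (\<lambda>z. dd a (dd b \<Phi>) (H z))" for b
    proof (rule Cb_comp_H[OF hl])
      have "Cb (r - 1 - 1) U (dd a (dd b \<Phi>))" by (rule Cb_dd[OF \<Phi>(2)]) (use r in simp)
      thus "Cb s U (dd a (dd b \<Phi>))" by (rule Cb_le) (use s in simp)
    qed (use s in simp)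
  qed
qed

text \<open>The second component of \<open>H\<close> is the identity, so the second derivative of
  \<open>H\<close> is \<open>(D^2 h, 0)\<close>. It produces the last term; the other is the second
  derivative of \<open>\<Phi>\<close> on tangent vectors.\<close>

lemma dd_dd_comp_H:
  fixes \<Phi> :: "'b \<times> 'a \<Rightarrow> 'c::real_normed_vector"
  assumes \<Phi>: "\<And>x. x \<in> U \<Longrightarrow> \<Phi> differentiable (at x)" "\<And>x. Cb (r - 1) U (dd x \<Phi>)"
    and hl: "\<And>u. Cb 1 K (dd u h)" and z: "z \<in> K"
  shows "dd w (dd u (\<lambda>z. \<Phi> (H z))) z = dd (\<xi> w z) (dd (\<xi> u z) \<Phi>) (H z) + dd (dd w (dd u h) z, 0) \<Phi> (H z)"
proof -
  have d: "dd b \<Phi> differentiable (at x)" if "x \<in> U" for b x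
    using Cb_differentiable[OF \<Phi>(2) _ that] r by simp
  have du: "dd u h differentiable (at z)" by (rule Cb_differentiable[OF hl _ z]) simp
  have \<xi>': "(\<xi> u has_derivative (\<lambda>w. (dd w (dd u h) z, 0))) (at z)"
    unfolding \<xi>_def[abs_def] by (intro has_derivative_Pair has_derivative_dd du has_derivative_const)
  have "dd w (dd u (\<lambda>z. \<Phi> (H z))) z = dd w (\<lambda>z. dd (\<xi> u z) \<Phi> (H z)) z"
    by (rule dd_transform[OF K(1) z]) (rule dd_comp_H[OF _ \<Phi>(1)[OF HU]])
  also have "\<dots> = dd (dd w (\<xi> u) z) \<Phi> (H z) + dd w (\<lambda>y. dd (\<xi> u z) \<Phi> (H y)) z"
  proof (rule dd_lin_field[OF K(1) z])
    show "linear (\<lambda>x. dd x \<Phi> (H z))" if "z \<in> K" for z by (rule linear_dd[OF \<Phi>(1)[OF HU[OF that]]])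
    show "(\<lambda>z. dd b \<Phi> (H z)) differentiable (at z)" for b
      using differentiable_chain_at[OF H_diff[OF z] d[OF HU[OF z]]] by (simp add: o_def)
    show "\<xi> u differentiable (at z)" using \<xi>' by (rule differentiableI)
  qed
  also have "dd w (\<xi> u) z = (dd w (dd u h) z, 0)" using \<xi>' by (rule dd_eq)
  also have "dd w (\<lambda>y. dd (\<xi> u z) \<Phi> (H y)) z = dd (\<xi> w z) (dd (\<xi> u z) \<Phi>) (H z)"
    by (rule dd_comp_H[OF z d[OF HU[OF z]]])
  finally show ?thesis by (simp add: add.commute)
qed

text \<open>For two arguments, the remainder is what is left of the second derivative of
  $f(h(z), z) = Dh(z)\,G(z)$ when the terms containing $D^2 h$ and $D^3 h$ are removed.  Each further
  argument differentiates the previous equation; the terms in which the new derivative falls on the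
  top derivative of $h$ belong to the principal part \<open>flow_rhs\<close> and are left out.\<close>

primrec remainder :: "'a list \<Rightarrow> 'a \<Rightarrow> 'a \<Rightarrow> 'a \<Rightarrow> 'b" where
  "remainder [] v u = (\<lambda>z. dd (\<xi> v z) (dd (\<xi> u z) f) (H z) - dd (dd (\<xi> v z) (dd (\<xi> u z) g) (H z)) h z)"
| "remainder (w # us) v u = (\<lambda>z. dd w (\<lambda>y. Lt y y (iter_dd h (us @ [v, u]) z)) z
     - (\<Sum>i<length us + 2. iter_dd h ((us @ [v, u])[i := dd w (dd ((us @ [v, u]) ! i) G) z]) z)
     + dd w (remainder us v u) z)"

text \<open>The directions are split as \<open>us @ [v, u]\<close> because this form starts at order
  two; order one obeys the Riccati equation, given by \<open>flow_first\<close>.\<close>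

definition flow_rhs :: "'a list \<Rightarrow> 'a \<Rightarrow> 'a \<Rightarrow> 'a \<Rightarrow> 'b" where
  "flow_rhs us v u z = Lt z z (iter_dd h (us @ [v, u]) z)
     - (\<Sum>i<length us + 2. iter_dd h ((us @ [v, u])[i := dd ((us @ [v, u]) ! i) G z]) z) + remainder us v u z"

lemma Cb_slot:
  assumes hl: "\<And>u. Cb j K (dd u h)" and i: "i < length vs" and s: "s + length vs \<le> Suc j" and X: "Cb s K X"
  shows "Cb s K (\<lambda>z. iter_dd h (vs[i := X z]) z)"
proof (rule Cb_lin_field[where T = "\<lambda>x. iter_dd h (vs[i := x])", OF K(1) _ _ X])
  show "linear (\<lambda>x. iter_dd h (vs[i := x]) z)" if "z \<in> K" for z
    by (rule slot_lin[OF hl _ i that]) (use s in simp)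
  show "Cb s K (iter_dd h (vs[i := b]))" for b
    by (rule Cb_le[OF Cb_iter_dd[OF hl, of _ "Suc j - length vs"]]) (use i s in auto)
qed

text \<open>Order count: \<open>remainder us v u\<close> contains derivatives of \<open>f\<close>
  and \<open>g\<close> up to order \<open>length us + 2\<close>, but of \<open>h\<close> only up to
  \<open>length us + 1\<close>, one less than the derivative whose equation it belongs to.\<close>

lemma Cb_remainder:
  assumes hl: "\<And>u. Cb j K (dd u h)" and j: "1 \<le> j"
  shows "s + length us \<le> r - 2 \<Longrightarrow> s + length us \<le> j \<Longrightarrow> Cb s K (remainder us v u)"
proof (induction us arbitrary: s)
  case Nil
  have "Cb s K (\<lambda>z. dd (\<xi> v z) (dd (\<xi> u z) f) (H z))" "Cb s K (\<lambda>z. dd (\<xi> v z) (dd (\<xi> u z) g) (H z))"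
    using Nil Cb_second[OF f_diff f_Cr hl] Cb_second[OF g_diff g_Cr hl] by auto
  thus ?case unfolding remainder.simps
    using Nil by (intro Cb_diff[OF K(1)] Cb_h_field[OF hl]) auto
next
  case (Cons w us)
  let ?vs = "us @ [v, u]"
  have Lb: "Cb (Suc s) K (\<lambda>z. Lt z z b)" for b by (rule Cb_L[OF hl]) (use Cons.prems in auto)
  have 1: "Cb s K (\<lambda>z. dd w (\<lambda>y. Lt y y (iter_dd h ?vs z)) z)"
  proof (rule Cb_lin_field[where T = "\<lambda>x z. dd w (\<lambda>y. Lt y y x) z" and X = "iter_dd h ?vs", OF K(1)])
    show "linear (\<lambda>x. dd w (\<lambda>y. Lt y y x) z)" if "z \<in> K" for z
      by (rule linear_dd_param[OF K(1) that L_lin Cb_differentiable[OF Lb _ that]]) auto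
    show "Cb s K (\<lambda>z. dd w (\<lambda>y. Lt y y b) z)" for b using Cb_dd[OF Lb, of w b] by simp
    show "Cb s K (iter_dd h ?vs)"
      by (rule Cb_le[OF Cb_iter_dd[OF hl, of _ "j - Suc (length us)"]]) (use Cons.prems in auto)
  qed
  have 2: "Cb s K (\<lambda>z. iter_dd h (?vs[i := dd w (dd (?vs ! i) G) z]) z)" if "i < length us + 2" for i
  proof (rule Cb_slot[OF hl])
    have "Cb (Suc s) K (dd (?vs ! i) G)" by (rule Cb_dd_G[OF hl]) (use Cons.prems in auto)
    thus "Cb s K (dd w (dd (?vs ! i) G))" by simp
  qed (use that Cons.prems in auto)
  have "Cb (Suc s) K (remainder us v u)" by (rule Cons.IH) (use Cons.prems in auto)
  hence 3: "Cb s K (dd w (remainder us v u))" by simp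
  show ?case unfolding remainder.simps by (intro Cb_add[OF K(1)] Cb_diff[OF K(1)] Cb_sum[OF K(1)] 1 2 3) auto
qed

end

lemma flow_deriv_cong:
  assumes "\<And>z. z \<in> K \<Longrightarrow> N z = N' z" "flow_deriv K G F N"
  shows "flow_deriv K G F N'"
  unfolding flow_deriv_def
proof (intro allI impI)
  fix \<zeta> t assume "traj K G \<zeta>" "0 \<le> (t::real)"
  thus "((\<lambda>t. F (\<zeta> t)) has_vector_derivative N' (\<zeta> t)) (at t within {0..})"
    using flow_derivD[OF assms(2)] assms(1)[OF trajD(1)] by metis
qed

context invariant_graph
begin

lemma Cb_flow_rhs:
  assumes hl: "\<And>u. Cb j K (dd u h)" and s: "s + length us + 1 \<le> j" "s + length us \<le> r - 2"
  shows "Cb s K (flow_rhs us v u)"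
proof -
  let ?vs = "us @ [v, u]"
  have "Cb s K (\<lambda>z. Lt z z (iter_dd h ?vs z))"
  proof (rule Cb_lin_field[where T = "\<lambda>x z. Lt z z x" and X = "iter_dd h ?vs", OF K(1) L_lin])
    show "Cb s K (\<lambda>z. Lt z z b)" for b by (rule Cb_L[OF hl]) (use s in auto)
    show "Cb s K (iter_dd h ?vs)"
      by (rule Cb_le[OF Cb_iter_dd[OF hl, of _ "j - Suc (length us)"]]) (use s in auto)
  qed
  moreover have "Cb s K (\<lambda>z. iter_dd h (?vs[i := dd (?vs ! i) G z]) z)" if "i < length us + 2" for i
    by (rule Cb_slot[OF hl _ _ Cb_dd_G[OF hl]]) (use that s in auto)
  moreover have "Cb s K (remainder us v u)"
    by (rule Cb_remainder[OF hl]) (use s in auto)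
  ultimately show ?thesis
    unfolding flow_rhs_def[abs_def] by (intro Cb_add[OF K(1)] Cb_diff[OF K(1)] Cb_sum[OF K(1)]) auto
qed

text \<open>In \<open>D^2 (f \<circ> H)\<close> and in \<open>Dh\<close> applied to
  \<open>D^2 G\<close>, the parts with \<open>D^2 h\<close> combine to
  \<open>Lt z z (D^2 h)\<close>. Of the two slot terms, one comes from differentiating
  \<open>Dh\<close> in \<open>dd (dd u G z) h z\<close>, the other is the correction term of
  \<open>flow_deriv_dd\<close>.\<close>

lemma flow_base:
  assumes hl: "\<And>u. Cb 1 K (dd u h)"
  shows "flow_deriv K G (iter_dd h [v, u]) (flow_rhs [] v u)"
proof -
  let ?N = "\<lambda>z. dd u (\<lambda>z. f (H z)) z - dd (dd u G z) h z"
  have f1: "Cb 1 K (dd u (\<lambda>z. f (H z)))" and g1: "Cb 1 K (dd u G)" and h1: "Cb 1 K (\<lambda>z. dd (dd u G z) h z)"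
    using r by (auto intro!: Cb_dd_fH[OF hl] Cb_dd_G[OF hl] Cb_h_field[OF hl] simp del: One_nat_def)
  have N1: "Cb 1 K ?N" by (rule Cb_diff[OF K(1) f1 h1])
  have "flow_deriv K G (dd v (dd u h)) (\<lambda>z. dd v ?N z - dd (dd v G z) (dd u h) z)"
    by (rule flow_deriv_dd[OF K(1) ex_traj' C1b_G Cb_imp_C1b[OF hl] Cb_imp_C1b[OF N1] flow_first]) auto
  hence "flow_deriv K G (iter_dd h [v, u]) (\<lambda>z. dd v ?N z - dd (dd v G z) (dd u h) z)" by simp
  thus ?thesis
  proof (rule flow_deriv_cong[rotated])
    fix z assume z: "z \<in> K"

    have df: "dd u (\<lambda>z. f (H z)) differentiable (at z)" "(\<lambda>z. dd (dd u G z) h z) differentiable (at z)"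
      "dd u G differentiable (at z)" "\<And>b. dd b h differentiable (at z)"
      by (rule Cb_differentiable[OF f1 _ z] Cb_differentiable[OF h1 _ z] Cb_differentiable[OF g1 _ z] Cb_differentiable[OF hl _ z]; simp)+
    let ?Q = "dd v (dd u h) z"
    let ?f2 = "dd (\<xi> v z) (dd (\<xi> u z) f) (H z)" and ?g2 = "dd (\<xi> v z) (dd (\<xi> u z) g) (H z)"
    have 1: "dd v (dd u (\<lambda>z. f (H z))) z = ?f2 + dd (?Q, 0) f (H z)"
      by (rule dd_dd_comp_H[OF f_diff f_Cr hl z])
    have 2: "dd v (dd u G) z = ?g2 + dd (?Q, 0) g (H z)"
      using dd_dd_comp_H[OF g_diff g_Cr hl z, of v u] by (simp add: G_def[abs_def])
    have 3: "dd v (\<lambda>z. dd (dd u G z) h z) z = dd (dd v (dd u G) z) h z + dd v (dd (dd u G z) h) z"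
      by (rule dd_lin_field[where T = "\<lambda>x. dd x h", OF K(1) z lin_h df(4,3)])
    have 4: "dd (dd v (dd u G) z) h z = dd ?g2 h z + dd (dd (?Q, 0) g (H z)) h z"
      unfolding 2 by (rule linear_add[OF lin_h[OF z]])
    have s: "{..<2} = {0, 1::nat}" by auto
    show "dd v ?N z - dd (dd v G z) (dd u h) z = flow_rhs [] v u z"
      by (simp add: dd_diff[OF df(1,2)] 1 3 4 flow_rhs_def Lt_def s)
  qed
qed

lemma flow_step:
  assumes hl: "\<And>u. Cb j K (dd u h)" and j: "j = length us + 2" "j \<le> r - 1"
    and flow: "flow_deriv K G (iter_dd h (us @ [v, u])) (flow_rhs us v u)"
  shows "flow_deriv K G (iter_dd h (w # us @ [v, u])) (flow_rhs (w # us) v u)"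
proof -
  let ?vs = "us @ [v, u]"
  have N1: "Cb 1 K (flow_rhs us v u)" by (rule Cb_flow_rhs[OF hl]) (use j in auto)
  have V1: "Cb 1 K (iter_dd h ?vs)" by (rule Cb_iter_dd[OF hl]) (use j in auto)
  have "flow_deriv K G (dd w (iter_dd h ?vs)) (\<lambda>z. dd w (flow_rhs us v u) z - dd (dd w G z) (iter_dd h ?vs) z)"
    by (rule flow_deriv_dd[OF K(1) ex_traj' C1b_G Cb_imp_C1b[OF V1] Cb_imp_C1b[OF N1] flow]) auto
  hence "flow_deriv K G (iter_dd h (w # ?vs)) (\<lambda>z. dd w (flow_rhs us v u) z - dd (dd w G z) (iter_dd h ?vs) z)" by simp
  thus ?thesis
  proof (rule flow_deriv_cong[rotated])
    fix z assume z: "z \<in> K"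
    have Lb: "Cb 1 K (\<lambda>z. Lt z z b)" for b by (rule Cb_L[OF hl]) (use j r in auto)
    have Lb': "(\<lambda>z. Lt z z b) differentiable (at z)" for b by (rule Cb_differentiable[OF Lb _ z]) simp
    have V: "iter_dd h ?vs differentiable (at z)" by (rule Cb_differentiable[OF V1 _ z]) simp
    have LV1: "Cb 1 K (\<lambda>z. Lt z z (iter_dd h ?vs z))"
      by (rule Cb_lin_field[where T = "\<lambda>x z. Lt z z x", OF K(1) L_lin Lb V1])
    have LV: "(\<lambda>z. Lt z z (iter_dd h ?vs z)) differentiable (at z)" by (rule Cb_differentiable[OF LV1 _ z]) simp
    have G1: "Cb 1 K (dd x G)" for x by (rule Cb_dd_G[OF hl]) (use j r in auto)
    have Gd: "dd x G differentiable (at z)" for x by (rule Cb_differentiable[OF G1 _ z]) simp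
    let ?s = "\<lambda>i z. iter_dd h (?vs[i := dd (?vs ! i) G z]) z"
    have S: "?s i differentiable (at z)" if "i < length us + 2" for i
    proof -
      have "Cb 1 K (?s i)" by (rule Cb_slot[OF hl _ _ G1]) (use that j in auto)
      thus ?thesis by (rule Cb_differentiable[OF _ _ z]) simp
    qed
    have sumd: "(\<lambda>z. \<Sum>i<length us + 2. ?s i z) differentiable (at z)"
      by (rule differentiableI[OF has_derivative_sum[OF has_derivative_dd[OF S]]]) auto
    have R1: "Cb 1 K (remainder us v u)" by (rule Cb_remainder[OF hl]) (use j in auto)
    have R: "remainder us v u differentiable (at z)" by (rule Cb_differentiable[OF R1 _ z]) simp
    have LS: "(\<lambda>z. Lt z z (iter_dd h ?vs z) - (\<Sum>i<length us + 2. ?s i z)) differentiable (at z)"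
      by (rule differentiableI[OF has_derivative_diff[OF has_derivative_dd[OF LV] has_derivative_dd[OF sumd]]])
    have a: "dd w (\<lambda>z. Lt z z (iter_dd h ?vs z)) z = Lt z z (dd w (iter_dd h ?vs) z) + dd w (\<lambda>y. Lt y y (iter_dd h ?vs z)) z"
      by (rule dd_lin_field[where T = "\<lambda>x z. Lt z z x", OF K(1) z L_lin Lb' V])
    have b: "dd w (?s i) z = iter_dd h (?vs[i := dd w (dd (?vs ! i) G) z]) z + iter_dd h (w # ?vs[i := dd (?vs ! i) G z]) z"
      if "i < length us + 2" for i
    proof -
      have "dd w (?s i) z = iter_dd h (?vs[i := dd w (dd (?vs ! i) G) z]) z + dd w (iter_dd h (?vs[i := dd (?vs ! i) G z])) z"
      proof (rule dd_lin_field[where T = "\<lambda>x. iter_dd h (?vs[i := x])", OF K(1) z _ _ Gd])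
        show "linear (\<lambda>x. iter_dd h (?vs[i := x]) z)" if "z \<in> K" for z
          by (rule slot_lin[OF hl _ _ that]) (use j \<open>i < _\<close> in auto)
        show "iter_dd h (?vs[i := x]) differentiable (at z)" for x
          by (rule iter_dd_differentiable[OF hl _ z]) (use j in simp)
      qed
      thus ?thesis by simp
    qed
    have "dd w (flow_rhs us v u) z = dd w (\<lambda>z. Lt z z (iter_dd h ?vs z)) z - (\<Sum>i<length us + 2. dd w (?s i) z) + dd w (remainder us v u) z"
      unfolding flow_rhs_def[abs_def] dd_add[OF LS R] dd_diff[OF LV sumd] by (subst dd_sum) (auto intro: S)
    also have "\<dots> = Lt z z (dd w (iter_dd h ?vs) z) + dd w (\<lambda>y. Lt y y (iter_dd h ?vs z)) z
       - (\<Sum>i<length us + 2. iter_dd h (?vs[i := dd w (dd (?vs ! i) G) z]) z)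
       - (\<Sum>i<length us + 2. iter_dd h (w # ?vs[i := dd (?vs ! i) G z]) z) + dd w (remainder us v u) z"
      by (simp add: a b sum.distrib)
    finally have 1: "dd w (flow_rhs us v u) z = Lt z z (iter_dd h (w # ?vs) z) + remainder (w # us) v u z
       - (\<Sum>i<length us + 2. iter_dd h (w # ?vs[i := dd (?vs ! i) G z]) z)"
      by simp
    \<comment> \<open>The slot with index 0 belongs to the new direction \<open>w\<close> and is the
      correction term of \<open>flow_deriv_dd\<close>; the remaining slots are the old ones with
      \<open>w\<close> prepended.\<close>
    have 2: "(\<Sum>i<length (w # us) + 2. iter_dd h (((w # us) @ [v, u])[i := dd (((w # us) @ [v, u]) ! i) G z]) z)
      = dd (dd w G z) (iter_dd h ?vs) z + (\<Sum>i<length us + 2. iter_dd h (w # ?vs[i := dd (?vs ! i) G z]) z)"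
    proof -
      have l: "length (w # us) + 2 = Suc (length us + 2)" by simp
      show ?thesis unfolding l sum.lessThan_Suc_shift by simp
    qed
    show "dd w (flow_rhs us v u) z - dd (dd w G z) (iter_dd h ?vs) z = flow_rhs (w # us) v u z"
      unfolding 1 flow_rhs_def[of "w # us"] 2 by simp
  qed
qed

text \<open>From order two on the equation is linear in the top derivative, with coefficients of
  lower order. Since \<open>h\<close> is already twice differentiable here, \<open>L\<close> and
  \<open>DG\<close> are \<open>C1b\<close>, and both base points of \<open>Lt\<close> may be set to
  \<open>y\<close>.\<close>

lemma higher_smooth:
  assumes hl: "\<And>u. Cb j K (dd u h)" and j: "1 \<le> j" "j + 2 \<le> r"
    and flow: "\<And>us v u. length us + 2 = Suc j \<Longrightarrow> flow_deriv K G (iter_dd h (us @ [v, u])) (flow_rhs us v u)"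
    and vs: "length vs = Suc j"
  shows "C1b K (iter_dd h vs)"
proof -
  define R where "R vs = remainder (butlast (butlast vs)) (last (butlast vs)) (last vs)" for vs
  define N where "N z vs = Lt z z (iter_dd h vs z) - (\<Sum>i<Suc j. iter_dd h (vs[i := dd (vs ! i) G z]) z) + R vs z" for z vs
  \<comment> \<open>The changes of the coefficients \<open>L\<close> and \<open>DG\<close> and of
    the remainder. Each coefficient change is paired with the top derivative at \<open>y'\<close>,
    which is so far only continuous and bounded.\<close>
  define Err where "Err y' y vs = (Lt y' y' (iter_dd h vs y') - Lt y y (iter_dd h vs y'))
      - (\<Sum>i<Suc j. iter_dd h (vs[i := dd (vs ! i) G y' - dd (vs ! i) G y]) y') + (R vs y' - R vs y)" for y' y vs
  have split: "vs = butlast (butlast vs) @ [last (butlast vs), last vs]" "length (butlast (butlast vs)) + 2 = Suc j"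
    if "length vs = Suc j" for vs :: "'a list"
  proof -
    have "vs \<noteq> []" using that by auto
    moreover have "butlast vs \<noteq> []" using that j by (metis One_nat_def diff_Suc_1 length_butlast list.size(3) not_one_le_zero)
    ultimately show "vs = butlast (butlast vs) @ [last (butlast vs), last vs]"
      by (metis append.assoc append_Cons append_Nil append_butlast_last_id)
    show "length (butlast (butlast vs)) + 2 = Suc j" using that j by simp
  qed
  show ?thesis
  proof (rule section_smooth[where N = N and Err = Err and LL = "\<lambda>y' y. Lt y y", OF hl j(2) _ _ _ _ _ _ vs])
    show "linear (Lt y y)" if "y \<in> K" for y by (rule Lt_lin[OF that that])
    show "bet y * (norm w)\<^sup>2 \<le> w \<bullet> Lt y y w" if "y \<in> K" for y w by (rule Lt_coercive[OF that that])
  next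
    fix z and e :: real assume "z \<in> K" "0 < e"
    from Lt_cont[OF this] obtain d where "0 < d" and d: "close_maps K Lt e (ball z d)" by (elim exE conjE)
    show "\<exists>d>0. close_maps K (\<lambda>y' y. Lt y y) e (ball z d)"
      using \<open>0 < d\<close> d by (intro exI[of _ d] conjI ballI) blast+
  next
    fix vs :: "'a list" assume l: "length vs = Suc j"
    show "flow_deriv K G (iter_dd h vs) (\<lambda>z. N z vs)"
      using flow[OF split(2)[OF l], of "last (butlast vs)" "last vs"]
      unfolding flow_rhs_def[abs_def] split(1)[OF l, symmetric] split(2)[OF l] N_def R_def .
    have G1: "Cb 1 K (dd x G)" for x by (rule Cb_dd_G[OF hl]) (use j in auto)
    have R1: "Cb 1 K (R vs)" unfolding R_def by (rule Cb_remainder[OF hl]) (use j split(2)[OF l] in auto)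
    have L1: "C1b K (\<lambda>z. Lt z z b)" for b by (rule Cb_imp_C1b[OF Cb_L[OF hl, of 1]]) (use j in auto)
    have V0: "Cb 0 K (iter_dd h vs)" if "length vs = Suc j" for vs
      by (rule Cb_iter_dd[OF hl]) (use that in auto)
    show "\<exists>M. sd K (\<lambda>y' y. Err y' y vs) M"
      unfolding Err_def
    proof (rule ex_sd_add[OF ex_sd_diff[OF _ ex_sd_sum]])
      show "\<exists>M. sd K (\<lambda>y' y. Lt y' y' (iter_dd h vs y') - Lt y y (iter_dd h vs y')) M"
        by (rule sd_lin_left[where T = "\<lambda>x z. Lt z z x", OF L_lin L1 V0[OF l]])
      show "\<exists>M. sd K (\<lambda>y' y. R vs y' - R vs y) M"
        by (rule sd_C1b[OF K Cb_imp_C1b[OF R1]]) simp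
      fix i assume i: "i \<in> {..<Suc j}"
      show "\<exists>M. sd K (\<lambda>y' y. iter_dd h (vs[i := dd (vs ! i) G y' - dd (vs ! i) G y]) y') M"
      proof (rule sd_lin_right[where T = "\<lambda>x. iter_dd h (vs[i := x])"])
        show "linear (\<lambda>x. iter_dd h (vs[i := x]) z)" if "z \<in> K" for z
          by (rule slot_lin[OF hl _ _ that]) (use l i in auto)
        show "Cb 0 K (iter_dd h (vs[i := b]))" for b by (rule V0) (simp add: l)
        show "\<exists>M. sd K (\<lambda>y' y. dd (vs ! i) G y' - dd (vs ! i) G y) M"
          by (rule sd_C1b[OF K Cb_imp_C1b[OF G1]]) simp
      qed
    qed simp
    fix y y' assume y: "y \<in> K" and y': "y' \<in> K"
    have sl: "iter_dd h (vs[i := a - b]) z = iter_dd h (vs[i := a]) z - iter_dd h (vs[i := b]) z" if "i < Suc j" "z \<in> K" for i a b z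
      by (rule linear_diff[OF slot_lin[OF hl _ _ that(2)]]) (use l that in auto)
    show "N y' vs - N y vs = Lt y y (iter_dd h vs y' - iter_dd h vs y)
        - (\<Sum>i<Suc j. iter_dd h (vs[i := dd (vs ! i) G y]) y' - iter_dd h (vs[i := dd (vs ! i) G y]) y) + Err y' y vs"
    proof -
      have "(\<Sum>i<Suc j. iter_dd h (vs[i := dd (vs ! i) G y' - dd (vs ! i) G y]) y')
        = (\<Sum>i<Suc j. iter_dd h (vs[i := dd (vs ! i) G y']) y') - (\<Sum>i<Suc j. iter_dd h (vs[i := dd (vs ! i) G y]) y')"
        unfolding sum_subtractf[symmetric] by (intro sum.cong refl sl) (use y' in auto)
      thus ?thesis
        unfolding N_def Err_def linear_diff[OF L_lin[OF y]] sum_subtractf by simp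
    qed
  qed
qed

text \<open>Smoothness and flow equation are carried together: the equation at order
  \<open>j + 1\<close> makes that derivative \<open>C1b\<close>, and only then can the equation
  itself be differentiated once more. The guard \<open>1 \<le> j\<close> excludes order one, whose
  equation does not have the form \<open>flow_rhs\<close>.\<close>

theorem graph_smooth:
  assumes "j \<le> r - 1"
  shows "(\<forall>u. Cb j K (dd u h)) \<and>
    (1 \<le> j \<longrightarrow> (\<forall>us v u. length us + 2 = Suc j \<longrightarrow> flow_deriv K G (iter_dd h (us @ [v, u])) (flow_rhs us v u)))"
  using assms
proof (induction j)
  case 0
  then show ?case using h_C1 by simp
next
  case (Suc j)
  hence hl: "\<And>u. Cb j K (dd u h)"
    and flow: "\<And>us v u. 1 \<le> j \<Longrightarrow> length us + 2 = Suc j \<Longrightarrow> flow_deriv K G (iter_dd h (us @ [v, u])) (flow_rhs us v u)" by auto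
  have top: "C1b K (iter_dd h vs)" if l: "length vs = Suc j" for vs
  proof (cases "j = 0")
    case True
    then obtain u where "vs = [u]" using l by (auto simp: length_Suc_conv)
    thus ?thesis using first_smooth by simp
  next
    case False
    thus ?thesis using Suc.prems by (intro higher_smooth[OF hl _ _ flow l]) auto
  qed
  have hl': "Cb (Suc j) K (dd u h)" for u by (rule Cb_Suc_from_top[OF hl top])
  have "flow_deriv K G (iter_dd h (us @ [v, u])) (flow_rhs us v u)" if "length us + 2 = Suc (Suc j)" for us v u
  proof (cases us)
    case Nil
    thus ?thesis using flow_base[of v u] hl' that by simp
  next
    case (Cons w ws)
    have "flow_deriv K G (iter_dd h (w # ws @ [v, u])) (flow_rhs (w # ws) v u)"
      by (rule flow_step[OF hl' _ _ flow]) (use Suc.prems that Cons in auto)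
    thus ?thesis using Cons by simp
  qed
  thus ?case using hl' by blast
qed

end

section \<open>Families of multilinear derivatives\<close>

lemma ml_bound_from_basis:
  fixes M :: "'a::euclidean_space list \<Rightarrow> 'b::real_normed_vector"
  assumes "multilin k M" "\<And>bs. bs \<in> basis_lists k \<Longrightarrow> norm (M bs) \<le> e / (real (card (basis_lists k :: 'a list set)) + 1)" "0 \<le> e"
  shows "ml_bound k M e"
  unfolding ml_bound_def
proof (intro allI impI)
  fix vs :: "'a list" assume l: "length vs = k"
  let ?n = "real (card (basis_lists k :: 'a list set))"
  have "norm (M vs) \<le> (\<Sum>bs\<in>(basis_lists k :: 'a list set). e / (?n + 1)) * prod_list (map norm vs)"
    by (rule multilin_norm_le[OF assms(1) l assms(2)])
  also have "\<dots> \<le> e * prod_list (map norm vs)"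
  proof (rule mult_right_mono[OF _ prod_list_norm_nonneg])
    have "(\<Sum>bs\<in>(basis_lists k :: 'a list set). e / (?n + 1)) = e * (?n / (?n + 1))" by simp
    also have "\<dots> \<le> e * 1" using assms(3) by (intro mult_left_mono) auto
    finally show "(\<Sum>bs\<in>(basis_lists k :: 'a list set). e / (?n + 1)) \<le> e" by simp
  qed
  finally show "norm (M vs) \<le> e * prod_list (map norm vs)" .
qed

lemma higher_derivs_onD:
  assumes "higher_derivs_on r S f D"
  shows "x \<in> S \<Longrightarrow> D 0 x [] = f x"
    and "k \<le> r \<Longrightarrow> x \<in> S \<Longrightarrow> multilin k (D k x)"
    and "k < r \<Longrightarrow> x \<in> S \<Longrightarrow> 0 < e \<Longrightarrow> \<exists>d>0. \<forall>y\<in>S. norm (y - x) < d \<longrightarrow>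
        ml_bound k (\<lambda>vs. D k y vs - D k x vs - D (Suc k) x ((y - x) # vs)) (e * norm (y - x))"
    and "k \<le> r \<Longrightarrow> x \<in> S \<Longrightarrow> 0 < e \<Longrightarrow> \<exists>d>0. \<forall>y\<in>S. norm (y - x) < d \<longrightarrow>
        ml_bound k (\<lambda>vs. D k y vs - D k x vs) e"
proof -
  note a = assms[unfolded higher_derivs_on_def]
  show "x \<in> S \<Longrightarrow> D 0 x [] = f x" by (rule a[THEN conjunct1, THEN bspec])
  show "k \<le> r \<Longrightarrow> x \<in> S \<Longrightarrow> multilin k (D k x)"
    by (rule a[THEN conjunct2, THEN conjunct1, THEN spec, THEN mp, THEN bspec])
  show "k < r \<Longrightarrow> x \<in> S \<Longrightarrow> 0 < e \<Longrightarrow> \<exists>d>0. \<forall>y\<in>S. norm (y - x) < d \<longrightarrow>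
        ml_bound k (\<lambda>vs. D k y vs - D k x vs - D (Suc k) x ((y - x) # vs)) (e * norm (y - x))"
    by (rule a[THEN conjunct2, THEN conjunct2, THEN conjunct1, THEN spec, THEN mp, THEN bspec, THEN spec, THEN mp])
  show "k \<le> r \<Longrightarrow> x \<in> S \<Longrightarrow> 0 < e \<Longrightarrow> \<exists>d>0. \<forall>y\<in>S. norm (y - x) < d \<longrightarrow>
        ml_bound k (\<lambda>vs. D k y vs - D k x vs) e"
    by (rule a[THEN conjunct2, THEN conjunct2, THEN conjunct2, THEN spec, THEN mp, THEN bspec, THEN spec, THEN mp])
qed

lemma higher_derivs_has_derivative:
  fixes D :: "nat \<Rightarrow> 'a::euclidean_space \<Rightarrow> 'a list \<Rightarrow> 'b::real_normed_vector"
  assumes S: "open S" and D: "higher_derivs_on r S f D" and k: "k < r" and x: "x \<in> S" and l: "length vs = k"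
  shows "((\<lambda>y. D k y vs) has_derivative (\<lambda>v. D (Suc k) x (v # vs))) (at x)"
  unfolding has_derivative_at_alt
proof (intro conjI allI impI)
  have "linear (\<lambda>v. D (Suc k) x (v # vs))"
    by (rule multilin_head[OF higher_derivs_onD(2)[OF D] l]) (use k x in auto)
  thus "bounded_linear (\<lambda>v. D (Suc k) x (v # vs))" by (simp add: linear_conv_bounded_linear)
  fix e :: real assume e: "0 < e"
  let ?P = "prod_list (map norm vs)"
  have P: "0 < ?P + 1" using prod_list_norm_nonneg[of vs] by linarith
  hence "0 < e / (?P + 1)" using e by simp
  from higher_derivs_onD(3)[OF D k x this] obtain d where d: "0 < d" "\<And>y. y \<in> S \<Longrightarrow> norm (y - x) < d \<Longrightarrow>
      ml_bound k (\<lambda>vs. D k y vs - D k x vs - D (Suc k) x ((y - x) # vs)) (e / (?P + 1) * norm (y - x))" by blast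
  obtain d' where d': "0 < d'" "ball x d' \<subseteq> S" using S x open_contains_ball by blast
  show "\<exists>d>0. \<forall>y. norm (y - x) < d \<longrightarrow> norm (D k y vs - D k x vs - D (Suc k) x ((y - x) # vs)) \<le> e * norm (y - x)"
  proof (intro exI[of _ "min d d'"] conjI allI impI)
    fix y assume y: "norm (y - x) < min d d'"
    hence "y \<in> S" using d'(2) by (auto simp: dist_norm norm_minus_commute)
    from d(2)[OF this] y l have "norm (D k y vs - D k x vs - D (Suc k) x ((y - x) # vs)) \<le> e / (?P + 1) * norm (y - x) * ?P"
      by (simp add: ml_bound_def)
    also have "\<dots> = e * norm (y - x) * (?P / (?P + 1))" by simp
    also have "\<dots> \<le> e * norm (y - x) * 1" using e P by (intro mult_left_mono) auto
    finally show "norm (D k y vs - D k x vs - D (Suc k) x ((y - x) # vs)) \<le> e * norm (y - x)" by simp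
  qed (use d d' in simp)
qed

lemma higher_derivs_first:
  fixes f :: "'a::euclidean_space \<Rightarrow> 'b::real_normed_vector"
  assumes "open S" "higher_derivs_on r S f D" "1 \<le> r" "x \<in> S"
  shows "(f has_derivative (\<lambda>v. D 1 x [v])) (at x)"
proof -
  have "((\<lambda>y. D 0 y []) has_derivative (\<lambda>v. D 1 x [v])) (at x)"
    using higher_derivs_has_derivative[OF assms(1,2) _ assms(4), of 0 "[]"] assms(3) by simp
  thus ?thesis
    by (rule has_derivative_transform_within_open[OF _ assms(1,4)]) (rule higher_derivs_onD(1)[OF assms(2)])
qed

lemma higher_derivs_continuous:
  fixes D :: "nat \<Rightarrow> 'a::euclidean_space \<Rightarrow> 'a list \<Rightarrow> 'b::real_normed_vector"
  assumes D: "higher_derivs_on r S f D" and k: "k \<le> r" and l: "length vs = k"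
  shows "continuous_on S (\<lambda>y. D k y vs)"
  unfolding continuous_on_iff
proof (intro ballI allI impI)
  fix x and e :: real assume x: "x \<in> S" and e: "0 < e"
  let ?P = "prod_list (map norm vs)"
  have P: "0 < ?P + 1" using prod_list_norm_nonneg[of vs] by linarith
  hence "0 < e / (?P + 1)" using e by simp
  from higher_derivs_onD(4)[OF D k x this] obtain d where d: "0 < d" "\<And>y. y \<in> S \<Longrightarrow> norm (y - x) < d \<Longrightarrow>
      ml_bound k (\<lambda>vs. D k y vs - D k x vs) (e / (?P + 1))" by blast
  show "\<exists>d>0. \<forall>y\<in>S. dist y x < d \<longrightarrow> dist (D k y vs) (D k x vs) < e"
  proof (intro exI[of _ d] conjI d(1) ballI impI)
    fix y assume y: "y \<in> S" "dist y x < d"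
    have "norm (D k y vs - D k x vs) \<le> e / (?P + 1) * ?P"
      using d(2)[OF y(1)] y(2) l by (simp add: ml_bound_def dist_norm)
    also have "\<dots> = e * (?P / (?P + 1))" by simp
    also have "\<dots> < e * 1" using e P by (intro mult_strict_left_mono) auto
    finally show "dist (D k y vs) (D k x vs) < e" by (simp add: dist_norm)
  qed
qed

text \<open>The induction runs over the orders \<open>k\<close> with \<open>k + s = r\<close> and
  starts at \<open>k = 1\<close>, because \<open>Cr_bounded_on\<close> bounds the derivatives but
  not \<open>f\<close>. This is why the conclusion concerns \<open>dd v f\<close>.\<close>

lemma Cr_bounded_imp_Cb:
  fixes f :: "'a::euclidean_space \<Rightarrow> 'b::real_normed_vector"
  assumes S: "open S" and f: "Cr_bounded_on r S f" and r: "1 \<le> r"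
  shows "x \<in> S \<Longrightarrow> f differentiable (at x)" and "Cb (r - 1) S (dd v f)"
proof -
  obtain D where D: "higher_derivs_on r S f D" and B: "\<And>k. k \<in> {1..r} \<Longrightarrow> \<exists>B. \<forall>x\<in>S. ml_bound k (D k x) B"
    using f unfolding Cr_bounded_on_def by blast
  have f0: "(f has_derivative (\<lambda>v. D 1 x [v])) (at x)" if "x \<in> S" for x
    by (rule higher_derivs_first[OF S D r that])
  thus "x \<in> S \<Longrightarrow> f differentiable (at x)" by (auto intro: differentiableI)
  have "Cb s S (\<lambda>y. D k y vs)" if "k + s = r" "1 \<le> k" "length vs = k" for s k vs
    using that
  proof (induction s arbitrary: k vs)
    case 0
    obtain B where B: "\<And>x. x \<in> S \<Longrightarrow> ml_bound k (D k x) B" using B[of k] 0 by auto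
    have "\<forall>x\<in>S. norm (D k x vs) \<le> B * prod_list (map norm vs)" using B 0 by (auto simp: ml_bound_def)
    thus ?case using higher_derivs_continuous[OF D _ 0(3)] 0 by (auto simp: bounded_iff)
  next
    case (Suc s)
    obtain B where B: "\<And>x. x \<in> S \<Longrightarrow> ml_bound k (D k x) B" using B[of k] Suc.prems by auto
    have "\<forall>x\<in>S. norm (D k x vs) \<le> B * prod_list (map norm vs)" using B Suc.prems by (auto simp: ml_bound_def)
    hence "bounded ((\<lambda>y. D k y vs) ` S)" by (auto simp: bounded_iff)
    moreover have der: "((\<lambda>y. D k y vs) has_derivative (\<lambda>v. D (Suc k) x (v # vs))) (at x)" if "x \<in> S" for x
      by (rule higher_derivs_has_derivative[OF S D _ that]) (use Suc.prems in auto)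
    have "Cb s S (dd v (\<lambda>y. D k y vs))" for v
    proof (rule Cb_cong[OF S])
      show "Cb s S (\<lambda>y. D (Suc k) y (v # vs))" by (rule Suc.IH) (use Suc.prems in auto)
      show "D (Suc k) x (v # vs) = dd v (\<lambda>y. D k y vs) x" if "x \<in> S" for x
        using dd_eq[OF der[OF that]] by simp
    qed
    ultimately show ?case using der by (auto intro: differentiableI)
  qed
  from this[of 1 "r - 1" "[v]"] r have "Cb (r - 1) S (\<lambda>y. D 1 y [v])" by simp
  thus "Cb (r - 1) S (dd v f)"
    by (rule Cb_cong[OF S, rotated]) (simp add: dd_eq[OF f0])
qed

context invariant_graph
begin

text \<open>Back from iterated directional derivatives to multilinear maps: for each basis list
  there is a radius, the least of these finitely many works for all, and multilinearity extends the
  estimate to every argument list.\<close>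

theorem Cr_bounded: "Cr_bounded_on r K h"
proof -
  have hl: "Cb (r - 1) K (dd u h)" for u using graph_smooth[of "r - 1"] by simp
  have diff: "iter_dd h vs differentiable (at z)" if "length vs < r" "z \<in> K" for vs z
    by (rule iter_dd_differentiable[OF hl _ that(2)]) (use that r in simp)
  have ml: "multilin k (\<lambda>vs. iter_dd h vs z)" if "k \<le> r" "z \<in> K" for k z
    by (rule multilin_iter_dd_h[OF hl _ that(2)]) (use that r in simp)
  have cont: "continuous_on K (iter_dd h vs)" if "length vs \<le> r" for vs
  proof (cases "vs = []")
    case True
    thus ?thesis using h_diff by (simp add: continuous_at_imp_continuous_on differentiable_imp_continuous_within)
  next
    case False
    have "Cb (r - length vs) K (iter_dd h vs)" by (rule Cb_iter_dd[OF hl]) (use that False r in auto)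
    thus ?thesis by (rule Cb_continuous)
  qed
  have pos: "0 < e / (real n + 1)" if "0 < e" for e :: real and n :: nat using that by (simp add: add_nonneg_pos)
  define D where "D k z vs = iter_dd h vs z" for k :: nat and z vs
  have "higher_derivs_on r K h D"
    unfolding higher_derivs_on_def
  proof (intro conjI ballI allI impI)
    show "D 0 x [] = h x" for x by (simp add: D_def)
    show "multilin k (D k x)" if "k \<le> r" "x \<in> K" for k x unfolding D_def[abs_def] by (rule ml[OF that])
  next
    fix k x and e :: real assume k: "k < r" and x: "x \<in> K" and e: "0 < e"
    let ?e = "e / (real (card (basis_lists k :: 'a list set)) + 1)"
    let ?P = "\<lambda>bs d. \<forall>y. norm (y - x) < d \<longrightarrow> norm (iter_dd h bs y - iter_dd h bs x - dd (y - x) (iter_dd h bs) x) \<le> ?e * norm (y - x)"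
    have "\<exists>d>0. \<forall>bs\<in>basis_lists k. ?P bs d"
    proof (rule finite_min_radius[OF finite_basis_lists])
      fix bs :: "'a list" assume "bs \<in> basis_lists k"
      hence "iter_dd h bs differentiable (at x)" using k x by (intro diff) (auto simp: basis_lists_def)
      from has_derivative_dd[OF this] pos[OF e] show "\<exists>d>0. ?P bs d"
        unfolding has_derivative_at_alt by blast
    qed force
    then obtain d where d: "0 < d" "\<And>bs. bs \<in> basis_lists k \<Longrightarrow> ?P bs d" by blast
    show "\<exists>d>0. \<forall>y\<in>K. norm (y - x) < d \<longrightarrow>
        ml_bound k (\<lambda>vs. D k y vs - D k x vs - D (Suc k) x ((y - x) # vs)) (e * norm (y - x))"
    proof (intro exI[of _ d] conjI d(1) ballI impI)
      fix y assume y: "y \<in> K" and n: "norm (y - x) < d"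
      show "ml_bound k (\<lambda>vs. D k y vs - D k x vs - D (Suc k) x ((y - x) # vs)) (e * norm (y - x))"
      proof (rule ml_bound_from_basis)
        show "multilin k (\<lambda>vs. D k y vs - D k x vs - D (Suc k) x ((y - x) # vs))"
          unfolding D_def using k x y by (intro multilin_diff multilin_Cons ml) auto
        show "norm (D k y bs - D k x bs - D (Suc k) x ((y - x) # bs)) \<le> e * norm (y - x) / (real (card (basis_lists k :: 'a list set)) + 1)"
          if "bs \<in> basis_lists k" for bs
          using d(2)[OF that] n by (simp add: D_def)
        show "0 \<le> e * norm (y - x)" using e by simp
      qed
    qed
  next
    fix k x and e :: real assume k: "k \<le> r" and x: "x \<in> K" and e: "0 < e"
    let ?e = "e / (real (card (basis_lists k :: 'a list set)) + 1)"
    let ?P = "\<lambda>bs d. \<forall>y\<in>K. norm (y - x) < d \<longrightarrow> norm (iter_dd h bs y - iter_dd h bs x) \<le> ?e"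
    have "\<exists>d>0. \<forall>bs\<in>basis_lists k. ?P bs d"
    proof (rule finite_min_radius[OF finite_basis_lists])
      fix bs :: "'a list" assume "bs \<in> basis_lists k"
      hence "continuous_on K (iter_dd h bs)" using k by (intro cont) (auto simp: basis_lists_def)
      from this[unfolded continuous_on_iff, rule_format, OF x pos[OF e]] show "\<exists>d>0. ?P bs d"
        by (metis dist_norm less_imp_le)
    qed force
    then obtain d where d: "0 < d" "\<And>bs. bs \<in> basis_lists k \<Longrightarrow> ?P bs d" by blast
    show "\<exists>d>0. \<forall>y\<in>K. norm (y - x) < d \<longrightarrow> ml_bound k (\<lambda>vs. D k y vs - D k x vs) e"
    proof (intro exI[of _ d] conjI d(1) ballI impI)
      fix y assume y: "y \<in> K" and n: "norm (y - x) < d"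
      show "ml_bound k (\<lambda>vs. D k y vs - D k x vs) e"
      proof (rule ml_bound_from_basis)
        show "multilin k (\<lambda>vs. D k y vs - D k x vs)"
          unfolding D_def using k x y by (intro multilin_diff ml) auto
        show "norm (D k y bs - D k x bs) \<le> ?e" if "bs \<in> basis_lists k" for bs
          using d(2)[OF that] n y by (simp add: D_def)
      qed (use e in simp)
    qed
  qed
  moreover have "\<exists>B. \<forall>x\<in>K. ml_bound k (D k x) B" if k: "k \<in> {1..r}" for k
  proof -
    have "Cb (k - 1) K (dd u h)" for u by (rule Cb_le[OF hl]) (use k in auto)
    from iter_dd_bound[OF this] obtain S where "\<And>z vs. z \<in> K \<Longrightarrow> length vs = Suc (k - 1) \<Longrightarrow> norm (iter_dd h vs z) \<le> S * prod_list (map norm vs)"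
      by metis
    thus ?thesis using k by (auto simp: ml_bound_def D_def)
  qed
  ultimately show ?thesis unfolding Cr_bounded_on_def by blast
qed

end

section \<open>From the hypotheses to the invariant graph\<close>

lemma continuous_on_onorm_partial:
  fixes g :: "'b::euclidean_space \<times> 'a::euclidean_space \<Rightarrow> 'a"
  assumes U: "open U" and g: "C1b U g"
  shows "continuous_on U (\<lambda>x. onorm (\<lambda>a. dd (a, 0) g x))"
  unfolding continuous_on_eq_continuous_at[OF U] continuous_at_eps_delta
proof (intro ballI allI impI)
  fix x and e :: real assume x: "x \<in> U" and e: "0 < e"
  hence e2: "0 < e / 2" by simp
  have lin: "bounded_linear (\<lambda>a. dd (a, 0) g y)" if "y \<in> U" for y
    using linear_compose[of "\<lambda>a. (a, 0)" "\<lambda>x. dd x g y"] linear_dd[of g y] g that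
    by (simp add: C1b_def o_def linear_conv_bounded_linear[symmetric] linear_iff)
  from dd_locally_close[OF U g x e2] obtain d where d: "0 < d"
    and dU: "\<And>y. y \<in> ball x d \<Longrightarrow> y \<in> U"
    and dd: "\<And>y y' v. y \<in> ball x d \<Longrightarrow> y' \<in> ball x d \<Longrightarrow> norm (dd v g y - dd v g y') \<le> e / 2 * norm v" by blast
  have le: "onorm (\<lambda>a. dd (a, 0) g y) \<le> onorm (\<lambda>a. dd (a, 0) g y') + e / 2" if "y \<in> ball x d" "y' \<in> ball x d" for y y'
  proof (rule onorm_le)
    fix a
    have "norm (dd (a, 0) g y) \<le> norm (dd (a, 0) g y') + norm (dd (a, 0) g y - dd (a, 0) g y')"
      by (rule norm_triangle_sub)
    also have "\<dots> \<le> onorm (\<lambda>a. dd (a, 0) g y') * norm a + e / 2 * norm a"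
      using dd[OF that, of "(a, 0)"] by (intro add_mono onorm[OF lin[OF dU[OF that(2)]]]) (simp add: norm_Pair)
    finally show "norm (dd (a, 0) g y) \<le> (onorm (\<lambda>a. dd (a, 0) g y') + e / 2) * norm a" by (simp add: distrib_right)
  qed
  show "\<exists>d>0. \<forall>y. dist y x < d \<longrightarrow> dist (onorm (\<lambda>a. dd (a, 0) g y)) (onorm (\<lambda>a. dd (a, 0) g x)) < e"
  proof (intro exI[of _ d] conjI d allI impI)
    fix y assume "dist y x < d"
    hence "y \<in> ball x d" "x \<in> ball x d" using d by (auto simp: dist_commute)
    from le[OF this] le[OF this(2,1)] e
    show "dist (onorm (\<lambda>a. dd (a, 0) g y)) (onorm (\<lambda>a. dd (a, 0) g x)) < e" by (simp add: dist_real_def abs_if)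
  qed
qed

text \<open>Invariance supplies one trajectory through each point of the graph, and its second
  component solves the reduced equation. Comparing the two expressions for the derivative of
  \<open>h\<close> at time 0 gives the tangency identity \<open>Dh(z) g(h z, z) = f(h z, z)\<close>;
  the chain rule then yields the flow derivative along an arbitrary trajectory.\<close>

lemma pos_invariant_graph:
  fixes h :: "'a::euclidean_space \<Rightarrow> 'b::euclidean_space"
  assumes inv: "pos_invariant (\<lambda>x. (f x, g x)) ((\<lambda>z. (h z, z)) ` K)"
    and h: "\<And>z. z \<in> K \<Longrightarrow> h differentiable (at z)"
  shows "z \<in> K \<Longrightarrow> \<exists>\<zeta>. \<zeta> 0 = z \<and> traj K (\<lambda>z. g (h z, z)) \<zeta>"
    and "flow_deriv K (\<lambda>z. g (h z, z)) h (\<lambda>z. f (h z, z))"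
proof -
  let ?G = "\<lambda>z. g (h z, z)"
  have lift: "\<exists>\<zeta>. \<zeta> 0 = z \<and> traj K ?G \<zeta> \<and> ((\<lambda>t. h (\<zeta> t)) has_vector_derivative f (h z, z)) (at 0 within {0..})" if z: "z \<in> K" for z
  proof -
    obtain \<phi> where \<phi>: "\<phi> 0 = (h z, z)"
      "\<And>t. 0 \<le> t \<Longrightarrow> (\<phi> has_vector_derivative (f (\<phi> t), g (\<phi> t))) (at t within {0..})"
      "\<And>t. 0 \<le> t \<Longrightarrow> \<phi> t \<in> (\<lambda>z. (h z, z)) ` K"
      using inv z unfolding pos_invariant_def by fast
    define \<zeta> where "\<zeta> t = snd (\<phi> t)" for t :: real
    have \<zeta>: "\<zeta> t \<in> K" "\<phi> t = (h (\<zeta> t), \<zeta> t)" if "0 \<le> t" for t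
      using \<phi>(3)[OF that] by (auto simp: \<zeta>_def)
    have "(\<zeta> has_vector_derivative ?G (\<zeta> t)) (at t within {0..})" if "0 \<le> t" for t
    proof -
      have "g (\<phi> t) = ?G (\<zeta> t)" by (rule arg_cong[OF \<zeta>(2)[OF that]])
      thus ?thesis
        using bounded_linear.has_vector_derivative[OF bounded_linear_snd \<phi>(2)[OF that]]
        by (simp add: \<zeta>_def[abs_def])
    qed
    hence "traj K ?G \<zeta>" using \<zeta>(1) by (simp add: traj_def)
    moreover have "((\<lambda>t. fst (\<phi> t)) has_vector_derivative f (h z, z)) (at 0 within {0..})"
      using bounded_linear.has_vector_derivative[OF bounded_linear_fst \<phi>(2)[of 0]] \<phi>(1) by simp
    hence "((\<lambda>t. h (\<zeta> t)) has_vector_derivative f (h z, z)) (at 0 within {0..})"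
      by (rule has_vector_derivative_transform[rotated 2]) (auto simp: \<zeta>(2))
    moreover have "\<zeta> 0 = z" using \<phi>(1) by (simp add: \<zeta>_def)
    ultimately show ?thesis by blast
  qed
  thus "z \<in> K \<Longrightarrow> \<exists>\<zeta>. \<zeta> 0 = z \<and> traj K ?G \<zeta>" by blast
  have eq: "dd (?G z) h z = f (h z, z)" if z: "z \<in> K" for z
  proof -
    obtain \<zeta> where \<zeta>: "\<zeta> 0 = z" "traj K ?G \<zeta>" "((\<lambda>t. h (\<zeta> t)) has_vector_derivative f (h z, z)) (at 0 within {0..})"
      using lift[OF z] by blast
    have "((\<lambda>t. h (\<zeta> t)) has_vector_derivative dd (?G z) h (\<zeta> 0)) (at 0 within {0..})"
      using trajD(2)[OF \<zeta>(2), of 0] \<zeta>(1) h[OF z] by (intro has_vector_derivative_chain_dd) auto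
    thus ?thesis using vector_derivative_unique_within[OF at_0_halfline_nontriv _ \<zeta>(3)] \<zeta>(1) by simp
  qed
  show "flow_deriv K ?G h (\<lambda>z. f (h z, z))"
    unfolding flow_deriv_def
  proof (intro allI impI)
    fix \<zeta> and t :: real assume tr: "traj K ?G \<zeta>" and t: "0 \<le> t"
    show "((\<lambda>t. h (\<zeta> t)) has_vector_derivative f (h (\<zeta> t), \<zeta> t)) (at t within {0..})"
      using has_vector_derivative_chain_dd[OF h[OF trajD(1)[OF tr t]] trajD(2)[OF tr t]] eq[OF trajD(1)[OF tr t]] by simp
  qed
qed

theorem theorem1p2:
  fixes f :: "(real^'n) \<times> (real^'m) \<Rightarrow> real^'n"
    and g :: "(real^'n) \<times> (real^'m) \<Rightarrow> real^'m"
    and h0 :: "real^'m \<Rightarrow> real^'n"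
    and K0 :: "(real^'m) set"
    and U0 :: "((real^'n) \<times> (real^'m)) set"
    and \<alpha> ell :: "(real^'n) \<times> (real^'m) \<Rightarrow> real"
    and \<eta> cr :: real
    and r :: nat
  assumes r: "r \<ge> 2"
    \<comment> \<open>Hypothesis 4\<close>
    and K0_open: "open K0" and K0_convex: "convex K0"
    and h0_C1: "Cr_on 1 K0 h0"
    and eta_pos: "\<eta> > 0"
    and Dh0: "\<forall>z\<in>K0. onorm (frechet_derivative h0 (at z)) < \<eta>"
    \<comment> \<open>Hypothesis 5\<close>
    and U0_open: "open U0"
    and U0_nbhd: "(\<lambda>z. (h0 z, z)) ` K0 \<subseteq> U0"
    and f_Cr: "Cr_bounded_on r U0 f"
    and g_Cr: "Cr_bounded_on r U0 g"
    and alpha_cont: "continuous_on U0 \<alpha>" and alpha_pos: "\<forall>x\<in>U0. \<alpha> x > 0"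
    and ell_cont: "continuous_on U0 ell" and ell_nonneg: "\<forall>x\<in>U0. ell x \<ge> 0"
    and cr_pos: "cr > 0"
    and Daf: "\<forall>x\<in>U0. \<forall>a'::real^'n.
                 inner a' (frechet_derivative f (at x) (a', 0)) \<ge> \<alpha> x * (norm a')\<^sup>2"
    and Dzg: "\<forall>x\<in>U0. \<forall>z'::real^'m.
                 inner z' (frechet_derivative g (at x) (0, z')) \<le> ell x * (norm z')\<^sup>2"
    and gap: "\<forall>x\<in>U0. \<alpha> x \<ge> real r * ell x
                 + real (r + 1) * \<eta> * onorm (\<lambda>a'::real^'n. frechet_derivative g (at x) (a', 0)) + cr"
    \<comment> \<open>positive invariance of the graph\<close>
    and invariant: "pos_invariant (\<lambda>x. (f x, g x)) ((\<lambda>z. (h0 z, z)) ` K0)"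
  shows "Cr_bounded_on r K0 h0"
proof -
  have r1: "1 \<le> r" using r by simp
  note f' = Cr_bounded_imp_Cb[OF U0_open f_Cr r1] and g' = Cr_bounded_imp_Cb[OF U0_open g_Cr r1]
  obtain D where D: "higher_derivs_on 1 K0 h0 D" using h0_C1 by (auto simp: Cr_on_def)
  have h_der: "(h0 has_derivative (\<lambda>v. D 1 z [v])) (at z)" if "z \<in> K0" for z
    by (rule higher_derivs_first[OF K0_open D order_refl that])
  have h_diff: "h0 differentiable (at z)" if "z \<in> K0" for z using h_der[OF that] by (rule differentiableI)
  have h_bound: "norm (dd u h0 z) \<le> \<eta> * norm u" if "z \<in> K0" for u z
  proof -
    have "bounded_linear (\<lambda>u. dd u h0 z)" using has_derivative_dd[OF h_diff[OF that]] by (rule has_derivative_bounded_linear)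
    from onorm[OF this, of u] have "norm (dd u h0 z) \<le> onorm (\<lambda>u. dd u h0 z) * norm u" .
    also have "\<dots> \<le> \<eta> * norm u"
      using bspec[OF Dh0 that] by (intro mult_right_mono) (auto simp: dd_def)
    finally show ?thesis .
  qed
  \<comment> \<open>Only \<open>C1b\<close> is available for \<open>g\<close>, since Hypothesis 5
    bounds its derivatives but not \<open>g\<close> itself.\<close>
  have g1: "C1b U0 g" unfolding C1b_def using g'(1) Cb_le[OF g'(2), of 0] by simp
  interpret graph: invariant_graph K0 h0 f g U0 \<alpha> ell "\<lambda>x. onorm (\<lambda>a. dd (a, 0) g x)" \<eta> cr r
  proof (rule invariant_graph.intro)
    show "Cb 0 K0 (dd u h0)" for u
    proof -
      have "continuous_on K0 (dd u h0)"
        by (rule continuous_on_eq[OF higher_derivs_continuous[OF D order_refl, of "[u]"]])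
           (simp_all add: dd_eq[OF h_der])
      moreover have "bounded (dd u h0 ` K0)" using h_bound by (auto simp: bounded_iff)
      ultimately show ?thesis by simp
    qed
    show "(h0 z, z) \<in> U0" if "z \<in> K0" for z using U0_nbhd that by auto
    show "continuous_on U0 (\<lambda>x. onorm (\<lambda>a. dd (a, 0) g x))" by (rule continuous_on_onorm_partial[OF U0_open g1])
    have bl: "bounded_linear (\<lambda>a. dd (a, 0) g x)" if "x \<in> U0" for x
      using linear_compose[of "\<lambda>a. (a, 0)" "\<lambda>v. dd v g x"] linear_dd[OF g'(1)[OF that]]
      by (simp add: o_def linear_conv_bounded_linear[symmetric] linear_iff)
    show "0 \<le> onorm (\<lambda>a. dd (a, 0) g x)" if "x \<in> U0" for x by (rule onorm_pos_le[OF bl[OF that]])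
    show "norm (dd (a, 0) g x) \<le> onorm (\<lambda>a. dd (a, 0) g x) * norm a" if "x \<in> U0" for x a by (rule onorm[OF bl[OF that]])
    show "\<alpha> x * (norm a)\<^sup>2 \<le> a \<bullet> dd (a, 0) f x" if "x \<in> U0" for x a using Daf that by (simp add: dd_def)
    show "v \<bullet> dd (0, v) g x \<le> ell x * (norm v)\<^sup>2" if "x \<in> U0" for x v using Dzg that by (simp add: dd_def)
    show "real r * ell x + (real r + 1) * \<eta> * onorm (\<lambda>a. dd (a, 0) g x) + cr \<le> \<alpha> x" if "x \<in> U0" for x
      using bspec[OF gap that] by (simp add: dd_def add.commute)
    show "\<exists>\<zeta>. \<zeta> 0 = z \<and> traj K0 (\<lambda>z. g (h0 z, z)) \<zeta>" if "z \<in> K0" for z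
      by (rule pos_invariant_graph(1)[OF invariant h_diff that])
    show "flow_deriv K0 (\<lambda>z. g (h0 z, z)) h0 (\<lambda>z. f (h0 z, z))"
      by (rule pos_invariant_graph(2)[OF invariant h_diff])
    show "0 \<le> ell x" if "x \<in> U0" for x using ell_nonneg that by simp
  qed (fact r K0_open K0_convex h_diff eta_pos h_bound U0_open f' g' alpha_cont ell_cont cr_pos)+
  show ?thesis by (rule graph.Cr_bounded)
qed

end
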